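(* For every $d \geq 3$ there exist positive reals $(\epsilon_n)_{n \geq 3}$ with $\epsilon_n = (1/2)^{o(n)}$ (that is, $\log_2(1/\epsilon_n) = o(n)$ as $n \to \infty$) such that for every $n \geq 3$ the following holds: every finite set $\mathcal{X} \subset \mathbb{R}^d$ in general position with $|\mathcal{X}| \geq ES_3(8n)$ contains a collection of $n$ subsets $X_1, \ldots, X_n \subset \mathcal{X}$ which is in convex position and satisfies $|X_i| \geq \epsilon_n |\mathcal{X}|$ for all $i = 1, \ldots, n$.
   Context: A set $X \subset \mathbb{R}^d$ with $|X| \geq d+1$ is in general position if no $d+1$ points of $X$ lie on a common affine hyperplane. A finite point set is in convex position if its points are the vertices of a convex polytope. $ES_d(n)$ denotes the smallest integer $N$ such that every set of $N$ points in general position in $\mathbb{R}^d$ contains $n$ points in convex position. A collection of sets $X_1, \ldots, X_n \subset \mathbb{R}^d$ is in convex position if for every $i = 1, \ldots, n$ the convex hulls $\mathrm{conv}(X_i)$ and $\mathrm{conv}(\bigcup_{j \neq i} X_j)$ are disjoint. *)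

theory Defs
  imports "HOL-Analysis.Analysis" "HOL-Library.Landau_Symbols"
begin

(* The size condition belongs to the notion: without it every set of at most DIM('a) points
   (three collinear points in dimension 3, say) would vacuously be in general position. *)
definition general_position :: "'a::euclidean_space set \<Rightarrow> bool" where
  "general_position X \<longleftrightarrow>
     (finite X \<longrightarrow> card X \<ge> DIM('a) + 1) \<and>
     \<not> (\<exists>S a b. S \<subseteq> X \<and> card S = DIM('a) + 1 \<and> a \<noteq> 0 \<and> S \<subseteq> {x. a \<bullet> x = b})"

definition convex_position :: "'a::euclidean_space set \<Rightarrow> bool" where
  "convex_position P \<longleftrightarrow> (\<exists>K. polytope K \<and> P = {v. v extreme_point_of K})"

(* The dimension d is the dimension of the type 'a.  Since sets of at most d points are never
   in general position, N ranges over N >= d + 1; otherwise N = 0 would qualify vacuously. *)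
definition ES :: "'a::euclidean_space itself \<Rightarrow> nat \<Rightarrow> nat" where
  "ES _ n = (LEAST N. N \<ge> DIM('a) + 1 \<and>
     (\<forall>X::'a set. finite X \<and> card X = N \<and> general_position X \<longrightarrow>
        (\<exists>P\<subseteq>X. card P = n \<and> convex_position P)))"

definition family_convex_position :: "'i set \<Rightarrow> ('i \<Rightarrow> 'a::euclidean_space set) \<Rightarrow> bool" where
  "family_convex_position I X \<longleftrightarrow>
     (\<forall>i\<in>I. convex hull (X i) \<inter> convex hull (\<Union>j\<in>I - {i}. X j) = {})"

end

theory Submission
  imports "HOL-Library.Ramsey" "HOL-Real_Asymp.Real_Asymp" Defs
begin

text \<open>
  A generic projection reduces everything to \<open>\<real>\<^sup>3\<close>. There, the main point is that for every
  \<open>\<delta> > 0\<close> and large \<open>n\<close>, any \<open>2\<^bsup>\<delta>n\<^esup>\<close> points in general position contain \<open>n\<close> points each of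
  which is cut off from the others by a plane through three points of the set.

  By Ramsey's theorem and a counting argument there are boundedly many clusters, each of them a
  constant fraction of the set, which lie like points on the moment curve with respect to boundedly
  many single points between them. If, in a projection from a single point \<open>q\<close>, the lines through
  two points of a cluster leave all other clusters on one side, then by the cups-caps theorem this
  cluster contributes a convex chain of linear length bulging away from the others (or already \<open>n\<close>
  points bulging towards them), and the chains of different clusters combine. As boundedly many
  clusters, independent of \<open>n\<close>, suffice, it remains to find enough clusters with such a \<open>q\<close>. For a pair
  of points in a cluster, \<open>q\<close> exists unless the direction of the pair lies in the cone spanned by the
  clusters under consideration; whether it does depends only on the signs of the pair with respect
  to two axes through single points, one joining the first point to the right neighbour and one
  joining the left neighbour to the last point. Each such sign is a total order on the cluster, so
  it can be made to agree with another one, or to disagree, on a large part of the cluster. Asking for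
  agreement with unbalanced sizes, either enough clusters succeed at once, or a whole group of
  clusters fails at almost no cost; iterating inside such groups leaves a chain of clusters which
  succeed for the opposite reason.

  The positive fraction version follows by counting: fixing the points that span the planes, the cut
  off points may vary independently within large sets.
\<close>

section \<open>Chains\<close>

lemma totalp_on_insert_below:
  assumes "finite Z" "Z \<noteq> {}" "transp_on Z P" "asymp_on Z P"
    and C: "C \<subseteq> {z \<in> Z. \<exists>y\<in>Z. P y z}" "totalp_on C P"
  shows "\<exists>y\<in>Z - C. totalp_on (insert y C) P"
proof (cases "C = {}")
  case True
  then show ?thesis using \<open>Z \<noteq> {}\<close> by (auto simp: totalp_on_def)
next
  case False
  have "finite C" "transp_on C P" "asymp_on C P"
    using assms(1,3,4) C(1) by (auto intro: finite_subset transp_on_subset asymp_on_subset)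
  then obtain c where c: "c \<in> C" "\<forall>x\<in>C. x \<noteq> c \<longrightarrow> \<not> P x c"
    using Finite_Set.bex_min_element False by metis
  obtain y where y: "y \<in> Z" "P y c" using C(1) c(1) by blast
  have "P y z" if "z \<in> C" for z
  proof (cases "z = c")
    case False
    then have "P c z" using C(2) c that by (auto simp: totalp_on_def)
    then show ?thesis using y that c(1) C(1) \<open>transp_on Z P\<close> by (auto dest: transp_onD)
  qed (use y in simp)
  moreover have "y \<notin> C"
    using c y \<open>asymp_on C P\<close> by (metis asymp_onD)
  ultimately show ?thesis
    using C(2) y(1) by (intro bexI[of _ y]) (auto simp: totalp_on_def)
qed

lemma chain_or_antichain:
  assumes "finite Z" "transp_on Z P" "asymp_on Z P" "s * t \<le> card Z"
  shows "(\<exists>C\<subseteq>Z. card C = s \<and> totalp_on C P) \<or> (\<exists>C\<subseteq>Z. card C = t \<and> (\<forall>x\<in>C. \<forall>y\<in>C. \<not> P x y))"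
  using assms
proof (induction s arbitrary: Z)
  case 0
  then show ?case by (intro disjI1 exI[of _ "{}"]) auto
next
  case (Suc s)
  define M where "M = {z \<in> Z. \<forall>y\<in>Z. \<not> P y z}"
  have M: "M \<subseteq> Z" "finite M" using Suc.prems(1) by (auto simp: M_def)
  show ?case
  proof (cases "t \<le> card M")
    case True
    then obtain C where "C \<subseteq> M" "card C = t" by (meson obtain_subset_with_card_n)
    then show ?thesis by (intro disjI2 exI[of _ C]) (auto simp: M_def)
  next
    case False
    then have "s * t \<le> card (Z - M)" using M Suc.prems(4) by (simp add: card_Diff_subset)
    then consider (chain) C where "C \<subseteq> Z - M" "card C = s" "totalp_on C P"
      | (antichain) C where "C \<subseteq> Z - M" "card C = t" "\<forall>x\<in>C. \<forall>y\<in>C. \<not> P x y"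
      using Suc.IH[of "Z - M"] Suc.prems by (auto intro: transp_on_subset asymp_on_subset)
    then show ?thesis
    proof cases
      case chain
      have "Z \<noteq> {}" using False Suc.prems(4) by auto
      then obtain y where y: "y \<in> Z - C" "totalp_on (insert y C) P"
        using totalp_on_insert_below[of Z P C] Suc.prems(1-3) chain by (auto simp: M_def)
      have "finite C" using chain(1) Suc.prems(1) by (auto intro: finite_subset)
      then have "card (insert y C) = Suc s" using y(1) chain(2) by simp
      then show ?thesis using y chain(1) by (intro disjI1 exI[of _ "insert y C"]) auto
    qed blast
  qed
qed

fun successively3 :: "('a \<Rightarrow> 'a \<Rightarrow> 'a \<Rightarrow> bool) \<Rightarrow> 'a list \<Rightarrow> bool" where
  "successively3 P (x # y # z # zs) \<longleftrightarrow> P x y z \<and> successively3 P (y # z # zs)"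
| "successively3 P _ \<longleftrightarrow> True"

primrec sorted_wrt3 :: "('a \<Rightarrow> 'a \<Rightarrow> 'a \<Rightarrow> bool) \<Rightarrow> 'a list \<Rightarrow> bool" where
  "sorted_wrt3 P [] \<longleftrightarrow> True"
| "sorted_wrt3 P (x # xs) \<longleftrightarrow> sorted_wrt (P x) xs \<and> sorted_wrt3 P xs"

lemma successively3_snoc:
  "successively3 P (us @ [a, b]) \<Longrightarrow> P a b c \<Longrightarrow> successively3 P (us @ [a, b, c])"
  by (induction P us rule: successively3.induct) auto

lemma sorted_wrt3_nth_less:
  "sorted_wrt3 P xs \<Longrightarrow> i < j \<Longrightarrow> j < k \<Longrightarrow> k < length xs \<Longrightarrow> P (xs ! i) (xs ! j) (xs ! k)"
proof (induction xs arbitrary: i j k)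
  case (Cons x xs)
  then obtain j' k' where "j = Suc j'" "k = Suc k'" by (metis less_nat_zero_code not0_implies_Suc)
  then show ?case using Cons by (cases i) (auto intro: sorted_wrt_nth_less)
qed simp

lemma successively3_imp_sorted_wrt3:
  assumes "successively3 P xs" "sorted_wrt lt xs" "set xs \<subseteq> S"
    and trans: "\<And>a b c d. \<lbrakk>{a, b, c, d} \<subseteq> S; lt a b; lt b c; lt c d; P a b c; P b c d\<rbrakk> \<Longrightarrow>
      P a b d \<and> P a c d"
  shows "sorted_wrt3 P xs"
  using assms(1-3)
proof (induction xs)
  case (Cons x ys)
  show ?case
  proof (cases ys)
    case ys: (Cons y zs)
    have lt: "lt x y" "\<And>z. z \<in> set zs \<Longrightarrow> lt y z" "sorted_wrt lt zs" and S: "{x, y} \<union> set zs \<subseteq> S"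
      using Cons.prems ys by auto
    have IH: "sorted_wrt3 P ys" using Cons ys by (cases zs) auto
    have first: "P x y z" if "z \<in> set zs" for z
    proof (cases zs)
      case zs: (Cons w ws)
      then have w: "P x y w" "lt w z" if "z \<noteq> w"
        using Cons.prems ys zs lt(3) \<open>z \<in> set zs\<close> that by simp_all
      have "P y w z" if "z \<noteq> w" using IH ys zs that \<open>z \<in> set zs\<close> by simp
      then show ?thesis
        using w trans[of x y w z] S zs lt(1,2) that Cons.prems(1) ys by (cases "z = w") auto
    qed (use that in simp)
    have "P x (zs ! i) (zs ! j)" if ij: "i < j" "j < length zs" for i j
    proof -
      have "P y (zs ! i) (zs ! j)" "lt (zs ! i) (zs ! j)"
        using IH ys lt(3) ij by (auto simp: sorted_wrt_iff_nth_less)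
      moreover have "{zs ! i, zs ! j} \<subseteq> set zs" using ij by auto
      ultimately show ?thesis
        using trans[of x y "zs ! i" "zs ! j"] first[of "zs ! i"] lt(1,2) S by blast
    qed
    then have "sorted_wrt (P x) ys" using first ys by (simp add: sorted_wrt_iff_nth_less[of _ zs])
    then show ?thesis using IH ys by simp
  qed simp
qed simp

definition triple_chain :: "('a \<Rightarrow> 'a \<Rightarrow> bool) \<Rightarrow> ('a \<Rightarrow> 'a \<Rightarrow> 'a \<Rightarrow> bool) \<Rightarrow> 'a set \<Rightarrow> 'a list \<Rightarrow> bool" where
  "triple_chain lt P S xs \<longleftrightarrow> set xs \<subseteq> S \<and> sorted_wrt lt xs \<and> successively3 P xs"

lemma triple_chain_mono: "triple_chain lt P S xs \<Longrightarrow> S \<subseteq> S' \<Longrightarrow> triple_chain lt P S' xs"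
  by (auto simp: triple_chain_def)

lemma triple_chain_extend:
  assumes trans: "transp_on S lt"
    and cover: "\<And>a b c. \<lbrakk>{a, b, c} \<subseteq> S; lt a b; lt b c\<rbrakk> \<Longrightarrow> P a b c \<or> Q a b c"
    and P: "triple_chain lt P S (us @ [a, b])" and Q: "triple_chain lt Q S (b # c # ws)"
  shows "triple_chain lt P S (us @ [a, b, c]) \<or> triple_chain lt Q S (a # b # c # ws)"
proof -
  have S: "set us \<union> {a, b, c} \<union> set ws \<subseteq> S" using P Q by (auto simp: triple_chain_def)
  have lt: "lt a b" "lt b c" and below: "\<And>x. x \<in> set us \<Longrightarrow> lt x b" and above: "\<And>x. x \<in> set ws \<Longrightarrow> lt b x"
    using P Q by (auto simp: triple_chain_def sorted_wrt_append)
  have lt_c: "lt x c" if "x \<in> set us \<union> {a, b}" for x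
    using transp_onD[OF trans, of x b c] that lt below S by auto
  have lt_a: "lt a x" if "x \<in> {b, c} \<union> set ws" for x
    using transp_onD[OF trans, of a b x] that lt above S by auto
  have "P a b c \<or> Q a b c" using cover[of a b c] S lt by simp
  then show ?thesis
  proof
    assume "P a b c"
    then have "successively3 P (us @ [a, b, c])"
      using P unfolding triple_chain_def by (blast intro: successively3_snoc)
    then show ?thesis using P S lt_c by (auto simp: triple_chain_def sorted_wrt_append)
  next
    assume "Q a b c"
    then show ?thesis using Q S lt_a by (auto simp: triple_chain_def)
  qed
qed

lemma triple_chain_pair:
  assumes "2 \<le> card S" "totalp_on S lt"
  shows "\<exists>xs. length xs = Suc (Suc 0) \<and> triple_chain lt P S xs"
proof -
  obtain x y where xy: "{x, y} \<subseteq> S" "x \<noteq> y"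
    using obtain_subset_with_card_n[OF assms(1)] card_2_iff by metis
  then have "lt x y \<or> lt y x" using assms(2) by (auto simp: totalp_on_def)
  then obtain u v where "{u, v} \<subseteq> S" "lt u v" using xy(1) by blast
  then show ?thesis by (intro exI[of _ "[u, v]"]) (simp add: triple_chain_def)
qed

definition chain_ends :: "('a \<Rightarrow> 'a \<Rightarrow> bool) \<Rightarrow> ('a \<Rightarrow> 'a \<Rightarrow> 'a \<Rightarrow> bool) \<Rightarrow> 'a set \<Rightarrow> nat \<Rightarrow> 'a set" where
  "chain_ends lt P S n = {b \<in> S. \<exists>us. length us = n \<and> triple_chain lt P S (us @ [b])}"

lemma no_triple_chain_outside_chain_ends:
  "\<not> (length xs = Suc n \<and> triple_chain lt P (S - chain_ends lt P S n) xs)"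
proof (cases xs rule: rev_cases)
  case (snoc us b)
  have "b \<in> chain_ends lt P S n" if "length us = n" "triple_chain lt P (S - chain_ends lt P S n) (us @ [b])"
    using that by (auto simp: chain_ends_def triple_chain_def)
  then show ?thesis unfolding snoc by (auto simp: triple_chain_def)
qed simp

lemma triple_chain_in_chain_ends:
  assumes "transp_on S lt" "\<And>a b c. \<lbrakk>{a, b, c} \<subseteq> S; lt a b; lt b c\<rbrakk> \<Longrightarrow> P a b c \<or> Q a b c"
    and Q: "length xs = m + 2" "triple_chain lt Q (chain_ends lt P S (Suc n)) xs"
  shows "(\<exists>xs. length xs = n + 3 \<and> triple_chain lt P S xs) \<or> (\<exists>xs. length xs = m + 3 \<and> triple_chain lt Q S xs)"
proof -
  obtain b c ws where xs: "xs = b # c # ws" "length ws = m" using Q(1) by (auto simp: length_Suc_conv)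
  then have "b \<in> chain_ends lt P S (Suc n)" using Q(2) by (simp add: triple_chain_def)
  then obtain vs where vs: "length vs = Suc n" "triple_chain lt P S (vs @ [b])" by (auto simp: chain_ends_def)
  then obtain us a where us: "vs = us @ [a]" by (cases vs rule: rev_cases) auto
  have "triple_chain lt Q S (b # c # ws)"
    using triple_chain_mono[OF Q(2)] by (auto simp: xs chain_ends_def)
  then have "triple_chain lt P S (us @ [a, b, c]) \<or> triple_chain lt Q S (a # b # c # ws)"
    using assms(1,2) vs(2) unfolding us by (intro triple_chain_extend) auto
  moreover have "length (us @ [a, b, c]) = n + 3" "length (a # b # c # ws) = m + 3" using xs(2) vs(1) us by auto
  ultimately show ?thesis by blast
qed

text \<open>If enough points end a \<open>P\<close>-chain of length \<open>k + 1\<close>, then among them there is a \<open>Q\<close>-chain, and its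
  first point joins it to a \<open>P\<close>-chain.\<close>
lemma cups_caps:
  assumes "finite S" "transp_on S lt" "totalp_on S lt" "(k + l) choose k < card S"
    and cover: "\<And>a b c. \<lbrakk>{a, b, c} \<subseteq> S; lt a b; lt b c\<rbrakk> \<Longrightarrow> P a b c \<or> Q a b c"
  shows "(\<exists>xs. length xs = k + 2 \<and> triple_chain lt P S xs) \<or> (\<exists>xs. length xs = l + 2 \<and> triple_chain lt Q S xs)"
  using assms
proof (induction "k + l" arbitrary: k l S rule: less_induct)
  case less
  show ?case
  proof (cases "k = 0 \<or> l = 0")
    case True
    then have "2 \<le> card S" using less.prems(4) by auto
    then show ?thesis
      using True triple_chain_pair[OF _ less.prems(3), of P] triple_chain_pair[OF _ less.prems(3), of Q] by auto
  next
    case False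
    then obtain k' l' where kl: "k = Suc k'" "l = Suc l'" by (meson not0_implies_Suc)
    have ord: "transp_on B lt" "totalp_on B lt" "finite B" if "B \<subseteq> S" for B
      using that less.prems(1-3) transp_on_subset totalp_on_subset finite_subset by blast+
    let ?A = "chain_ends lt P S k"
    have A: "?A \<subseteq> S" by (auto simp: chain_ends_def)
    then have "card S = card (S - ?A) + card ?A"
      using less.prems(1) card_mono[of S ?A] finite_subset[of ?A S] by (simp add: card_Diff_subset)
    moreover have "(k + l) choose k = (k' + l choose k') + (k + l' choose k)" using kl by simp
    ultimately consider (few) "(k' + l) choose k' < card (S - ?A)" | (many) "(k + l') choose k < card ?A"
      using less.prems(4) by linarith
    then show ?thesis
    proof cases
      case few
      have "(\<exists>xs. length xs = k' + 2 \<and> triple_chain lt P (S - ?A) xs) \<or>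
        (\<exists>xs. length xs = l + 2 \<and> triple_chain lt Q (S - ?A) xs)"
        by (rule less.hyps[OF _ ord(3,1,2) few less.prems(5)]) (use kl in auto)
      moreover have "\<not> (length xs = k' + 2 \<and> triple_chain lt P (S - ?A) xs)" for xs
        using no_triple_chain_outside_chain_ends[of xs k lt P S] kl by simp
      ultimately show ?thesis using triple_chain_mono[of lt Q "S - ?A" _ S] by blast
    next
      case many
      have "(\<exists>xs. length xs = k + 2 \<and> triple_chain lt P ?A xs) \<or>
        (\<exists>xs. length xs = l' + 2 \<and> triple_chain lt Q ?A xs)"
        by (rule less.hyps[OF _ ord(3,1,2) many less.prems(5)]) (use kl A in auto)
      then show ?thesis
      proof
        assume "\<exists>xs. length xs = l' + 2 \<and> triple_chain lt Q ?A xs"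
        then obtain xs where xs: "length xs = l' + 2" "triple_chain lt Q (chain_ends lt P S (Suc k')) xs"
          unfolding kl by blast
        have "(\<exists>xs. length xs = k' + 3 \<and> triple_chain lt P S xs) \<or>
          (\<exists>xs. length xs = l' + 3 \<and> triple_chain lt Q S xs)"
          by (rule triple_chain_in_chain_ends[OF less.prems(2) _ xs]) (rule less.prems(5))
        then show ?thesis by (simp add: kl numeral_3_eq_3)
      qed (use triple_chain_mono[OF _ A] in blast)
    qed
  qed
qed

section \<open>Counting in products\<close>

lemma pigeonhole_cover:
  assumes "finite S" "finite T" "T \<noteq> {}" "S \<subseteq> (\<Union>t\<in>T. B t)"
  shows "\<exists>t\<in>T. card S \<le> card T * card (S \<inter> B t)"
proof -
  have "\<forall>x\<in>S. \<exists>t. t \<in> T \<and> x \<in> B t" using assms(4) by blast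
  then obtain f where f: "\<And>x. x \<in> S \<Longrightarrow> f x \<in> T \<and> x \<in> B (f x)" by metis
  then obtain t where t: "t \<in> T" "card S \<le> card (f -` {t} \<inter> S) * card T"
    using pigeonhole_card[of f S T] assms by auto
  have "card (f -` {t} \<inter> S) \<le> card (S \<inter> B t)" using f assms(1) by (intro card_mono) auto
  then have "card S \<le> card T * card (S \<inter> B t)"
    using t(2) by (metis mult.commute mult_le_mono2 order_trans)
  then show ?thesis using t(1) by blast
qed

definition slice :: "'i set \<Rightarrow> ('i \<Rightarrow> 'a set) \<Rightarrow> 'i set \<Rightarrow> ('i \<Rightarrow> 'a) \<Rightarrow> (('i \<Rightarrow> 'a) \<Rightarrow> bool) \<Rightarrow> ('i \<Rightarrow> 'a) set" where
  "slice I A V g Q = {f \<in> PiE I A. Q f \<and> (\<forall>i\<in>I - V. f i = g i)}"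

lemma coordinate_slice_subset: "V \<subseteq> I \<Longrightarrow> v \<in> V \<Longrightarrow> (\<lambda>f. f v) ` slice I A V g Q \<subseteq> A v"
  unfolding slice_def by blast

lemma card_slice_le:
  assumes I: "finite I" "\<And>i. i \<in> I \<Longrightarrow> finite (A i)" and V: "V \<subseteq> I"
  shows "card (slice I A V g Q) \<le> (\<Prod>v\<in>V. card ((\<lambda>f. f v) ` slice I A V g Q))"
proof -
  let ?S = "slice I A V g Q"
  let ?P = "PiE V (\<lambda>v. (\<lambda>f. f v) ` ?S)"
  have finV: "finite V" using I V finite_subset by blast
  have "card ?S \<le> card ?P"
  proof (rule card_inj_on_le)
    show "inj_on (\<lambda>f. restrict f V) ?S"
    proof (rule inj_onI)
      fix f f' assume f: "f \<in> ?S" "f' \<in> ?S" and eq: "restrict f V = restrict f' V"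
      have "f i = f' i" if "i \<in> I" for i
        using f fun_cong[OF eq, of i] that by (cases "i \<in> V") (auto simp: slice_def)
      then show "f = f'" using f by (intro PiE_ext[of f I A f']) (auto simp: slice_def)
    qed
    have "finite ((\<lambda>f. f v) ` ?S)" if "v \<in> V" for v
      using finite_subset[OF coordinate_slice_subset[OF V that]] I(2) V that by blast
    then show "finite ?P" using finV by (intro finite_PiE)
  qed auto
  then show ?thesis using finV by (simp add: card_PiE)
qed

text \<open>One colour class and one choice of the coordinates outside \<open>V t\<close> carry their fair share of the
  product, and a slice is at most as large as the product of its coordinate projections.\<close>
lemma product_pigeonhole:
  fixes A :: "'i \<Rightarrow> 'a set" and V :: "'t \<Rightarrow> 'i set"
  assumes I: "finite I" and A: "\<And>i. i \<in> I \<Longrightarrow> finite (A i) \<and> card (A i) = s" and s: "s > 0"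
    and T: "finite T" "\<And>f. f \<in> PiE I A \<Longrightarrow> \<exists>t\<in>T. P t f"
    and V: "\<And>t. t \<in> T \<Longrightarrow> V t \<subseteq> I"
  shows "\<exists>t\<in>T. \<exists>g\<in>PiE (I - V t) A.
    s ^ card (V t) \<le> card T * (\<Prod>v\<in>V t. card ((\<lambda>f. f v) ` slice I A (V t) g (P t)))"
proof -
  have box: "finite (PiE J A) \<and> card (PiE J A) = s ^ card J \<and> PiE J A \<noteq> {}" if "J \<subseteq> I" for J
  proof -
    have "finite J" using that I finite_subset by blast
    moreover have "\<And>i. i \<in> J \<Longrightarrow> finite (A i) \<and> card (A i) = s \<and> A i \<noteq> {}" using A s that by fastforce
    ultimately show ?thesis by (simp add: finite_PiE card_PiE PiE_eq_empty_iff)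
  qed
  have "T \<noteq> {}" using T(2) box[of I] by blast
  then obtain t where t: "t \<in> T" "card (PiE I A) \<le> card T * card (PiE I A \<inter> {f. P t f})"
    using pigeonhole_cover[of "PiE I A" T "\<lambda>t. {f. P t f}"] T box[of I] by blast
  let ?S = "PiE I A \<inter> {f. P t f}" and ?G = "PiE (I - V t) A"
  have VI: "V t \<subseteq> I" using V t(1) .
  have "?S \<subseteq> (\<Union>g\<in>?G. {f. \<forall>i\<in>I - V t. f i = g i})"
  proof
    fix f assume "f \<in> ?S"
    then show "f \<in> (\<Union>g\<in>?G. {f. \<forall>i\<in>I - V t. f i = g i})"
      by (intro UN_I[of "restrict f (I - V t)"]) auto
  qed
  then obtain g where g: "g \<in> ?G" "card ?S \<le> card ?G * card (?S \<inter> {f. \<forall>i\<in>I - V t. f i = g i})"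
    using pigeonhole_cover[of ?S ?G "\<lambda>g. {f. \<forall>i\<in>I - V t. f i = g i}"] box[of I] box[of "I - V t"] by blast
  let ?p = "\<Prod>v\<in>V t. card ((\<lambda>f. f v) ` slice I A (V t) g (P t))"
  have "?S \<inter> {f. \<forall>i\<in>I - V t. f i = g i} = slice I A (V t) g (P t)" by (auto simp: slice_def)
  then have "card (?S \<inter> {f. \<forall>i\<in>I - V t. f i = g i}) \<le> ?p" using card_slice_le[OF I _ VI, of A] A by simp
  then have "card ?S \<le> card ?G * ?p" using g(2) mult_le_mono2 order_trans by blast
  then have "card T * card ?S \<le> card T * (card ?G * ?p)" by (rule mult_le_mono2)
  then have "s ^ card I \<le> card T * (card ?G * ?p)" using t(2) box[OF order_refl] by linarith
  then have "s ^ card I \<le> card ?G * (card T * ?p)" by (simp only: mult.left_commute)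
  moreover have "card ?G = s ^ (card I - card (V t))" "s ^ card I = s ^ (card I - card (V t)) * s ^ card (V t)"
    using box[of "I - V t"] VI card_mono[OF I VI] finite_subset[OF VI I]
    by (simp_all add: card_Diff_subset flip: power_add)
  ultimately have "s ^ card (V t) \<le> card T * ?p" using s by simp
  then show ?thesis using t(1) g(1) by blast
qed

lemma prod_lower_bound_subset:
  fixes b :: "'i \<Rightarrow> nat"
  assumes "finite V" "s > 0" "\<And>v. v \<in> V \<Longrightarrow> b v \<le> s" "s ^ card V \<le> D * prod b V" "N \<subseteq> V"
  shows "s ^ card N \<le> D * prod b N"
proof -
  have "finite N" using assms(1,5) finite_subset by blast
  then have cards: "card V = card N + card (V - N)"
    using assms(1,5) card_mono[of V N] by (simp add: card_Diff_subset)
  have "prod b (V - N) \<le> s ^ card (V - N)"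
    using prod_mono[of "V - N" b "\<lambda>_. s"] assms(3) by simp
  then have "D * (prod b N * prod b (V - N)) \<le> D * (prod b N * s ^ card (V - N))" by simp
  moreover have "prod b V = prod b N * prod b (V - N)"
    using assms(1,5) by (simp add: prod.subset_diff mult.commute)
  ultimately have "s ^ card V \<le> D * prod b N * s ^ card (V - N)"
    using assms(4) by (metis mult.assoc order_trans)
  then have "s ^ card N * s ^ card (V - N) \<le> D * prod b N * s ^ card (V - N)"
    by (simp add: cards power_add)
  then show ?thesis using assms(2) by simp
qed

corollary product_pigeonhole_coordinates:
  fixes A :: "'i \<Rightarrow> 'a set" and V :: "'t \<Rightarrow> 'i set"
  assumes I: "finite I" and A: "\<And>i. i \<in> I \<Longrightarrow> finite (A i) \<and> card (A i) = Suc (card T) * s" and s: "s > 0"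
    and T: "finite T" "\<And>f. f \<in> PiE I A \<Longrightarrow> \<exists>t\<in>T. P t f"
    and V: "\<And>t. t \<in> T \<Longrightarrow> V t \<subseteq> I"
  shows "\<exists>t\<in>T. \<exists>g\<in>PiE (I - V t) A. \<forall>v\<in>V t. s \<le> card ((\<lambda>f. f v) ` slice I A (V t) g (P t))"
proof -
  let ?S = "Suc (card T) * s"
  let ?b = "\<lambda>t g v. card ((\<lambda>f. f v) ` slice I A (V t) g (P t))"
  have S: "?S > 0" using s by simp
  obtain t g where t: "t \<in> T" "g \<in> PiE (I - V t) A" "?S ^ card (V t) \<le> card T * prod (?b t g) (V t)"
    using product_pigeonhole[of I A ?S T P V, OF I A S T V] by blast
  have "s \<le> ?b t g v" if v: "v \<in> V t" for v
  proof -
    have "?b t g w \<le> ?S" if "w \<in> V t" for w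
      using coordinate_slice_subset[OF V[OF t(1)] that] A[of w] V[OF t(1)] that card_mono by (metis subsetD)
    then have "?S ^ card {v} \<le> card T * prod (?b t g) {v}"
      using prod_lower_bound_subset[OF finite_subset[OF V[OF t(1)] I] S _ t(3), of "{v}"] v by blast
    then have "?S \<le> Suc (card T) * ?b t g v" by simp
    then show ?thesis by (simp only: Suc_mult_le_cancel1)
  qed
  then show ?thesis using t(1,2) by blast
qed

lemma half_of_factors_large:
  fixes b :: "'i \<Rightarrow> nat"
  assumes "finite V" "s > 0" "c > 0" "\<And>v. v \<in> V \<Longrightarrow> b v \<le> s" "s ^ card V \<le> c ^ card V * prod b V"
  shows "card V \<le> 2 * card {v \<in> V. s \<le> c ^ 2 * b v}"
proof (rule ccontr)
  let ?G = "{v \<in> V. s \<le> c ^ 2 * b v}"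
  define N where "N = V - ?G"
  assume "\<not> card V \<le> 2 * card ?G"
  moreover have "card N + card ?G = card V"
    using assms(1) card_mono[of V ?G] by (simp add: N_def card_Diff_subset)
  ultimately have N: "card V \<le> 2 * card N" "N \<noteq> {}" by auto
  then obtain v where "v \<in> N" by blast
  then have "(\<Prod>v\<in>N. c ^ 2 * b v) < (\<Prod>v\<in>N. s)"
    using assms(1,2) by (intro prod_mono_strict[of v]) (auto simp: N_def)
  then have "c ^ (2 * card N) * prod b N < s ^ card N" by (simp add: prod.distrib power_mult)
  moreover have "c ^ card V * prod b N \<le> c ^ (2 * card N) * prod b N"
    using N(1) assms(3) by (intro mult_le_mono1 power_increasing) auto
  moreover have "s ^ card N \<le> c ^ card V * prod b N"
    by (rule prod_lower_bound_subset[OF assms(1,2,4,5)]) (auto simp: N_def)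
  ultimately show False by simp
qed

lemma disjoint_parts_exist:
  assumes "finite X" "R * s \<le> card X"
  shows "\<exists>A. (\<forall>i<R. A i \<subseteq> X \<and> card (A i) = s) \<and> disjoint_family_on A {..<R}"
  using assms
proof (induction R arbitrary: X)
  case (Suc R)
  have "s \<le> card X" using Suc.prems(2) by simp
  then obtain B where B: "B \<subseteq> X" "card B = s" by (meson obtain_subset_with_card_n)
  then have "R * s \<le> card (X - B)"
    using Suc.prems finite_subset[OF B(1)] by (simp add: card_Diff_subset)
  then obtain A where A: "\<forall>i<R. A i \<subseteq> X - B \<and> card (A i) = s" "disjoint_family_on A {..<R}"
    using Suc.IH[of "X - B"] Suc.prems(1) by auto
  have "\<forall>i<Suc R. (A(R := B)) i \<subseteq> X \<and> card ((A(R := B)) i) = s" using A(1) B by (auto simp: less_Suc_eq)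
  moreover have "disjoint_family_on (A(R := B)) {..<Suc R}"
    using A by (fastforce simp: disjoint_family_on_def less_Suc_eq)
  ultimately show ?case by blast
qed (simp add: disjoint_family_on_def)

lemma PiE_disjoint_inj_on: "f \<in> PiE I A \<Longrightarrow> disjoint_family_on A I \<Longrightarrow> inj_on f I"
  by (intro inj_onI) (metis PiE_mem disjoint_family_onD disjoint_iff)

section \<open>Nested queries\<close>

definition separated_by :: "(nat \<Rightarrow> nat \<Rightarrow> bool) \<Rightarrow> nat \<Rightarrow> nat set \<Rightarrow> bool" where
  "separated_by Q m F \<longleftrightarrow> (\<forall>j\<in>F. \<exists>b>j. b \<le> m \<and> (\<forall>i\<in>F. j < i \<longrightarrow> b \<le> i) \<and> Q j b)"

lemma separated_by_insert:
  assumes F: "separated_by Q m F" "F \<subseteq> {..<m}" and j: "m \<le> j" "j < m'" "Q j m'"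
  shows "separated_by Q m' (insert j F)"
  unfolding separated_by_def
proof
  fix i assume i: "i \<in> insert j F"
  show "\<exists>b>i. b \<le> m' \<and> (\<forall>i'\<in>insert j F. i < i' \<longrightarrow> b \<le> i') \<and> Q i b"
  proof (cases "i = j")
    case True
    then show ?thesis using F(2) j by (intro exI[of _ m']) force
  next
    case False
    then have "i \<in> F" using i by simp
    from bspec[OF F(1)[unfolded separated_by_def] this]
    obtain b where "b > i" "b \<le> m" "\<forall>i'\<in>F. i < i' \<longrightarrow> b \<le> i'" "Q i b" by blast
    then show ?thesis using j(1,2) by (intro exI[of _ b]) auto
  qed
qed

lemma block_transversal:
  fixes \<alpha> c k :: nat
  shows "(\<exists>F\<subseteq>{\<alpha>..<\<alpha> + k * c}. card F = k \<and> separated_by Q (\<alpha> + k * c) F) \<or>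
    (\<exists>\<beta>\<ge>\<alpha>. \<beta> + c \<le> \<alpha> + k * c \<and> (\<forall>j\<in>{\<beta>..<\<beta> + c}. \<not> Q j (\<beta> + c)))"
proof (induction k)
  case 0
  show ?case by (intro disjI1 exI[of _ "{}"]) (simp add: separated_by_def)
next
  case (Suc k)
  define \<beta> where "\<beta> = \<alpha> + k * c"
  have end_block: "\<alpha> + Suc k * c = \<beta> + c" by (simp add: \<beta>_def)
  from Suc show ?case
  proof (elim disjE exE conjE)
    fix \<beta>' assume "\<alpha> \<le> \<beta>'" "\<beta>' + c \<le> \<alpha> + k * c" "\<forall>j\<in>{\<beta>'..<\<beta>' + c}. \<not> Q j (\<beta>' + c)"
    then show ?thesis by (intro disjI2 exI[of _ \<beta>']) auto
  next
    fix F assume "F \<subseteq> {\<alpha>..<\<alpha> + k * c}" and F: "card F = k" "separated_by Q (\<alpha> + k * c) F"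
    then have sub: "F \<subseteq> {\<alpha>..<\<beta>}" by (simp add: \<beta>_def)
    show ?thesis
    proof (cases "\<forall>j\<in>{\<beta>..<\<beta> + c}. \<not> Q j (\<beta> + c)")
      case True
      then show ?thesis by (intro disjI2 exI[of _ \<beta>]) (simp add: \<beta>_def)
    next
      case False
      then obtain j where j: "\<beta> \<le> j" "j < \<beta> + c" "Q j (\<beta> + c)" by auto
      have "separated_by Q (\<beta> + c) (insert j F)"
        using F(2) sub j by (intro separated_by_insert[where m = \<beta>]) (auto simp: \<beta>_def)
      moreover have "j \<notin> F" using sub j(1) by auto
      then have "card (insert j F) = Suc k" using F(1) finite_subset[OF sub] by simp
      moreover have "insert j F \<subseteq> {\<alpha>..<\<beta> + c}" using sub j by (auto simp: \<beta>_def)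
      ultimately show ?thesis unfolding end_block by (intro disjI1 exI[of _ "insert j F"]) simp
    qed
  qed
qed

fun stage_size :: "nat \<Rightarrow> nat \<Rightarrow> nat" where
  "stage_size k 0 = 1"
| "stage_size k (Suc s) = Suc (k * stage_size k s)"

lemma stage_size_pos: "0 < stage_size k s"
  by (cases s) auto

definition answers_small ::
    "(nat \<Rightarrow> nat \<Rightarrow> nat \<Rightarrow> 'p set \<Rightarrow> bool) \<Rightarrow> (nat \<Rightarrow> 'p set) \<Rightarrow> nat \<Rightarrow> nat \<Rightarrow> nat set \<Rightarrow> bool" where
  "answers_small small A K c F \<longleftrightarrow> (\<forall>j\<in>F. \<exists>W\<subseteq>A j. card W = c \<and>
     (\<exists>a b. (\<forall>i\<in>F. a \<le> i) \<and> j < b \<and> b \<le> K \<and> (\<forall>i\<in>F. j < i \<longrightarrow> b \<le> i) \<and> small j a b W))"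

definition answers_large ::
    "(nat \<Rightarrow> nat \<Rightarrow> nat \<Rightarrow> 'p set \<Rightarrow> bool) \<Rightarrow> (nat \<Rightarrow> 'p set) \<Rightarrow> nat \<Rightarrow> nat \<Rightarrow> nat \<Rightarrow> nat set \<Rightarrow> bool" where
  "answers_large large A K e \<alpha> F \<longleftrightarrow> (\<forall>j\<in>F. \<exists>W\<subseteq>A j. e \<le> card W \<and>
     (\<exists>a b. \<alpha> < a \<and> a \<le> j \<and> (\<forall>i\<in>F. i < j \<longrightarrow> i < a) \<and> (\<forall>i\<in>F. i < b) \<and> b \<le> K \<and> large j a b W))"

lemma answers_smallI:
  assumes F: "F \<subseteq> {a..<b'}" "b' \<le> K" "\<And>j. j \<in> F \<Longrightarrow> Z j \<subseteq> A j"
    and small: "separated_by (\<lambda>j b. \<exists>W\<subseteq>Z j. card W = c \<and> small j a b W) b' F"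
  shows "answers_small small A K c F"
  unfolding answers_small_def
proof
  fix j assume j: "j \<in> F"
  from bspec[OF small[unfolded separated_by_def] this] obtain b W where b: "j < b" "b \<le> b'" "\<forall>i\<in>F. j < i \<longrightarrow> b \<le> i"
    and W: "W \<subseteq> Z j" "card W = c" "small j a b W"
    by blast
  have "\<forall>i\<in>F. a \<le> i" using F(1) by auto
  moreover have "W \<subseteq> A j" "b \<le> K" using W(1) F(2,3) j b(2) by auto
  ultimately show "\<exists>W\<subseteq>A j. card W = c \<and>
      (\<exists>a b. (\<forall>i\<in>F. a \<le> i) \<and> j < b \<and> b \<le> K \<and> (\<forall>i\<in>F. j < i \<longrightarrow> b \<le> i) \<and> small j a b W)"
    using b W(2,3) by metis
qed

lemma answers_large_insert:
  assumes F: "F \<subseteq> {\<beta>..<b}" "card F = s" "answers_large large A K e \<beta> F"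
    and "\<alpha> < \<beta>" "\<beta> < b" "b \<le> K" "W \<subseteq> A \<beta>" "e \<le> card W" "large \<beta> (Suc \<alpha>) b W"
  shows "insert \<beta> F \<subseteq> {\<beta>..<b} \<and> card (insert \<beta> F) = Suc s \<and> answers_large large A K e \<alpha> (insert \<beta> F)"
proof (intro conjI)
  have "\<beta> \<notin> F" using F(3) by (fastforce simp: answers_large_def)
  then show "card (insert \<beta> F) = Suc s" using F(2) finite_subset[OF F(1)] by simp
  show "insert \<beta> F \<subseteq> {\<beta>..<b}" using F(1) assms(5) by auto
  show "answers_large large A K e \<alpha> (insert \<beta> F)"
    unfolding answers_large_def
  proof
    fix j assume j: "j \<in> insert \<beta> F"
    show "\<exists>W\<subseteq>A j. e \<le> card W \<and> (\<exists>a b. \<alpha> < a \<and> a \<le> j \<and> (\<forall>i\<in>insert \<beta> F. i < j \<longrightarrow> i < a) \<and>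
      (\<forall>i\<in>insert \<beta> F. i < b) \<and> b \<le> K \<and> large j a b W)"
    proof (cases "j = \<beta>")
      case True
      have "\<forall>i\<in>insert \<beta> F. \<beta> \<le> i \<and> i < b" using F(1) assms(5) by auto
      then show ?thesis
        unfolding True using assms(4-9) by (intro exI[of _ W] conjI exI[of _ "Suc \<alpha>"] exI[of _ b]) auto
    next
      case False
      then have "j \<in> F" using j by simp
      from bspec[OF F(3)[unfolded answers_large_def] this]
      obtain W a b' where W: "W \<subseteq> A j" "e \<le> card W" "\<beta> < a" "a \<le> j" "\<forall>i\<in>F. i < j \<longrightarrow> i < a"
        "\<forall>i\<in>F. i < b'" "b' \<le> K" "large j a b' W"
        by blast
      moreover have "\<beta> < b'" using W(3,4,6) \<open>j \<in> F\<close> by fastforce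
      ultimately show ?thesis
        using assms(4) by (intro exI[of _ W] conjI exI[of _ a] exI[of _ b']) auto
    qed
  qed
qed

lemma query_stage:
  assumes split: "\<And>j b. \<lbrakk>a \<le> j; j < b; b \<le> a + k * m\<rbrakk> \<Longrightarrow>
      (\<exists>W\<subseteq>Z j. card W = c \<and> small j a b W) \<or> (\<exists>W\<subseteq>Z j. card W = t \<and> large j a b W)"
    and Z: "\<And>j. \<lbrakk>a \<le> j; j < a + k * m\<rbrakk> \<Longrightarrow> Z j \<subseteq> A j" and "a + k * m \<le> K"
  shows "(\<exists>F\<subseteq>{a..<a + k * m}. card F = k \<and> answers_small small A K c F) \<or>
    (\<exists>\<beta> W. a \<le> \<beta> \<and> \<beta> + m \<le> a + k * m \<and>
      (\<forall>j\<in>{\<beta>..<\<beta> + m}. W j \<subseteq> Z j \<and> card (W j) = t \<and> large j a (\<beta> + m) (W j)))"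
proof -
  define Q where "Q j b \<longleftrightarrow> (\<exists>W\<subseteq>Z j. card W = c \<and> small j a b W)" for j b
  consider (small) F where "F \<subseteq> {a..<a + k * m}" "card F = k" "separated_by Q (a + k * m) F"
    | (large) \<beta> where "a \<le> \<beta>" "\<beta> + m \<le> a + k * m" "\<forall>j\<in>{\<beta>..<\<beta> + m}. \<not> Q j (\<beta> + m)"
    using block_transversal[of a k m Q] by blast
  then show ?thesis
  proof cases
    case small
    have "Z j \<subseteq> A j" if "j \<in> F" for j using Z[of j] small(1) that by fastforce
    then have "answers_small small A K c F"
      using answers_smallI[OF small(1) assms(3)] small(3) unfolding Q_def by blast
    then show ?thesis using small(1,2) by blast
  next
    case large
    have "\<exists>W. W \<subseteq> Z j \<and> card W = t \<and> large j a (\<beta> + m) W" if j: "j \<in> {\<beta>..<\<beta> + m}" for j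
    proof -
      have "\<not> Q j (\<beta> + m)" using large(3) j by blast
      then show ?thesis using split[of j "\<beta> + m"] large(1,2) j unfolding Q_def by auto
    qed
    then obtain W where "\<And>j. j \<in> {\<beta>..<\<beta> + m} \<Longrightarrow> W j \<subseteq> Z j \<and> card (W j) = t \<and> large j a (\<beta> + m) (W j)"
      by metis
    then show ?thesis using large(1,2) by (intro disjI2 exI[of _ \<beta>] exI[of _ W]) simp
  qed
qed

text \<open>A query splits a cluster into a small part satisfying \<open>small\<close> or a large part satisfying \<open>large\<close>,
  so that a cluster survives \<open>s\<close> answers \<open>large\<close> at the cost of a factor \<open>c ^ s\<close> only. Either every
  block of a stage contains a cluster answering \<open>small\<close>, or the next stage is played inside a block
  all of whose clusters answer \<open>large\<close>.\<close>
lemma query_game: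
  assumes c: "c > 0"
    and split: "\<And>j a b Z t. \<lbrakk>L \<le> a; a \<le> j; j < b; b \<le> K; Z \<subseteq> A j; c * t \<le> card Z\<rbrakk> \<Longrightarrow>
      (\<exists>W\<subseteq>Z. card W = c \<and> small j a b W) \<or> (\<exists>W\<subseteq>Z. card W = t \<and> large j a b W)"
    and "L \<le> \<alpha>" "\<alpha> + stage_size k s \<le> K"
    and "\<And>j. \<lbrakk>\<alpha> \<le> j; j < \<alpha> + stage_size k s\<rbrakk> \<Longrightarrow> Z j \<subseteq> A j \<and> c ^ s * e \<le> card (Z j)"
  shows "\<exists>F\<subseteq>{\<alpha>..<\<alpha> + stage_size k s}.
    card F = k \<and> answers_small small A K c F \<or> card F = s \<and> answers_large large A K e \<alpha> F"
  using assms(3-5)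
proof (induction s arbitrary: \<alpha> Z)
  case 0
  then show ?case by (intro exI[of _ "{}"]) (simp add: answers_large_def)
next
  case (Suc s)
  let ?\<kappa> = "stage_size k s"
  have end_stage: "\<alpha> + stage_size k (Suc s) = Suc \<alpha> + k * ?\<kappa>" by simp
  note K = Suc.prems(2)[unfolded end_stage] and Z = Suc.prems(3)[unfolded end_stage]
  have stage_split: "(\<exists>W\<subseteq>Z j. card W = c \<and> small j (Suc \<alpha>) b W) \<or>
      (\<exists>W\<subseteq>Z j. card W = c ^ s * e \<and> large j (Suc \<alpha>) b W)"
    if "Suc \<alpha> \<le> j" "j < b" "b \<le> Suc \<alpha> + k * ?\<kappa>" for j b
    using Z[of j] K Suc.prems(1) that by (intro split) (auto simp: mult.assoc)
  have "Z j \<subseteq> A j" if "Suc \<alpha> \<le> j" "j < Suc \<alpha> + k * ?\<kappa>" for j using Z[of j] that by simp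
  with query_stage[of "Suc \<alpha>" k ?\<kappa> Z c small "c ^ s * e" large A K] stage_split K
  consider (small) F where "F \<subseteq> {Suc \<alpha>..<Suc \<alpha> + k * ?\<kappa>}" "card F = k" "answers_small small A K c F"
    | (large) \<beta> W where "Suc \<alpha> \<le> \<beta>" "\<beta> + ?\<kappa> \<le> Suc \<alpha> + k * ?\<kappa>"
      "\<forall>j\<in>{\<beta>..<\<beta> + ?\<kappa>}. W j \<subseteq> Z j \<and> card (W j) = c ^ s * e \<and> large j (Suc \<alpha>) (\<beta> + ?\<kappa>) (W j)"
    by blast
  then show ?case
  proof cases
    case small
    then show ?thesis unfolding end_stage by (intro exI[of _ F]) auto
  next
    case large
    let ?b = "\<beta> + ?\<kappa>"
    have WA: "W j \<subseteq> A j \<and> c ^ s * e \<le> card (W j)" if "\<beta> \<le> j" "j < ?b" for j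
    proof -
      have "W j \<subseteq> Z j" "card (W j) = c ^ s * e" using large(3) that by simp_all
      moreover have "Z j \<subseteq> A j" using Z[of j] large(1,2) that by simp
      ultimately show ?thesis by simp
    qed
    have "L \<le> \<beta>" "?b \<le> K" using large(1,2) K Suc.prems(1) by simp_all
    from Suc.IH[OF this WA] obtain F where F: "F \<subseteq> {\<beta>..<?b}"
      "card F = k \<and> answers_small small A K c F \<or> card F = s \<and> answers_large large A K e \<beta> F"
      by blast
    have block: "{\<beta>..<?b} \<subseteq> {\<alpha>..<Suc \<alpha> + k * ?\<kappa>}" using large by auto
    from F(2) show ?thesis
    proof (elim disjE conjE)
      assume "card F = s" "answers_large large A K e \<beta> F"
      moreover have "\<beta> \<in> {\<beta>..<?b}" using stage_size_pos by simp
      from bspec[OF large(3) this] have "e \<le> card (W \<beta>)" "large \<beta> (Suc \<alpha>) ?b (W \<beta>)" using c by simp_all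
      ultimately show ?thesis
        using answers_large_insert[OF F(1), of s large A K e \<alpha> "W \<beta>"] WA[of \<beta>] large(1,2) K
          stage_size_pos[of k s] block unfolding end_stage by (intro exI[of _ "insert \<beta> F"]) auto
    qed (use F(1) block in \<open>unfold end_stage, blast\<close>)
  qed
qed

lemma ramsey_increasing_quadruples:
  fixes n :: nat
  shows "\<exists>R::nat. \<forall>P. \<exists>e \<in> {..n} \<rightarrow>\<^sub>E {..<R}. strict_mono_on {..n} e \<and>
    (\<exists>b. \<forall>i j k l. i < j \<longrightarrow> j < k \<longrightarrow> k < l \<longrightarrow> l \<le> n \<longrightarrow> (P (e i) (e j) (e k) (e l) \<longleftrightarrow> b))"
proof -
  obtain R :: nat where R: "partn_lst {..<R} [Suc n, Suc n] 4" using ramsey_full by blast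
  have "\<exists>e \<in> {..n} \<rightarrow>\<^sub>E {..<R}. strict_mono_on {..n} e \<and>
    (\<exists>b. \<forall>i j k l. i < j \<longrightarrow> j < k \<longrightarrow> k < l \<longrightarrow> l \<le> n \<longrightarrow> (P (e i) (e j) (e k) (e l) \<longleftrightarrow> b))"
    for P :: "nat \<Rightarrow> nat \<Rightarrow> nat \<Rightarrow> nat \<Rightarrow> bool"
  proof -
    define col :: "nat set \<Rightarrow> nat" where "col S = (let xs = sorted_list_of_set S in
      if P (xs ! 0) (xs ! 1) (xs ! 2) (xs ! 3) then 0 else 1)" for S
    have col: "col {a, b, c, d} = (if P a b c d then 0 else 1)" if "a < b" "b < c" "c < d" for a b c d
    proof -
      have "sorted_list_of_set (set [a, b, c, d]) = [a, b, c, d]"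
        using that by (intro sorted_list_of_set.idem_if_sorted_distinct) auto
      then show ?thesis by (simp add: col_def)
    qed
    have "col \<in> nsets {..<R} 4 \<rightarrow> {..<length [Suc n, Suc n]}" by (auto simp: col_def Let_def)
    then obtain u H where "u < length [Suc n, Suc n]" "H \<in> nsets {..<R} ([Suc n, Suc n] ! u)"
      and mono: "col ` nsets H 4 \<subseteq> {u}"
      using partn_lstE[OF R] by metis
    then have H: "H \<subseteq> {..<R}" "finite H" "card H = Suc n" by (auto simp: nsets_def less_Suc_eq)
    define e where "e = restrict (enumerate H) {..n}"
    have e_in: "e i \<in> H" if "i \<le> n" for i
      using that H by (simp add: e_def finite_enumerate_in_set)
    have e_less: "e i < e j" if "i < j" "j \<le> n" for i j
      using that H by (simp add: e_def finite_enumerate_mono)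
    have "P (e i) (e j) (e k) (e l) \<longleftrightarrow> u = 0" if "i < j" "j < k" "k < l" "l \<le> n" for i j k l
    proof -
      have less: "e i < e j" "e j < e k" "e k < e l" using that e_less by auto
      then have "{e i, e j, e k, e l} \<in> nsets H 4" using that e_in by (auto simp: nsets_def)
      then have "col {e i, e j, e k, e l} = u" using mono by blast
      then show ?thesis using col[OF less] by (simp split: if_splits)
    qed
    moreover have "e \<in> {..n} \<rightarrow>\<^sub>E {..<R}" using e_in H(1) by (auto simp: e_def)
    moreover have "strict_mono_on {..n} e" using e_less by (auto intro: strict_mono_onI)
    ultimately show ?thesis by blast
  qed
  then show ?thesis by blast
qed

section \<open>Subexponential binomial coefficients\<close>

lemma binomial_le_exp:
  fixes x :: real
  assumes "x > 0" "k \<le> n"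
  shows "real (n choose k) \<le> exp (real n * x + real k * \<bar>ln x\<bar>)"
proof -
  have "real (n choose k) * x ^ k \<le> (\<Sum>i\<le>n. real (n choose i) * x ^ i)"
    using assms by (intro member_le_sum[of k "{..n}" "\<lambda>i. real (n choose i) * x ^ i"]) auto
  also have "\<dots> = (x + 1) ^ n" by (simp add: binomial_ring)
  also have "\<dots> \<le> exp x ^ n"
    using assms(1) exp_ge_add_one_self[of x] by (intro power_mono) (auto simp: add.commute)
  finally have "real (n choose k) \<le> exp x ^ n / x ^ k" using assms(1) by (simp add: pos_le_divide_eq)
  also have "\<dots> = exp (real n * x + real k * (- ln x))"
    using assms(1) by (simp add: exp_diff exp_of_nat_mult)
  also have "\<dots> \<le> exp (real n * x + real k * \<bar>ln x\<bar>)"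
    unfolding exp_le_cancel_iff by (intro add_left_mono mult_left_mono abs_ge_minus_self) simp
  finally show ?thesis .
qed

definition chain_threshold :: "nat \<Rightarrow> nat \<Rightarrow> nat" where
  "chain_threshold n l = (2 * n + 2 * l) choose (2 * l)"

lemma chain_threshold_le_exp:
  fixes x :: real
  assumes "x > 0" "l \<le> n + 1" "1 \<le> n"
  shows "real (chain_threshold n l) \<le> exp (6 * x * real n + 2 * \<bar>ln x\<bar> * real l)"
proof -
  have "real (2 * n + 2 * l) * x \<le> 6 * real n * x" using assms by (intro mult_right_mono) auto
  then have "exp (real (2 * n + 2 * l) * x + real (2 * l) * \<bar>ln x\<bar>) \<le> exp (6 * x * real n + 2 * \<bar>ln x\<bar> * real l)"
    by (simp add: mult_ac)
  then show ?thesis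
    using binomial_le_exp[OF assms(1), of "2 * l" "2 * n + 2 * l"] unfolding chain_threshold_def by linarith
qed

lemma chain_threshold_subexponential:
  fixes \<mu> :: real
  assumes "\<mu> > 0"
  shows "\<exists>r>0. \<forall>\<^sub>F n in sequentially. real (chain_threshold n (n div r + 1)) < 2 powr (\<mu> * real n)"
proof -
  define \<nu> where "\<nu> = \<mu> * ln 2"
  define c where "c = 2 * \<bar>ln (\<nu> / 24)\<bar>"
  have \<nu>: "\<nu> > 0" and c: "c \<ge> 0" using assms by (simp_all add: \<nu>_def c_def)
  obtain r :: nat where r: "4 * c / \<nu> < real r" using reals_Archimedean2 by blast
  have "0 \<le> 4 * c / \<nu>" using c \<nu> by simp
  then have r_pos: "r > 0" using r by simp
  have r_small: "c / real r \<le> \<nu> / 4" using r r_pos \<nu> by (simp add: field_simps)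
  have bound: "real (chain_threshold n (n div r + 1)) < 2 powr (\<mu> * real n)"
    if n: "1 \<le> n" "4 * c / \<nu> < real n" for n
  proof -
    have "c * real (n div r) \<le> c * (real n / real r)" using c by (intro mult_left_mono of_nat_div_le_of_nat)
    also have "\<dots> = real n * (c / real r)" by simp
    also have "\<dots> \<le> real n * (\<nu> / 4)" using r_small by (intro mult_left_mono) auto
    finally have "c * real (n div r + 1) \<le> real n * \<nu> / 4 + c" by (simp add: algebra_simps)
    moreover have "c < real n * \<nu> / 4" using n(2) \<nu> by (simp add: field_simps)
    moreover have "0 < real n * \<nu>" using n(1) \<nu> by simp
    ultimately have "6 * (\<nu> / 24) * real n + c * real (n div r + 1) < real n * \<nu>" by (simp add: mult.commute)
    then have "exp (6 * (\<nu> / 24) * real n + c * real (n div r + 1)) < 2 powr (\<mu> * real n)"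
      by (simp add: powr_def \<nu>_def mult_ac)
    then show ?thesis
      using chain_threshold_le_exp[of "\<nu> / 24" "n div r + 1" n] n(1) \<nu> unfolding c_def by simp
  qed
  have "\<forall>\<^sub>F n in sequentially. 4 * c / \<nu> < real n" by real_asymp
  with eventually_ge_at_top[of 1]
  have "\<forall>\<^sub>F n in sequentially. real (chain_threshold n (n div r + 1)) < 2 powr (\<mu> * real n)"
    by eventually_elim (rule bound)
  then show ?thesis using r_pos by blast
qed

section \<open>Abstract orientations of points in space\<close>

lemma sgn_three_term:
  fixes u :: real
  assumes "u * x = v * y + w * z" "u \<noteq> 0" "sgn v = sgn u" "sgn w = sgn u" "sgn z = sgn y"
  shows "sgn x = sgn y"
proof -
  have quotients: "v / u > 0" "w / u > 0"
    using assms(2-4) by (auto simp: sgn_if zero_less_divide_iff split: if_splits)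
  have x: "x = (v / u) * y + (w / u) * z" using assms(1,2) by (simp add: field_simps)
  consider (pos) "y > 0" "z > 0" | (neg) "y < 0" "z < 0" | (zero) "y = 0" "z = 0"
    using assms(5) by (auto simp: sgn_if split: if_splits)
  then show ?thesis
  proof cases
    case pos
    then have "x > 0" unfolding x using quotients by (intro add_pos_pos mult_pos_pos)
    then show ?thesis using pos by simp
  next
    case neg
    then have "x < 0" unfolding x using quotients by (intro add_neg_neg mult_pos_neg)
    then show ?thesis using neg by simp
  qed (simp add: x)
qed

text \<open>The sign of \<open>ori a b c d\<close> tells on which side of the plane through \<open>a\<close>, \<open>b\<close>, \<open>c\<close> the point \<open>d\<close> lies.\<close>
locale chirotope =
  fixes ori :: "'p \<Rightarrow> 'p \<Rightarrow> 'p \<Rightarrow> 'p \<Rightarrow> real"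
  assumes swap12: "ori b a c d = - ori a b c d"
    and swap23: "ori a c b d = - ori a b c d"
    and swap34: "ori a b d c = - ori a b c d"
    and grassmann_pluecker:
      "ori a b c d * ori a b e f - ori a b c e * ori a b d f + ori a b c f * ori a b d e = 0"
begin

lemma rotate234: "ori a b c d = ori a c d b"
  using swap34[of a c b d] swap23[of a b c d] by simp

lemma rotate243: "ori a b c d = ori a d b c"
  using rotate234[of a d b c] by simp

lemma ori_same [simp]: "ori a b c a = 0" "ori a b c b = 0" "ori a b c c = 0"
proof -
  show last: "ori a b c c = 0" for a b c using swap34[of a b c c] by simp
  show mid: "ori a b c b = 0" for a b c using swap23[of a c b b] last[of a c b] by simp
  show "ori a b c a = 0" using swap12[of b a c a] mid[of b a c] by simp
qed

definition uniform_on :: "'p set \<Rightarrow> bool" where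
  "uniform_on X \<longleftrightarrow> (\<forall>a b c d. {a, b, c, d} \<subseteq> X \<longrightarrow> distinct [a, b, c, d] \<longrightarrow> ori a b c d \<noteq> 0)"

lemma uniform_onD: "uniform_on X \<Longrightarrow> {a, b, c, d} \<subseteq> X \<Longrightarrow> distinct [a, b, c, d] \<Longrightarrow> ori a b c d \<noteq> 0"
  unfolding uniform_on_def by blast

lemma uniform_on_subset: "uniform_on X \<Longrightarrow> Y \<subseteq> X \<Longrightarrow> uniform_on Y"
  unfolding uniform_on_def by (meson order_trans)

subsection \<open>Orders around an axis\<close>

definition axis_less :: "'p \<Rightarrow> 'p \<Rightarrow> 'p \<Rightarrow> 'p \<Rightarrow> bool" where
  "axis_less a b y z \<longleftrightarrow> ori a b y z > 0"

lemma axis_less_asym: "axis_less a b y z \<Longrightarrow> \<not> axis_less a b z y"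
  using swap34[of a b z y] by (simp add: axis_less_def)

lemma axis_less_irrefl: "\<not> axis_less a b y y"
  by (simp add: axis_less_def)

lemma axis_less_trans:
  assumes "ori a b r z \<noteq> 0" "sgn (ori a b r y) = sgn (ori a b r z)" "sgn (ori a b r w) = sgn (ori a b r z)"
    and "axis_less a b y z" "axis_less a b z w"
  shows "axis_less a b y w"
proof -
  have "ori a b r z * ori a b y w = ori a b r y * ori a b z w + ori a b r w * ori a b y z"
    using grassmann_pluecker[of a b r y z w] by simp
  then have "sgn (ori a b y w) = sgn (ori a b z w)"
    by (rule sgn_three_term) (use assms in \<open>simp_all add: axis_less_def\<close>)
  then show ?thesis using assms(5) by (simp add: axis_less_def sgn_1_pos)
qed

definition strict_axis_order :: "'p \<Rightarrow> 'p \<Rightarrow> 'p set \<Rightarrow> bool" where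
  "strict_axis_order a b Z \<longleftrightarrow> transp_on Z (axis_less a b) \<and> totalp_on Z (axis_less a b)"

lemma strict_axis_order_subset:
  "strict_axis_order a b Z \<Longrightarrow> Z' \<subseteq> Z \<Longrightarrow> strict_axis_order a b Z'"
  unfolding strict_axis_order_def using transp_on_subset totalp_on_subset by blast

lemma strict_axis_orderI:
  assumes "\<And>y. y \<in> Z \<Longrightarrow> sgn (ori a b r y) = \<sigma>" "\<sigma> \<noteq> 0"
    and "\<And>y z. y \<in> Z \<Longrightarrow> z \<in> Z \<Longrightarrow> y \<noteq> z \<Longrightarrow> ori a b y z \<noteq> 0"
  shows "strict_axis_order a b Z"
  unfolding strict_axis_order_def
proof
  show "transp_on Z (axis_less a b)"
  proof (rule transp_onI)
    fix y z w assume Z: "y \<in> Z" "z \<in> Z" "w \<in> Z" and "axis_less a b y z" "axis_less a b z w"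
    moreover have "ori a b r z \<noteq> 0" using assms(1)[OF Z(2)] assms(2) by auto
    ultimately show "axis_less a b y w" using axis_less_trans[of a b r z y w] assms(1) by simp
  qed
  show "totalp_on Z (axis_less a b)"
  proof (rule totalp_onI)
    fix y z assume "y \<in> Z" "z \<in> Z" "y \<noteq> z"
    then show "axis_less a b y z \<or> axis_less a b z y"
      using assms(3)[of y z] swap34[of a b z y] by (auto simp: axis_less_def)
  qed
qed

definition axes_agree :: "'p \<Rightarrow> 'p \<Rightarrow> 'p \<Rightarrow> 'p \<Rightarrow> 'p set \<Rightarrow> bool" where
  "axes_agree a b c d Z \<longleftrightarrow> (\<forall>y\<in>Z. \<forall>z\<in>Z. sgn (ori a b y z) = sgn (ori c d y z))"

lemma axes_agree_subset: "axes_agree a b c d Z \<Longrightarrow> W \<subseteq> Z \<Longrightarrow> axes_agree a b c d W"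
  unfolding axes_agree_def by blast

lemma axes_agree_trans: "axes_agree a b c d Z \<Longrightarrow> axes_agree c d e f Z \<Longrightarrow> axes_agree a b e f Z"
  unfolding axes_agree_def by simp

lemma axes_agree_sym: "axes_agree a b c d Z \<Longrightarrow> axes_agree c d a b Z"
  unfolding axes_agree_def by simp

text \<open>The pairs ordered alike by both axes form a partial order; its antichains are ordered oppositely.\<close>
lemma axes_agree_or_flipped_agree:
  assumes "finite Z" "s * t \<le> card Z" "strict_axis_order a b Z" "strict_axis_order c d Z"
  shows "(\<exists>W\<subseteq>Z. card W = s \<and> axes_agree a b c d W) \<or> (\<exists>W\<subseteq>Z. card W = t \<and> axes_agree b a c d W)"
proof -
  let ?P = "\<lambda>y z. axis_less a b y z \<and> axis_less c d y z"
  have "transp_on Z ?P" "asymp_on Z ?P"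
    using assms(3,4) axis_less_asym unfolding strict_axis_order_def transp_on_def asymp_on_def by blast+
  then consider (chain) W where "W \<subseteq> Z" "card W = s" "totalp_on W ?P"
    | (antichain) W where "W \<subseteq> Z" "card W = t" "\<forall>x\<in>W. \<forall>y\<in>W. \<not> ?P x y"
    using chain_or_antichain[of Z ?P s t] assms(1,2) by blast
  then show ?thesis
  proof cases
    case chain
    have "sgn (ori a b y z) = sgn (ori c d y z)" if "y \<in> W" "z \<in> W" for y z
    proof (cases "y = z")
      case False
      then have "?P y z \<or> ?P z y" using chain(3) that by (simp add: totalp_on_def)
      then show ?thesis using swap34[of a b y z] swap34[of c d y z] by (auto simp: axis_less_def)
    qed simp
    then show ?thesis using chain(1,2) unfolding axes_agree_def by blast
  next
    case antichain
    have "sgn (ori b a y z) = sgn (ori c d y z)" if "y \<in> W" "z \<in> W" for y z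
    proof (cases "y = z")
      case False
      have "axis_less a b y z \<or> axis_less a b z y" "axis_less c d y z \<or> axis_less c d z y"
        using assms(3,4) that antichain(1) False unfolding strict_axis_order_def totalp_on_def by blast+
      moreover have "\<not> ?P y z" "\<not> ?P z y" using antichain(3) that by blast+
      ultimately show ?thesis
        using swap12[of a b y z] swap34[of a b y z] swap34[of c d y z] by (auto simp: axis_less_def)
    qed simp
    then show ?thesis using antichain(1,2) unfolding axes_agree_def by blast
  qed
qed

subsection \<open>Cups and caps seen from a point\<close>

lemma triples_transitive:
  assumes ord: "axis_less q r a b" "axis_less q r b c" "axis_less q r c d" "axis_less q r a c" "axis_less q r b d"
    and pos: "0 < s * ori q a b c" "0 < s * ori q b c d"
  shows "0 < s * ori q a b d" "0 < s * ori q a c d"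
proof -
  have "ori q b r a * ori q b c d = ori q b r c * ori q b a d - ori q b r d * ori q b a c"
    using grassmann_pluecker[of q b r a c d] by simp
  moreover have "ori q b r a = ori q r a b" "ori q b r c = - ori q r b c" "ori q b r d = - ori q r b d"
    "ori q b a d = - ori q a b d" "ori q b a c = - ori q a b c"
    by (rule rotate243[symmetric] swap23)+
  ultimately have "ori q r b c * ori q a b d = ori q r a b * ori q b c d + ori q r b d * ori q a b c" by simp
  then have "ori q r b c * (s * ori q a b d) = ori q r a b * (s * ori q b c d) + ori q r b d * (s * ori q a b c)"
    by algebra
  then have "sgn (s * ori q a b d) = sgn (s * ori q b c d)"
    by (rule sgn_three_term) (use ord pos in \<open>simp_all add: axis_less_def\<close>)
  then show "0 < s * ori q a b d" using pos(2) by (simp add: sgn_1_pos)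
  have "ori q c r a * ori q c b d = ori q c r b * ori q c a d - ori q c r d * ori q c a b"
    using grassmann_pluecker[of q c r a b d] by simp
  moreover have "ori q c r a = ori q r a c" "ori q c r b = ori q r b c" "ori q c r d = - ori q r c d"
    "ori q c b d = - ori q b c d" "ori q c a d = - ori q a c d" "ori q c a b = ori q a b c"
    by (rule rotate243[symmetric] swap23)+
  ultimately have "ori q r b c * ori q a c d = ori q r a c * ori q b c d + ori q r c d * ori q a b c" by simp
  then have "ori q r b c * (s * ori q a c d) = ori q r a c * (s * ori q b c d) + ori q r c d * (s * ori q a b c)"
    by algebra
  then have "sgn (s * ori q a c d) = sgn (s * ori q b c d)"
    by (rule sgn_three_term) (use ord pos in \<open>simp_all add: axis_less_def\<close>)
  then show "0 < s * ori q a c d" using pos(2) by (simp add: sgn_1_pos)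
qed

text \<open>In the projection from \<open>q\<close>, the points \<open>ys\<close> form a convex chain bulging away from \<open>r\<close> if \<open>s = 1\<close>,
  and towards \<open>r\<close> if \<open>s = -1\<close>.\<close>
definition bulge :: "real \<Rightarrow> 'p \<Rightarrow> 'p \<Rightarrow> 'p set \<Rightarrow> 'p list \<Rightarrow> bool" where
  "bulge s q r Z ys \<longleftrightarrow> set ys \<subseteq> Z \<and> sorted_wrt (axis_less q r) ys \<and>
     sorted_wrt3 (\<lambda>a b c. 0 < s * ori q a b c) ys"

lemma bulge_if_triple_chain:
  assumes "strict_axis_order q r Z" "triple_chain (axis_less q r) (\<lambda>a b c. 0 < s * ori q a b c) Z ys"
  shows "bulge s q r Z ys"
proof -
  have "sorted_wrt3 (\<lambda>a b c. 0 < s * ori q a b c) ys"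
  proof (rule successively3_imp_sorted_wrt3)
    fix a b c d
    assume S: "{a, b, c, d} \<subseteq> Z" and lt: "axis_less q r a b" "axis_less q r b c" "axis_less q r c d"
      and "0 < s * ori q a b c" "0 < s * ori q b c d"
    moreover have "axis_less q r a c" "axis_less q r b d"
      using assms(1) S lt unfolding strict_axis_order_def transp_on_def by blast+
    ultimately show "0 < s * ori q a b d \<and> 0 < s * ori q a c d"
      using triples_transitive[of q r a b c d s] by simp
  qed (use assms(2) in \<open>simp_all add: triple_chain_def\<close>)
  then show ?thesis using assms(2) by (simp add: bulge_def triple_chain_def)
qed

lemma bulge_exists:
  assumes "finite Z" "strict_axis_order q r Z" "uniform_on (insert q Z)" "q \<notin> Z" "(k + l) choose k < card Z"
  shows "(\<exists>ys. length ys = k + 2 \<and> bulge (-1) q r Z ys) \<or> (\<exists>ys. length ys = l + 2 \<and> bulge 1 q r Z ys)"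
proof -
  have "0 < -1 * ori q a b c \<or> 0 < 1 * ori q a b c"
    if "{a, b, c} \<subseteq> Z" "axis_less q r a b" "axis_less q r b c" for a b c
  proof -
    have "axis_less q r a c" using assms(2) that unfolding strict_axis_order_def transp_on_def by blast
    then have "distinct [q, a, b, c]" using that assms(4) axis_less_irrefl by auto
    then have "ori q a b c \<noteq> 0" using that(1) by (intro uniform_onD[OF assms(3)]) auto
    then show ?thesis by auto
  qed
  then have "(\<exists>ys. length ys = k + 2 \<and> triple_chain (axis_less q r) (\<lambda>a b c. 0 < -1 * ori q a b c) Z ys) \<or>
    (\<exists>ys. length ys = l + 2 \<and> triple_chain (axis_less q r) (\<lambda>a b c. 0 < 1 * ori q a b c) Z ys)"
    using assms unfolding strict_axis_order_def by (intro cups_caps) auto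
  then show ?thesis using bulge_if_triple_chain[OF assms(2)] by blast
qed

text \<open>Every other point of a bulge is cut off by the plane through \<open>q\<close> and its two neighbours.\<close>
lemma bulge_cuts:
  assumes b: "bulge s q r Z ys" and i: "2 * i + 2 < length ys"
  shows "0 < s * ori q (ys ! (2 * i + 2)) (ys ! (2 * i)) (ys ! (2 * i + 1))"
    and "2 * j + 2 < length ys \<Longrightarrow> j \<noteq> i \<Longrightarrow> s * ori q (ys ! (2 * i + 2)) (ys ! (2 * i)) (ys ! (2 * j + 1)) < 0"
proof -
  have tri: "0 < s * ori q (ys ! i) (ys ! j) (ys ! k)" if "i < j" "j < k" "k < length ys" for i j k
    using b that unfolding bulge_def by (auto dest: sorted_wrt3_nth_less)
  have "0 < s * ori q (ys ! (2 * i)) (ys ! (2 * i + 1)) (ys ! (2 * i + 2))" using tri i by simp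
  then show "0 < s * ori q (ys ! (2 * i + 2)) (ys ! (2 * i)) (ys ! (2 * i + 1))"
    by (subst rotate234) simp
  assume j: "2 * j + 2 < length ys" "j \<noteq> i"
  show "s * ori q (ys ! (2 * i + 2)) (ys ! (2 * i)) (ys ! (2 * j + 1)) < 0"
  proof (cases "j < i")
    case True
    then have "0 < s * ori q (ys ! (2 * j + 1)) (ys ! (2 * i)) (ys ! (2 * i + 2))" using tri i by simp
    moreover have "ori q (ys ! (2 * i + 2)) (ys ! (2 * i)) (ys ! (2 * j + 1)) =
      - ori q (ys ! (2 * j + 1)) (ys ! (2 * i)) (ys ! (2 * i + 2))"
      by (subst rotate234, subst swap23, simp add: rotate234)
    ultimately show ?thesis by simp
  next
    case False
    then have "0 < s * ori q (ys ! (2 * i)) (ys ! (2 * i + 2)) (ys ! (2 * j + 1))" using tri i j by simp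
    then show ?thesis by (subst swap23) simp
  qed
qed

subsection \<open>Points cut off by planes\<close>

definition cut_off_points :: "'p set \<Rightarrow> nat \<Rightarrow> bool" where
  "cut_off_points X n \<longleftrightarrow> (\<exists>V\<subseteq>X. card V = n \<and>
     (\<forall>v\<in>V. \<exists>a\<in>X. \<exists>b\<in>X. \<exists>c\<in>X. 0 < ori a b c v \<and> (\<forall>w\<in>V - {v}. ori a b c w < 0)))"

lemma cut_off_pointsI:
  assumes I: "finite I" "n \<le> card I" "v ` I \<subseteq> X"
    and cut: "\<And>i. i \<in> I \<Longrightarrow> \<exists>a\<in>X. \<exists>b\<in>X. \<exists>c\<in>X. 0 < ori a b c (v i) \<and> (\<forall>j\<in>I - {i}. ori a b c (v j) < 0)"
  shows "cut_off_points X n"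
proof -
  have inj: "inj_on v I"
    by (rule inj_onI) (metis DiffI cut less_asym singletonD)
  obtain J where J: "J \<subseteq> I" "card J = n" using I(2) by (meson obtain_subset_with_card_n)
  show ?thesis
    unfolding cut_off_points_def
  proof (intro exI[of _ "v ` J"] conjI ballI)
    show "v ` J \<subseteq> X" using I(3) J(1) by blast
    show "card (v ` J) = n" using J inj by (simp add: card_image inj_on_subset)
    fix x assume "x \<in> v ` J"
    then obtain i where i: "i \<in> J" "x = v i" by blast
    then obtain a b c where abc: "a \<in> X" "b \<in> X" "c \<in> X" "0 < ori a b c x"
      and neg: "\<forall>j\<in>I - {i}. ori a b c (v j) < 0"
      using cut[of i] J(1) by auto
    have "\<forall>w\<in>v ` J - {x}. ori a b c w < 0" using neg i J(1) by auto
    then show "\<exists>a\<in>X. \<exists>b\<in>X. \<exists>c\<in>X. 0 < ori a b c x \<and> (\<forall>w\<in>v ` J - {x}. ori a b c w < 0)"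
      using abc by blast
  qed
qed

lemma cut_off_points_if_bulge_neg:
  assumes b: "bulge (-1) q r Z ys" "2 * n < length ys" and X: "Z \<subseteq> X" "q \<in> X"
  shows "cut_off_points X n"
proof (rule cut_off_pointsI[where I = "{..<n}" and v = "\<lambda>i. ys ! (2 * i + 1)"])
  have ys: "ys ! i \<in> X" if "i < length ys" for i
    using b(1) that X(1) unfolding bulge_def by (meson nth_mem subsetD)
  then show "(\<lambda>i. ys ! (2 * i + 1)) ` {..<n} \<subseteq> X" using b(2) by auto
  fix i assume i: "i \<in> {..<n}"
  have "0 < ori q (ys ! (2 * i)) (ys ! (2 * i + 2)) (ys ! (2 * i + 1))"
    using bulge_cuts(1)[OF b(1), of i] i b(2) swap23[of q "ys ! (2 * i + 2)"] by simp
  moreover have "\<forall>j\<in>{..<n} - {i}. ori q (ys ! (2 * i)) (ys ! (2 * i + 2)) (ys ! (2 * j + 1)) < 0"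
    using bulge_cuts(2)[OF b(1), of i] i b(2) swap23[of q "ys ! (2 * i + 2)"] by simp
  moreover have "ys ! (2 * i) \<in> X" "ys ! (2 * i + 2) \<in> X" using ys i b(2) by auto
  ultimately show "\<exists>a\<in>X. \<exists>b\<in>X. \<exists>c\<in>X. 0 < ori a b c (ys ! (2 * i + 1)) \<and>
      (\<forall>j\<in>{..<n} - {i}. ori a b c (ys ! (2 * j + 1)) < 0)"
    using X(2) by blast
qed auto

text \<open>Seen from \<open>q\<close>, every line through two points of \<open>Z\<close> leaves \<open>r\<close> and all of \<open>U\<close> on the same side.\<close>
definition one_sided :: "'p \<Rightarrow> 'p \<Rightarrow> 'p set \<Rightarrow> 'p set \<Rightarrow> bool" where
  "one_sided q r Z U \<longleftrightarrow> (\<forall>y\<in>Z. \<forall>z\<in>Z. axis_less q r y z \<longrightarrow> (\<forall>x\<in>U. 0 < ori q x y z))"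

definition exposed :: "'p set \<Rightarrow> 'p set \<Rightarrow> 'p set \<Rightarrow> bool" where
  "exposed X Z U \<longleftrightarrow> (\<exists>q\<in>X - Z. \<exists>r. strict_axis_order q r Z \<and> one_sided q r Z U)"

lemma exposed_mono: "exposed X Z U \<Longrightarrow> V \<subseteq> U \<Longrightarrow> exposed X Z V"
  unfolding exposed_def one_sided_def by blast

lemma bulge_cuts_one_sided:
  assumes b: "bulge s q r Z ys" and i: "2 * i + 2 < length ys" and U: "one_sided q r Z U" "w \<in> U"
  shows "ori q (ys ! (2 * i + 2)) (ys ! (2 * i)) w < 0"
proof -
  let ?a = "ys ! (2 * i)" and ?b = "ys ! (2 * i + 2)"
  have "axis_less q r ?a ?b" "?a \<in> Z" "?b \<in> Z"
    using b i nth_mem[of "2 * i" ys] nth_mem[of "2 * i + 2" ys]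
    by (auto simp: bulge_def sorted_wrt_nth_less)
  then have "0 < ori q w ?a ?b" using U unfolding one_sided_def by blast
  moreover have "ori q ?b ?a w = - ori q w ?a ?b"
    by (subst rotate234, subst swap23, simp add: rotate234)
  ultimately show ?thesis by simp
qed

lemma bulge_if_exposed:
  assumes "uniform_on X" "finite Z" "Z \<subseteq> X" "exposed X Z U" "chain_threshold n l < card Z" "\<not> cut_off_points X n"
  shows "\<exists>q\<in>X. \<exists>r ys. length ys = 2 * l + 2 \<and> bulge 1 q r Z ys \<and> one_sided q r Z U"
proof -
  obtain q r where q: "q \<in> X - Z" "strict_axis_order q r Z" "one_sided q r Z U"
    using assms(4) unfolding exposed_def by blast
  have "(2 * n + 2 * l choose (2 * n)) = chain_threshold n l"
    unfolding chain_threshold_def by (subst binomial_symmetric) auto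
  moreover have "uniform_on (insert q Z)" using q(1) assms(1,3) by (auto intro: uniform_on_subset)
  ultimately have "(\<exists>ys. length ys = 2 * n + 2 \<and> bulge (-1) q r Z ys) \<or>
      (\<exists>ys. length ys = 2 * l + 2 \<and> bulge 1 q r Z ys)"
    using assms(2,5) q by (intro bulge_exists) auto
  then show ?thesis using cut_off_points_if_bulge_neg[of q r Z _ n X] assms(3,6) q by fastforce
qed

text \<open>Bulges of mutually exposed sets combine, as the planes cutting off points of one of them leave all
  the others on the negative side.\<close>
lemma cut_off_points_of_exposed_family:
  assumes F: "finite F" "n \<le> card F * l" and X: "uniform_on X"
    and Z: "\<And>j. j \<in> F \<Longrightarrow> finite (Z j) \<and> Z j \<subseteq> X \<and> chain_threshold n l < card (Z j) \<and>
      exposed X (Z j) (\<Union>i\<in>F - {j}. Z i)"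
  shows "cut_off_points X n"
proof (rule ccontr)
  assume none: "\<not> cut_off_points X n"
  have "\<exists>q\<in>X. \<exists>r ys. length ys = 2 * l + 2 \<and> bulge 1 q r (Z j) ys \<and> one_sided q r (Z j) (\<Union>i\<in>F - {j}. Z i)"
    if "j \<in> F" for j
    using bulge_if_exposed[OF X _ _ _ _ none] Z[OF that] by blast
  then obtain q r ys where "\<And>j. j \<in> F \<Longrightarrow> q j \<in> X \<and> length (ys j) = 2 * l + 2 \<and>
      bulge 1 (q j) (r j) (Z j) (ys j) \<and> one_sided (q j) (r j) (Z j) (\<Union>i\<in>F - {j}. Z i)"
    unfolding Bex_def by metis
  then have q: "q j \<in> X" and ys: "length (ys j) = 2 * l + 2" "bulge 1 (q j) (r j) (Z j) (ys j)"
    and side: "one_sided (q j) (r j) (Z j) (\<Union>i\<in>F - {j}. Z i)" if "j \<in> F" for j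
    using that by blast+
  have ysZ: "ys j ! i \<in> Z j" if "j \<in> F" "i < 2 * l + 2" for i j
    using ys[OF that(1)] that(2) unfolding bulge_def by (metis nth_mem subsetD)
  have "cut_off_points X n"
  proof (rule cut_off_pointsI[where I = "F \<times> {..<l}" and v = "\<lambda>(j, i). ys j ! (2 * i + 1)"])
    show "(\<lambda>(j, i). ys j ! (2 * i + 1)) ` (F \<times> {..<l}) \<subseteq> X" using ysZ Z by fastforce
    fix x assume "x \<in> F \<times> {..<l}"
    then obtain j i where x: "x = (j, i)" "j \<in> F" "i < l" by auto
    let ?a = "ys j ! (2 * i)" and ?b = "ys j ! (2 * i + 2)"
    have len: "2 * i + 2 < length (ys j)" using x ys(1) by simp
    have "ori (q j) ?b ?a (ys j' ! (2 * i' + 1)) < 0" if "j' \<in> F" "i' < l" "(j', i') \<noteq> x" for j' i'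
    proof (cases "j' = j")
      case True
      then show ?thesis using bulge_cuts(2)[OF ys(2)[OF x(2)] len, of i'] x(1) that ys(1) by auto
    next
      case False
      then show ?thesis
        using bulge_cuts_one_sided[OF ys(2)[OF x(2)] len side[OF x(2)]] ysZ[of j' "2 * i' + 1"] that by auto
    qed
    then have "\<forall>y\<in>F \<times> {..<l} - {x}. ori (q j) ?b ?a (case y of (j, i) \<Rightarrow> ys j ! (2 * i + 1)) < 0" by auto
    moreover have "0 < ori (q j) ?b ?a (ys j ! (2 * i + 1))" using bulge_cuts(1)[OF ys(2)[OF x(2)] len] by simp
    moreover have "?a \<in> X" "?b \<in> X" using ysZ[OF x(2)] Z[OF x(2)] x(3) by auto
    ultimately show "\<exists>a\<in>X. \<exists>b\<in>X. \<exists>c\<in>X. 0 < ori a b c (case x of (j, i) \<Rightarrow> ys j ! (2 * i + 1)) \<and>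
        (\<forall>y\<in>F \<times> {..<l} - {x}. ori a b c (case y of (j, i) \<Rightarrow> ys j ! (2 * i + 1)) < 0)"
      using q[OF x(2)] unfolding x(1) prod.case by blast
  qed (use F in auto)
  then show False using none by blast
qed

end

section \<open>Clusters along the moment curve\<close>

definition position_sign :: "nat \<Rightarrow> nat \<Rightarrow> nat \<Rightarrow> nat \<Rightarrow> real" where
  "position_sign a b c d = sgn (real b - real a) * sgn (real c - real a) * sgn (real d - real a) *
     sgn (real c - real b) * sgn (real d - real b) * sgn (real d - real c)"

lemma sgn_diff_commute: "sgn (real a - real b) = - sgn (real b - real a)"
  by (simp flip: sgn_minus)

lemma position_sign_swap:
  "position_sign b a c d = - position_sign a b c d"
  "position_sign a c b d = - position_sign a b c d"
  "position_sign a b d c = - position_sign a b c d"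
  by (simp_all add: position_sign_def sgn_diff_commute[of a b] sgn_diff_commute[of b c] sgn_diff_commute[of c d])

lemma position_sign_sorted: "a < b \<Longrightarrow> b < c \<Longrightarrow> c < d \<Longrightarrow> position_sign a b c d = 1"
  by (simp add: position_sign_def)

lemma position_sign_nonzero: "distinct [a, b, c, d] \<Longrightarrow> position_sign a b c d \<noteq> 0"
  by (auto simp: position_sign_def sgn_zero_iff)

lemma position_sign_shift:
  assumes "d \<le> d'" "\<And>e. e \<in> {a, b, c} \<Longrightarrow> e < d \<or> d' < e"
  shows "position_sign a b c d = position_sign a b c d'"
proof -
  have "sgn (real d - real e) = sgn (real d' - real e)" if "e \<in> {a, b, c}" for e
    using assms(2)[OF that] assms(1) by (auto simp: sgn_if)
  then show ?thesis by (simp add: position_sign_def)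
qed

lemma position_sign_neighbours:
  assumes "l < t" "t < r" "\<And>e. e \<in> {a, b, s} \<Longrightarrow> e < l \<or> r < e"
  shows "position_sign a b l t = position_sign a b l r" "position_sign a b t r = position_sign a b l r"
    and "position_sign a b t s = position_sign a b l s" "position_sign a b r s = position_sign a b l s"
proof -
  have "position_sign a b l t = position_sign a b l r" "position_sign a b r t = position_sign a b r l"
    "position_sign a b s t = position_sign a b s l" "position_sign a b s r = position_sign a b s l"
    using assms by (intro position_sign_shift position_sign_shift[symmetric]; force)+
  then show "position_sign a b l t = position_sign a b l r" "position_sign a b t r = position_sign a b l r"
    "position_sign a b t s = position_sign a b l s" "position_sign a b r s = position_sign a b l s"
    using position_sign_swap(3)[of a b] by metis+
qed

text \<open>Around the axis through the positions \<open>q\<close> and \<open>s\<close>, position \<open>t\<close> lies between \<open>l\<close> and \<open>r\<close>.\<close>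
definition in_wedge :: "nat \<Rightarrow> nat \<Rightarrow> nat \<Rightarrow> nat \<Rightarrow> nat \<Rightarrow> bool" where
  "in_wedge q s l r t \<longleftrightarrow> position_sign q s l t = position_sign q s l r \<and>
     position_sign q s t r = position_sign q s l r"

lemma in_wedge_from_left:
  assumes "m < u" "u < s" "s < w" "m < t \<and> t < u \<or> w < t"
  shows "in_wedge m s u w t"
  using assms by (auto simp: in_wedge_def position_sign_def)

lemma in_wedge_from_right:
  assumes "m < u" "u < s" "s < M" "m < t \<and> t < u \<or> s < t \<and> t < M"
  shows "in_wedge u s m M t"
  using assms by (auto simp: in_wedge_def position_sign_def)

lemma adjacent_swaps_sort:
  assumes sorted: "P (sort xs)" and swap: "\<And>us x y vs. P (us @ y # x # vs) \<Longrightarrow> P (us @ x # y # vs)"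
  shows "P xs"
proof -
  have insert: "P (us @ insort x vs) \<Longrightarrow> P (us @ x # vs)" for us x vs
  proof (induction vs arbitrary: us)
    case (Cons v vs)
    show ?case
    proof (cases "x \<le> v")
      case False
      then have "P (us @ v # x # vs)" using Cons.prems Cons.IH[of "us @ [v]"] by simp
      then show ?thesis by (rule swap)
    qed (use Cons.prems in simp)
  qed simp
  have "P (us @ sort xs) \<Longrightarrow> P (us @ xs)" for us
  proof (induction xs arbitrary: us)
    case (Cons x xs)
    then have "P (us @ x # sort xs)" by (intro insert) simp
    then show ?case using Cons.IH[of "us @ [x]"] by simp
  qed simp
  from this[of "[]"] show ?thesis using sorted by simp
qed

context chirotope
begin

definition homogeneous :: "real \<Rightarrow> (nat \<Rightarrow> 'p) \<Rightarrow> nat \<Rightarrow> bool" where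
  "homogeneous \<epsilon> x n \<longleftrightarrow> (\<forall>a b c d. a < b \<longrightarrow> b < c \<longrightarrow> c < d \<longrightarrow> d \<le> n \<longrightarrow>
     sgn (ori (x a) (x b) (x c) (x d)) = \<epsilon>)"

definition sign_of_positions :: "real \<Rightarrow> (nat \<Rightarrow> 'p) \<Rightarrow> nat list \<Rightarrow> bool" where
  "sign_of_positions \<epsilon> x ts \<longleftrightarrow> (\<forall>a b c d. ts = [a, b, c, d] \<longrightarrow>
     sgn (ori (x a) (x b) (x c) (x d)) = \<epsilon> * position_sign a b c d)"

lemma sign_of_positions_swap:
  assumes "sign_of_positions \<epsilon> x (us @ t # s # vs)"
  shows "sign_of_positions \<epsilon> x (us @ s # t # vs)"
  unfolding sign_of_positions_def
proof (intro allI impI)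
  fix a b c d assume "us @ s # t # vs = [a, b, c, d]"
  then consider (first) "us = []" "s = a" "t = b" "vs = [c, d]" | (middle) "us = [a]" "s = b" "t = c" "vs = [d]"
    | (last) "us = [a, b]" "s = c" "t = d" "vs = []"
    by (auto simp: append_eq_Cons_conv)
  then show "sgn (ori (x a) (x b) (x c) (x d)) = \<epsilon> * position_sign a b c d"
  proof cases
    case first
    then show ?thesis using assms swap12[of "x a" "x b" "x c" "x d"] position_sign_swap(1)[of a b c d]
      by (simp add: sign_of_positions_def sgn_minus)
  next
    case middle
    then show ?thesis using assms swap23[of "x a" "x b" "x c" "x d"] position_sign_swap(2)[of a b c d]
      by (simp add: sign_of_positions_def sgn_minus)
  next
    case last
    then show ?thesis using assms swap34[of "x a" "x b" "x c" "x d"] position_sign_swap(3)[of a b c d]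
      by (simp add: sign_of_positions_def sgn_minus)
  qed
qed

lemma sgn_homogeneous:
  assumes "homogeneous \<epsilon> x n" "{a, b, c, d} \<subseteq> {..n}" "distinct [a, b, c, d]"
  shows "sgn (ori (x a) (x b) (x c) (x d)) = \<epsilon> * position_sign a b c d"
proof -
  define ts where "ts = sort [a, b, c, d]"
  have "sorted (sort us)" "distinct (sort us) = distinct us" "set (sort us) = set us"
    "length (sort us) = length us"
    for us :: "nat list" by simp_all
  from this[of "[a, b, c, d]"]
  have ts: "sorted ts" "distinct ts" "set ts \<subseteq> {..n}" "length ts = Suc (Suc (Suc (Suc 0)))"
    unfolding ts_def[symmetric] using assms(2,3) by simp_all
  then obtain a' b' c' d' where "ts = [a', b', c', d']" by (auto simp: length_Suc_conv)
  moreover from this have "a' < b'" "b' < c'" "c' < d'" "d' \<le> n" using ts(1-3) by auto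
  ultimately have "sign_of_positions \<epsilon> x ts"
    using assms(1) by (simp add: sign_of_positions_def homogeneous_def position_sign_sorted)
  then have "sign_of_positions \<epsilon> x [a, b, c, d]"
    using adjacent_swaps_sort[of "sign_of_positions \<epsilon> x"] sign_of_positions_swap unfolding ts_def by blast
  then show ?thesis by (simp add: sign_of_positions_def)
qed

lemma homogeneous_inj_on:
  assumes "homogeneous \<epsilon> x n" "\<epsilon> \<noteq> 0" "3 \<le> n"
  shows "inj_on x {..n}"
proof (rule inj_onI, rule ccontr)
  fix a b assume ab: "a \<in> {..n}" "b \<in> {..n}" "x a = x b" "a \<noteq> b"
  then have "2 \<le> card ({..n} - {a, b})" using assms(3) by (simp add: card_Diff_subset)
  then obtain c d where cd: "{c, d} \<subseteq> {..n} - {a, b}" "c \<noteq> d"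
    by (metis card_2_iff obtain_subset_with_card_n)
  then have "distinct [a, c, d, b]" "{a, c, d, b} \<subseteq> {..n}" using ab by auto
  then have "sgn (ori (x a) (x c) (x d) (x b)) \<noteq> 0"
    using sgn_homogeneous[OF assms(1)] position_sign_nonzero assms(2) by (metis mult_eq_0_iff)
  then show False using ab(3) by simp
qed

end

text \<open>The positions \<open>0, \<dots>, 4 * K\<close> carry points that are ordered like points on the moment curve or its
  mirror image: position \<open>4 * j + 2\<close> carries all points of the cluster \<open>C j\<close>, any other position \<open>t\<close>
  the single point \<open>p t\<close>. Nothing is assumed on quadruples with points of two clusters.\<close>
locale moment_clusters = chirotope ori
  for ori :: "'p \<Rightarrow> 'p \<Rightarrow> 'p \<Rightarrow> 'p \<Rightarrow> real" +
  fixes \<epsilon> :: real and X :: "'p set" and K :: nat and p :: "nat \<Rightarrow> 'p" and C :: "nat \<Rightarrow> 'p set"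
  assumes finite_X: "finite X"
    and uniform_X: "uniform_on X"
    and sign_nonzero: "\<epsilon> \<noteq> 0"
    and K_pos: "0 < K"
    and p_in_X: "\<And>t. t \<le> 4 * K \<Longrightarrow> t mod 4 \<noteq> 2 \<Longrightarrow> p t \<in> X"
    and C_subset_X: "\<And>j. j < K \<Longrightarrow> C j \<subseteq> X"
    and C_nonempty: "\<And>j. j < K \<Longrightarrow> C j \<noteq> {}"
    and extends: "\<And>j y. j < K \<Longrightarrow> y \<in> C j \<Longrightarrow> \<exists>x. homogeneous \<epsilon> x (4 * K) \<and> x (4 * j + 2) = y \<and>
      (\<forall>t\<le>4 * K. t mod 4 \<noteq> 2 \<longrightarrow> x t = p t)"
begin

definition single :: "nat \<Rightarrow> bool" where
  "single t \<longleftrightarrow> t \<le> 4 * K \<and> t mod 4 \<noteq> 2"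

lemma single_neq_cluster: "single t \<Longrightarrow> t \<noteq> 4 * j + 2"
  unfolding single_def by presburger

lemma cluster_sequence:
  assumes "j < K" "y \<in> C j"
  obtains x where "homogeneous \<epsilon> x (4 * K)" "x (4 * j + 2) = y" "\<And>t. single t \<Longrightarrow> x t = p t"
  using extends[OF assms] by (auto simp: single_def)

lemma sgn_one_cluster:
  assumes "j < K" "y \<in> C j" "single a" "single b" "single c" "distinct [a, b, c]"
  shows "sgn (ori (p a) y (p b) (p c)) = \<epsilon> * position_sign a (4 * j + 2) b c"
    and "sgn (ori (p a) (p b) y (p c)) = \<epsilon> * position_sign a b (4 * j + 2) c"
    and "sgn (ori (p a) (p b) (p c) y) = \<epsilon> * position_sign a b c (4 * j + 2)"
proof -
  obtain x where x: "homogeneous \<epsilon> x (4 * K)" "x (4 * j + 2) = y" "\<And>t. single t \<Longrightarrow> x t = p t"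
    using cluster_sequence assms(1,2) by metis
  let ?s = "4 * j + 2"
  have pos: "{a, b, c, ?s} \<subseteq> {..4 * K}" using assms by (auto simp: single_def)
  have new: "?s \<notin> {a, b, c}" using assms(3-5) single_neq_cluster by blast
  show "sgn (ori (p a) y (p b) (p c)) = \<epsilon> * position_sign a ?s b c"
    using sgn_homogeneous[OF x(1), of a ?s b c] pos new x(2,3) assms(3-6) by auto
  show "sgn (ori (p a) (p b) y (p c)) = \<epsilon> * position_sign a b ?s c"
    using sgn_homogeneous[OF x(1), of a b ?s c] pos new x(2,3) assms(3-6) by auto
  show "sgn (ori (p a) (p b) (p c) y) = \<epsilon> * position_sign a b c ?s"
    using sgn_homogeneous[OF x(1), of a b c ?s] pos new x(2,3) assms(3-6) by auto
qed

lemma sgn_singles: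
  assumes "single a" "single b" "single c" "single d" "distinct [a, b, c, d]"
  shows "sgn (ori (p a) (p b) (p c) (p d)) = \<epsilon> * position_sign a b c d"
proof -
  obtain y where "y \<in> C 0" using C_nonempty K_pos by blast
  then obtain x where "homogeneous \<epsilon> x (4 * K)" "\<And>t. single t \<Longrightarrow> x t = p t"
    using cluster_sequence K_pos by metis
  then show ?thesis using sgn_homogeneous[of \<epsilon> x "4 * K" a b c d] assms by (auto simp: single_def)
qed

lemma single_notin_cluster: "j < K \<Longrightarrow> single a \<Longrightarrow> p a \<notin> C j"
proof
  assume j: "j < K" and a: "single a" and "p a \<in> C j"
  then obtain x where x: "homogeneous \<epsilon> x (4 * K)" "x (4 * j + 2) = p a" "x a = p a"
    using cluster_sequence by metis
  have "inj_on x {..4 * K}" using homogeneous_inj_on[OF x(1) sign_nonzero] K_pos by simp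
  then have "a = 4 * j + 2" using x(2,3) j a by (auto simp: inj_on_def single_def)
  then show False using single_neq_cluster[OF a] by blast
qed

lemma single_points_neq:
  assumes "single a" "single b" "a \<noteq> b"
  shows "p a \<noteq> p b"
proof -
  obtain y where "y \<in> C 0" using C_nonempty K_pos by blast
  then obtain x where x: "homogeneous \<epsilon> x (4 * K)" "\<And>t. single t \<Longrightarrow> x t = p t"
    using cluster_sequence K_pos by metis
  have "inj_on x {..4 * K}" using homogeneous_inj_on[OF x(1) sign_nonzero] K_pos by simp
  then show ?thesis using x(2)[OF assms(1)] x(2)[OF assms(2)] assms by (auto simp: inj_on_def single_def)
qed

text \<open>The two single points adjacent to a cluster span a line that its points cross, so the sign of a
  quadruple with two cluster points is interpolated from those with one.\<close>
lemma sgn_two_clusters: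
  assumes ij: "i < K" "j < K" "i \<noteq> j" "x \<in> C i" "y \<in> C j"
    and ab: "single a" "single b" "a \<noteq> b" "{a, b} \<inter> {4 * i + 1, 4 * i + 3} = {}"
  shows "sgn (ori (p a) (p b) x y) = \<epsilon> * position_sign a b (4 * i + 2) (4 * j + 2)"
proof -
  let ?l = "4 * i + 1" and ?r = "4 * i + 3" and ?t = "4 * i + 2" and ?s = "4 * j + 2"
  have lr: "single ?l" "single ?r" using ij by (simp_all add: single_def)
  have off: "e < ?l \<or> ?r < e" if "e \<in> {a, b, ?s}" for e
    using that ab(4) ij(3) single_neq_cluster[OF ab(1), of i] single_neq_cluster[OF ab(2), of i] by force
  have dist: "distinct [a, b, ?l]" "distinct [a, b, ?r]" "distinct [a, b, ?l, ?r]"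
    using off ab(3) by force+
  have sgn_lr: "sgn (ori (p a) (p b) (p ?l) (p ?r)) = \<epsilon> * position_sign a b ?l ?r"
    using sgn_singles lr ab dist by blast
  note shift = position_sign_neighbours[of ?l ?t ?r a b ?s, OF _ _ off]
  have "ori (p a) (p b) (p ?l) (p ?r) * ori (p a) (p b) x y =
    ori (p a) (p b) (p ?l) x * ori (p a) (p b) (p ?r) y + ori (p a) (p b) x (p ?r) * ori (p a) (p b) (p ?l) y"
    using grassmann_pluecker[of "p a" "p b" "p ?l" "p ?r" x y] swap34[of "p a" "p b" x "p ?r"]
    by (simp add: mult.commute)
  then have "sgn (ori (p a) (p b) x y) = sgn (ori (p a) (p b) (p ?r) y)"
  proof (rule sgn_three_term)
    show "ori (p a) (p b) (p ?l) (p ?r) \<noteq> 0" using sgn_lr position_sign_nonzero[OF dist(3)] sign_nonzero by force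
    show "sgn (ori (p a) (p b) (p ?l) x) = sgn (ori (p a) (p b) (p ?l) (p ?r))"
      using sgn_one_cluster(3)[OF ij(1,4) ab(1,2) lr(1) dist(1)] sgn_lr shift(1) by simp
    show "sgn (ori (p a) (p b) x (p ?r)) = sgn (ori (p a) (p b) (p ?l) (p ?r))"
      using sgn_one_cluster(2)[OF ij(1,4) ab(1,2) lr(2) dist(2)] sgn_lr shift(2) by simp
    show "sgn (ori (p a) (p b) (p ?l) y) = sgn (ori (p a) (p b) (p ?r) y)"
      using sgn_one_cluster(3)[OF ij(2,5) ab(1,2)] lr dist(1,2) shift(4) by simp
  qed
  also have "\<dots> = \<epsilon> * position_sign a b ?t ?s"
    using sgn_one_cluster(3)[OF ij(2,5) ab(1,2) lr(2) dist(2)] shift(3,4) by simp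
  finally show ?thesis .
qed

corollary sgn_two_clusters_rotated:
  assumes "i < K" "j < K" "i \<noteq> j" "x \<in> C i" "y \<in> C j"
    and "single a" "single b" "a \<noteq> b" "{a, b} \<inter> {4 * i + 1, 4 * i + 3} = {}"
  shows "sgn (ori (p a) y (p b) x) = \<epsilon> * position_sign a (4 * j + 2) b (4 * i + 2)"
    and "sgn (ori (p a) y x (p b)) = \<epsilon> * position_sign a (4 * j + 2) (4 * i + 2) b"
proof -
  have "position_sign a b (4 * i + 2) (4 * j + 2) = position_sign a (4 * j + 2) b (4 * i + 2)"
    using position_sign_swap(2)[of a "4 * j + 2" b "4 * i + 2"]
      position_sign_swap(3)[of a b "4 * j + 2" "4 * i + 2"] by simp
  then show first: "sgn (ori (p a) y (p b) x) = \<epsilon> * position_sign a (4 * j + 2) b (4 * i + 2)"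
    using sgn_two_clusters[OF assms] rotate234[of "p a" y "p b" x] by simp
  show "sgn (ori (p a) y x (p b)) = \<epsilon> * position_sign a (4 * j + 2) (4 * i + 2) b"
    using first swap34[of "p a" y x "p b"] position_sign_swap(3)[of a "4 * j + 2" "4 * i + 2" b]
    by (simp add: sgn_minus)
qed

lemma strict_axis_order_cluster:
  assumes "j < K" "single a" "single b" "a \<noteq> b"
  shows "strict_axis_order (p a) (p b) (C j)"
proof -
  have "{0, 1, 3} - {a, b} \<noteq> {}" by auto
  then obtain c where "c \<in> {0, 1, 3}" "c \<notin> {a, b}" by blast
  then have c: "single c" "distinct [a, b, c]" using K_pos assms(4) by (auto simp: single_def)
  show ?thesis
  proof (rule strict_axis_orderI)
    show "sgn (ori (p a) (p b) (p c) y) = \<epsilon> * position_sign a b c (4 * j + 2)" if "y \<in> C j" for y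
      using sgn_one_cluster(3)[OF assms(1) that assms(2,3) c] .
    show "\<epsilon> * position_sign a b c (4 * j + 2) \<noteq> 0"
      using c assms(2,3) single_neq_cluster position_sign_nonzero[of a b c "4 * j + 2"] sign_nonzero by auto
    show "ori (p a) (p b) y z \<noteq> 0" if "y \<in> C j" "z \<in> C j" "y \<noteq> z" for y z
      using that single_notin_cluster[OF assms(1)] single_points_neq[OF assms(2-4)] assms(1-3)
        C_subset_X[OF assms(1)] p_in_X
      by (intro uniform_onD[OF uniform_X]) (auto simp: single_def)
  qed
qed

lemma sgn_seen_from_single:
  assumes ij: "i < K" "j < K" "i \<noteq> j" "x \<in> C i" "y \<in> C j"
    and q: "single q" "single l" "single r" "distinct [q, l, r]" "{q, l, r} \<inter> {4 * i + 1, 4 * i + 3} = {}"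
    and wedge: "in_wedge q (4 * j + 2) l r (4 * i + 2)"
    and agree: "sgn (ori (p q) (p l) y z) = sgn (ori (p q) (p r) y z)"
  shows "sgn (ori (p q) x y z) = sgn (ori (p q) (p l) y z)"
proof -
  have lr: "sgn (ori (p q) y (p l) (p r)) = \<epsilon> * position_sign q (4 * j + 2) l r"
    by (rule sgn_one_cluster(1)[OF ij(2,5) q(1-4)])
  have "ori (p q) y (p l) (p r) * ori (p q) y x z =
    ori (p q) y (p l) x * ori (p q) y (p r) z + ori (p q) y x (p r) * ori (p q) y (p l) z"
    using grassmann_pluecker[of "p q" y "p l" "p r" x z] swap34[of "p q" y x "p r"] by (simp add: mult.commute)
  then have "sgn (ori (p q) y x z) = sgn (ori (p q) y (p r) z)"
  proof (rule sgn_three_term)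
    have "position_sign q (4 * j + 2) l r \<noteq> 0"
      using q single_neq_cluster by (intro position_sign_nonzero) auto
    then show "ori (p q) y (p l) (p r) \<noteq> 0" using lr sign_nonzero by force
    show "sgn (ori (p q) y (p l) x) = sgn (ori (p q) y (p l) (p r))"
      unfolding lr using sgn_two_clusters_rotated(1)[OF ij, of q l] q wedge by (auto simp: in_wedge_def)
    show "sgn (ori (p q) y x (p r)) = sgn (ori (p q) y (p l) (p r))"
      unfolding lr using sgn_two_clusters_rotated(2)[OF ij, of q r] q wedge by (auto simp: in_wedge_def)
    show "sgn (ori (p q) y (p l) z) = sgn (ori (p q) y (p r) z)"
      unfolding swap23[of "p q" y "p l" z] swap23[of "p q" y "p r" z] using agree by (simp add: sgn_minus)
  qed
  then show ?thesis
    using agree swap23[of "p q" x y z] swap23[of "p q" "p r" y z] by (simp add: sgn_minus)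
qed

lemma exposed_if_axes_agree:
  assumes j: "j < K" "Z \<subseteq> C j" and q: "single q" "single l" "single r" "distinct [q, l, r]"
    and agree: "axes_agree (p q) (p l) (p q) (p r) Z"
    and F: "\<And>i. i \<in> F \<Longrightarrow> i < K \<and> i \<noteq> j \<and> {q, l, r} \<inter> {4 * i + 1, 4 * i + 3} = {} \<and>
      in_wedge q (4 * j + 2) l r (4 * i + 2)"
  shows "exposed X Z (\<Union>i\<in>F. C i)"
  unfolding exposed_def one_sided_def
proof (intro bexI exI conjI ballI impI)
  show "p q \<in> X - Z" using p_in_X q(1) single_notin_cluster[OF j(1) q(1)] j(2) by (auto simp: single_def)
  show "strict_axis_order (p q) (p l) Z"
    using strict_axis_order_cluster[OF j(1) q(1,2)] q(4) j(2) strict_axis_order_subset by auto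
  fix y z x assume yz: "y \<in> Z" "z \<in> Z" "axis_less (p q) (p l) y z" and "x \<in> (\<Union>i\<in>F. C i)"
  then obtain i where i: "i \<in> F" "x \<in> C i" by blast
  have "y \<in> C j" using yz(1) j(2) by blast
  moreover have "sgn (ori (p q) (p l) y z) = sgn (ori (p q) (p r) y z)"
    using agree yz(1,2) by (simp add: axes_agree_def)
  ultimately have "sgn (ori (p q) x y z) = sgn (ori (p q) (p l) y z)"
    using F[OF i(1)] by (intro sgn_seen_from_single[OF _ j(1) _ i(2) _ q]) simp_all
  then show "0 < ori (p q) x y z" using yz(3) by (simp add: axis_less_def sgn_1_pos)
qed

definition framed :: "nat set \<Rightarrow> nat \<Rightarrow> nat \<Rightarrow> nat \<Rightarrow> nat \<Rightarrow> nat \<Rightarrow> bool" where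
  "framed F j m u w M \<longleftrightarrow> single m \<and> single u \<and> single w \<and> single M \<and>
     m < u \<and> u < 4 * j + 2 \<and> 4 * j + 2 < w \<and> w \<le> M \<and>
     (\<forall>i\<in>F - {j}. {m, u, w, M} \<inter> {4 * i + 1, 4 * i + 3} = {} \<and>
       (m < 4 * i + 2 \<and> 4 * i + 2 < u \<or> w < 4 * i + 2 \<and> 4 * i + 2 < M))"

text \<open>By the agreement assumption, the direction of any two points of \<open>Z\<close> avoids the cone spanned by
  \<open>m\<close>, \<open>u\<close>, \<open>w\<close>, \<open>M\<close>, which contains all other clusters. The sign with respect to the axis \<open>m u\<close> decides
  whether the separating planes pass through \<open>m\<close> or through \<open>u\<close>.\<close>
lemma exposed_subcluster:
  assumes j: "j < K" "Z \<subseteq> C j" "s * s \<le> card Z" and F: "F \<subseteq> {..<K}"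
    and framed: "framed F j m u w M" and agree: "axes_agree (p u) (p M) (p m) (p w) Z"
  shows "\<exists>W\<subseteq>Z. card W = s \<and> exposed X W (\<Union>i\<in>F - {j}. C i)"
proof -
  have pos: "single m" "single u" "single w" "single M" "m < u" "u < 4 * j + 2" "4 * j + 2 < w" "w \<le> M"
    and other: "\<And>i. i \<in> F - {j} \<Longrightarrow> {m, u, w, M} \<inter> {4 * i + 1, 4 * i + 3} = {} \<and>
      (m < 4 * i + 2 \<and> 4 * i + 2 < u \<or> w < 4 * i + 2 \<and> 4 * i + 2 < M)"
    using framed unfolding framed_def by blast+
  have "finite Z" using finite_X C_subset_X j finite_subset by meson
  moreover have ord: "strict_axis_order (p m) (p u) Z" "strict_axis_order (p m) (p w) Z"
    using strict_axis_order_cluster[OF j(1)] strict_axis_order_subset[OF _ j(2)] pos by auto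
  ultimately consider
      (agree) W where "W \<subseteq> Z" "card W = s" "axes_agree (p m) (p u) (p m) (p w) W"
    | (flip) W where "W \<subseteq> Z" "card W = s" "axes_agree (p u) (p m) (p m) (p w) W"
    using axes_agree_or_flipped_agree[OF _ j(3) ord] by blast
  then show ?thesis
  proof cases
    case agree
    have "exposed X W (\<Union>i\<in>F - {j}. C i)"
    proof (rule exposed_if_axes_agree[OF j(1) _ pos(1-3) _ agree(3)])
      fix i assume i: "i \<in> F - {j}"
      show "i < K \<and> i \<noteq> j \<and> {m, u, w} \<inter> {4 * i + 1, 4 * i + 3} = {} \<and> in_wedge m (4 * j + 2) u w (4 * i + 2)"
        using F i other[OF i] in_wedge_from_left[OF pos(5-7), of "4 * i + 2"] by blast
    qed (use j(2) agree(1) pos in auto)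
    then show ?thesis using agree(1,2) by blast
  next
    case flip
    have "axes_agree (p u) (p m) (p u) (p M) W"
      using axes_agree_trans[OF flip(3) axes_agree_sym] axes_agree_subset[OF agree flip(1)] by blast
    then have "exposed X W (\<Union>i\<in>F - {j}. C i)"
    proof (rule exposed_if_axes_agree[OF j(1) _ pos(2,1,4), rotated 2])
      fix i assume i: "i \<in> F - {j}"
      have "m < 4 * i + 2 \<and> 4 * i + 2 < u \<or> 4 * j + 2 < 4 * i + 2 \<and> 4 * i + 2 < M"
        using other[OF i] pos(7) by linarith
      then have "in_wedge u (4 * j + 2) m M (4 * i + 2)"
        using pos(5-8) by (intro in_wedge_from_right) auto
      then show "i < K \<and> i \<noteq> j \<and> {u, m, M} \<inter> {4 * i + 1, 4 * i + 3} = {} \<and> in_wedge u (4 * j + 2) m M (4 * i + 2)"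
        using F i other[OF i] by blast
    qed (use j(2) flip(1) pos in auto)
    then show ?thesis using flip(1,2) by blast
  qed
qed

definition framed_family :: "nat \<Rightarrow> nat set \<Rightarrow> bool" where
  "framed_family s F \<longleftrightarrow> F \<subseteq> {..<K} \<and> (\<forall>j\<in>F. \<exists>Z\<subseteq>C j. s * s \<le> card Z \<and>
     (\<exists>m u w M. framed F j m u w M \<and> axes_agree (p u) (p M) (p m) (p w) Z))"

lemma cut_off_points_of_framed_family:
  assumes F: "framed_family s F" "n \<le> card F * l" and s: "chain_threshold n l < s"
  shows "cut_off_points X n"
proof -
  have FK: "F \<subseteq> {..<K}" using F(1) by (simp add: framed_family_def)
  have "\<exists>W\<subseteq>C j. card W = s \<and> exposed X W (\<Union>i\<in>F - {j}. C i)" if j: "j \<in> F" for j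
  proof -
    obtain Z m u w M where Z: "Z \<subseteq> C j" "s * s \<le> card Z" "framed F j m u w M"
      "axes_agree (p u) (p M) (p m) (p w) Z"
      using F(1) j unfolding framed_family_def by blast
    have "j < K" using FK j by auto
    from exposed_subcluster[OF this Z(1,2) FK Z(3,4)] show ?thesis using Z(1) by blast
  qed
  then obtain W where W: "\<And>j. j \<in> F \<Longrightarrow> W j \<subseteq> C j \<and> card (W j) = s \<and> exposed X (W j) (\<Union>i\<in>F - {j}. C i)"
    by metis
  show ?thesis
  proof (rule cut_off_points_of_exposed_family[OF _ F(2) uniform_X])
    show "finite F" using FK finite_subset by blast
    fix j assume j: "j \<in> F"
    have "W j \<subseteq> X" using W[OF j] C_subset_X FK j by blast
    moreover have "exposed X (W j) (\<Union>i\<in>F - {j}. W i)"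
      using W by (intro exposed_mono[OF conjunct2[OF conjunct2[OF W[OF j]]]]) blast
    ultimately show "finite (W j) \<and> W j \<subseteq> X \<and> chain_threshold n l < card (W j) \<and>
        exposed X (W j) (\<Union>i\<in>F - {j}. W i)"
      using W[OF j] s finite_subset[OF _ finite_X] by auto
  qed
qed

definition small_answer :: "nat \<Rightarrow> nat \<Rightarrow> nat \<Rightarrow> 'p set \<Rightarrow> bool" where
  "small_answer j a b W \<longleftrightarrow> axes_agree (p (4 * j + 1)) (p (4 * K)) (p (4 * a)) (p (4 * b)) W"

definition large_answer :: "nat \<Rightarrow> nat \<Rightarrow> nat \<Rightarrow> 'p set \<Rightarrow> bool" where
  "large_answer j a b W \<longleftrightarrow> axes_agree (p (4 * a)) (p (4 * b)) (p 0) (p (4 * Suc j)) W"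

lemma single_boundary: "t \<le> K \<Longrightarrow> single (4 * t)"
  by (simp add: single_def)

lemma single_left_neighbour: "j < K \<Longrightarrow> single (4 * j + 1)"
  by (simp add: single_def)

lemma framed_family_if_answers_small:
  assumes F: "answers_small small_answer A N (s * s) F" "F \<subseteq> {..<N}" "N \<le> K"
    and A: "\<And>j. j \<in> F \<Longrightarrow> A j \<subseteq> C j"
  shows "framed_family s F"
  unfolding framed_family_def
proof (intro conjI ballI)
  show "F \<subseteq> {..<K}" using F(2,3) by auto
  fix j assume j: "j \<in> F"
  from bspec[OF F(1)[unfolded answers_small_def] this]
  obtain W a b where W: "W \<subseteq> A j" "card W = s * s" "small_answer j a b W"
    and ab: "\<forall>i\<in>F. a \<le> i" "j < b" "b \<le> N" "\<forall>i\<in>F. j < i \<longrightarrow> b \<le> i"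
    by blast
  have other: "{4 * a, 4 * j + 1, 4 * b, 4 * K} \<inter> {4 * i + 1, 4 * i + 3} = {} \<and>
      (4 * a < 4 * i + 2 \<and> 4 * i + 2 < 4 * j + 1 \<or> 4 * b < 4 * i + 2 \<and> 4 * i + 2 < 4 * K)" if "i \<in> F - {j}" for i
  proof -
    have "a \<le> i" "i < j \<or> b \<le> i" "i \<noteq> j" "i < K" using ab(1,4) that F(2,3) by force+
    then show ?thesis by auto presburger+
  qed
  have "a \<le> j" using ab(1) j by blast
  then have "framed F j (4 * a) (4 * j + 1) (4 * b) (4 * K)"
    using ab(2,3) F(3) other single_boundary[of a] single_left_neighbour[of j] single_boundary[of b]
      single_boundary[of K] unfolding framed_def by simp
  moreover have "W \<subseteq> C j" "s * s \<le> card W" using W(1,2) A[OF j] by auto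
  ultimately show "\<exists>Z\<subseteq>C j. s * s \<le> card Z \<and> (\<exists>m u w M. framed F j m u w M \<and> axes_agree (p u) (p M) (p m) (p w) Z)"
    using W(3) unfolding small_answer_def by blast
qed

lemma framed_family_if_answers_large:
  assumes F: "answers_large large_answer A N (s * s) \<alpha> F" "F \<subseteq> {..<N}" "N \<le> K"
    and A: "\<And>j. j \<in> F \<Longrightarrow> A j \<subseteq> C j"
  shows "framed_family s F"
  unfolding framed_family_def
proof (intro conjI ballI)
  show "F \<subseteq> {..<K}" using F(2,3) by auto
  fix j assume j: "j \<in> F"
  from bspec[OF F(1)[unfolded answers_large_def] this]
  obtain W a b where W: "W \<subseteq> A j" "s * s \<le> card W" "large_answer j a b W"
    and ab: "\<alpha> < a" "a \<le> j" "\<forall>i\<in>F. i < j \<longrightarrow> i < a" "\<forall>i\<in>F. i < b" "b \<le> N"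
    by blast
  have other: "{0, 4 * a, 4 * Suc j, 4 * b} \<inter> {4 * i + 1, 4 * i + 3} = {} \<and>
      (0 < 4 * i + 2 \<and> 4 * i + 2 < 4 * a \<or> 4 * Suc j < 4 * i + 2 \<and> 4 * i + 2 < 4 * b)" if "i \<in> F - {j}" for i
  proof -
    have "i < a \<or> j < i" "i < b" using ab(3,4) that by force+
    then show ?thesis by auto presburger+
  qed
  have "j < b" using ab(4) j by blast
  then have "framed F j 0 (4 * a) (4 * Suc j) (4 * b)"
    using ab(1,2,5) F(3) other single_boundary[of 0] single_boundary[of a] single_boundary[of "Suc j"]
      single_boundary[of b] unfolding framed_def by simp
  moreover have "W \<subseteq> C j" using W(1) A[OF j] by blast
  ultimately show "\<exists>Z\<subseteq>C j. s * s \<le> card Z \<and> (\<exists>m u w M. framed F j m u w M \<and> axes_agree (p u) (p M) (p m) (p w) Z)"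
    using W(2,3) unfolding large_answer_def by blast
qed

lemma finite_cluster: "j < K \<Longrightarrow> finite (C j)"
  using C_subset_X finite_X finite_subset by blast

definition opposed :: "nat \<Rightarrow> 'p set \<Rightarrow> bool" where
  "opposed j W \<longleftrightarrow> axes_agree (p (4 * K)) (p (4 * j + 1)) (p 0) (p (4 * Suc j)) W"

lemma small_answer_or_opposed:
  assumes j: "j < K" and size: "s * t \<le> card (C j)"
  shows "(\<exists>W\<subseteq>C j. card W = s \<and> small_answer j 0 (Suc j) W) \<or> (\<exists>W\<subseteq>C j. card W = t \<and> opposed j W)"
proof -
  have "strict_axis_order (p (4 * j + 1)) (p (4 * K)) (C j)" "strict_axis_order (p (4 * 0)) (p (4 * Suc j)) (C j)"
    using strict_axis_order_cluster[OF j] single_left_neighbour[OF j] single_boundary[of 0]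
      single_boundary[of K] single_boundary[of "Suc j"] j by auto
  from axes_agree_or_flipped_agree[OF finite_cluster[OF j] size this] show ?thesis
    unfolding small_answer_def opposed_def mult_0_right .
qed

text \<open>On an opposed set, an axis opposite to the one in \<open>small_answer\<close> agrees with the one in
  \<open>large_answer\<close>.\<close>
lemma small_or_large_answer:
  assumes j: "a \<le> j" "j < b" "b \<le> K" and Z: "Z \<subseteq> C j" "opposed j Z" "s * t \<le> card Z"
  shows "(\<exists>W\<subseteq>Z. card W = s \<and> small_answer j a b W) \<or> (\<exists>W\<subseteq>Z. card W = t \<and> large_answer j a b W)"
proof -
  have jK: "j < K" using j by simp
  have "strict_axis_order (p (4 * j + 1)) (p (4 * K)) (C j)" "strict_axis_order (p (4 * a)) (p (4 * b)) (C j)"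
    using strict_axis_order_cluster[OF jK] single_left_neighbour[OF jK] single_boundary[of K]
      single_boundary[of a] single_boundary[of b] j by auto
  then have ord: "strict_axis_order (p (4 * j + 1)) (p (4 * K)) Z" "strict_axis_order (p (4 * a)) (p (4 * b)) Z"
    using strict_axis_order_subset Z(1) by blast+
  have "finite Z" using Z(1) finite_cluster[OF jK] finite_subset by blast
  then consider (small) W where "W \<subseteq> Z" "card W = s" "small_answer j a b W"
    | (flip) W where "W \<subseteq> Z" "card W = t" "axes_agree (p (4 * K)) (p (4 * j + 1)) (p (4 * a)) (p (4 * b)) W"
    using axes_agree_or_flipped_agree[OF _ Z(3) ord] unfolding small_answer_def by blast
  then show ?thesis
  proof cases
    case flip
    have "opposed j W" using Z(2) flip(1) unfolding opposed_def by (rule axes_agree_subset)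
    then have "large_answer j a b W"
      using axes_agree_trans[OF axes_agree_sym[OF flip(3)]] unfolding opposed_def large_answer_def by blast
    then show ?thesis using flip(1,2) by blast
  qed blast
qed

lemma framed_family_in_opposed_block:
  assumes block: "\<beta> + stage_size k R \<le> K" and "s > 0"
    and A: "\<And>j. \<lbrakk>\<beta> \<le> j; j < \<beta> + stage_size k R\<rbrakk> \<Longrightarrow>
      \<exists>W\<subseteq>C j. card W = (s * s) ^ R * (s' * s') \<and> opposed j W"
  shows "\<exists>F. card F = k \<and> framed_family s F \<or> card F = R \<and> framed_family s' F"
proof -
  let ?N = "\<beta> + stage_size k R"
  obtain A where A: "\<And>j. \<lbrakk>\<beta> \<le> j; j < ?N\<rbrakk> \<Longrightarrow> A j \<subseteq> C j \<and> card (A j) = (s * s) ^ R * (s' * s') \<and> opposed j (A j)"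
    using assms(3) by metis
  have "\<exists>F\<subseteq>{\<beta>..<?N}. card F = k \<and> answers_small small_answer A ?N (s * s) F \<or>
      card F = R \<and> answers_large large_answer A ?N (s' * s') \<beta> F"
  proof (rule query_game[where L = \<beta> and Z = A])
    fix j a b W t assume ab: "\<beta> \<le> a" "a \<le> j" "j < b" "b \<le> ?N" and W: "W \<subseteq> A j" "s * s * t \<le> card W"
    have "A j \<subseteq> C j" "opposed j (A j)" using A[of j] ab by auto
    then have "W \<subseteq> C j" "opposed j W" using W(1) axes_agree_subset unfolding opposed_def by blast+
    then show "(\<exists>W'\<subseteq>W. card W' = s * s \<and> small_answer j a b W') \<or> (\<exists>W'\<subseteq>W. card W' = t \<and> large_answer j a b W')"
      using small_or_large_answer[of a j b W "s * s" t] ab W(2) block by simp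
  qed (use \<open>s > 0\<close> A in auto)
  then obtain F where F: "F \<subseteq> {\<beta>..<?N}" and answers: "card F = k \<and> answers_small small_answer A ?N (s * s) F \<or>
      card F = R \<and> answers_large large_answer A ?N (s' * s') \<beta> F"
    by blast
  have "F \<subseteq> {..<?N}" using F by auto
  moreover have AC: "A j \<subseteq> C j" if "j \<in> F" for j using A[of j] subsetD[OF F that] by simp
  ultimately show ?thesis
    using answers framed_family_if_answers_small[OF _ _ block AC]
      framed_family_if_answers_large[OF _ _ block AC] by auto
qed

text \<open>Either enough clusters can be framed by the whole range, or all clusters of a whole block are
  opposed, and the queries are played within this block.\<close>
theorem cut_off_points_of_clusters:
  assumes K: "K = k * stage_size k R"
    and size: "\<And>j. j < K \<Longrightarrow> (s * s) * ((s * s) ^ R * (s' * s')) \<le> card (C j)"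
    and s: "chain_threshold n l < s" "n \<le> k * l"
    and s': "chain_threshold n l' < s'" "n \<le> R * l'"
  shows "cut_off_points X n"
proof -
  let ?\<kappa> = "stage_size k R"
  define agrees where "agrees j \<longleftrightarrow> (\<exists>W\<subseteq>C j. card W = s * s \<and> small_answer j 0 (Suc j) W)" for j
  consider (transversal) F where "F \<subseteq> {..<K}" "card F = k" "\<forall>j\<in>F. agrees j"
    | (block) \<beta> where "\<beta> + ?\<kappa> \<le> K" "\<forall>j\<in>{\<beta>..<\<beta> + ?\<kappa>}. \<not> agrees j"
    using block_transversal[of 0 k ?\<kappa> "\<lambda>j b. agrees j"] K
    by (auto simp: atLeast0LessThan separated_by_def)
  then have "\<exists>F. card F = k \<and> framed_family s F \<or> card F = R \<and> framed_family s' F"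
  proof cases
    case transversal
    have "answers_small small_answer C K (s * s) F"
      unfolding answers_small_def
    proof
      fix j assume "j \<in> F"
      then have "j < K" "agrees j" using transversal by auto
      then show "\<exists>W\<subseteq>C j. card W = s * s \<and> (\<exists>a b. (\<forall>i\<in>F. a \<le> i) \<and> j < b \<and> b \<le> K \<and>
          (\<forall>i\<in>F. j < i \<longrightarrow> b \<le> i) \<and> small_answer j a b W)"
        unfolding agrees_def by (metis Suc_leI le0 lessI)
    qed
    then show ?thesis using framed_family_if_answers_small[of C K s F] transversal(1,2) by auto
  next
    case block
    have "\<exists>W\<subseteq>C j. card W = (s * s) ^ R * (s' * s') \<and> opposed j W" if "\<beta> \<le> j" "j < \<beta> + ?\<kappa>" for j
    proof -
      have "j < K" "\<not> agrees j" using that block by auto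
      then show ?thesis using small_answer_or_opposed[OF _ size] unfolding agrees_def by blast
    qed
    then show ?thesis using framed_family_in_opposed_block[OF block(1)] s(1) by simp
  qed
  then show ?thesis
    using cut_off_points_of_framed_family s s' by blast
qed

end

section \<open>Existence of clusters\<close>

lemma two_pow_ceiling_bounds:
  fixes x :: real
  assumes "0 \<le> x"
  shows "2 powr (x * real i) \<le> real ((2 ^ nat \<lceil>x\<rceil>) ^ i)"
    and "real ((2 ^ nat \<lceil>x\<rceil>) ^ i) \<le> 2 ^ i * 2 powr (x * real i)"
proof -
  have pow: "real ((2 ^ nat \<lceil>x\<rceil>) ^ i) = 2 powr (real (nat \<lceil>x\<rceil>) * real i)"
    by (simp add: powr_realpow flip: power_mult of_nat_mult)
  have "x * real i \<le> real (nat \<lceil>x\<rceil>) * real i" by (intro mult_right_mono real_nat_ceiling_ge) simp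
  then show "2 powr (x * real i) \<le> real ((2 ^ nat \<lceil>x\<rceil>) ^ i)" unfolding pow by simp
  have "real (nat \<lceil>x\<rceil>) * real i \<le> (x + 1) * real i" using assms by (intro mult_right_mono) simp_all
  then have "real ((2 ^ nat \<lceil>x\<rceil>) ^ i) \<le> 2 powr (real i + x * real i)"
    unfolding pow by (simp add: distrib_right add.commute)
  then show "real ((2 ^ nat \<lceil>x\<rceil>) ^ i) \<le> 2 ^ i * 2 powr (x * real i)"
    by (simp add: powr_add powr_realpow)
qed

lemma scale_with_power_bounds:
  fixes \<delta> :: real
  assumes "\<delta> > 0" "R > 0"
  shows "\<exists>\<gamma>>0. \<forall>n. \<exists>s::nat. 2 powr (\<gamma> * real n) \<le> real s \<and> 2 powr (\<delta> / 12 * real n) \<le> real (s ^ R) \<and>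
    real (s ^ (4 * R + 2)) \<le> 2 ^ (4 * R + 2) * 2 powr (\<delta> / 2 * real n)"
proof -
  define L where "L = 4 * R + 2"
  define \<gamma> where "\<gamma> = \<delta> / (2 * real L)"
  have \<gamma>: "\<gamma> > 0" "\<gamma> * real L = \<delta> / 2" "\<delta> / 12 \<le> \<gamma> * real R"
    using assms by (simp_all add: \<gamma>_def L_def field_simps)
  have "2 powr (\<gamma> * real n) \<le> real s \<and> 2 powr (\<delta> / 12 * real n) \<le> real (s ^ R) \<and>
      real (s ^ L) \<le> 2 ^ L * 2 powr (\<delta> / 2 * real n)" if s: "s = 2 ^ nat \<lceil>\<gamma> * real n\<rceil>" for n s :: nat
  proof (intro conjI)
    have "0 \<le> \<gamma> * real n" using \<gamma>(1) by simp
    note bounds = two_pow_ceiling_bounds[OF this, folded s]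
    show "2 powr (\<gamma> * real n) \<le> real s" using bounds(1)[of 1] by simp
    have "2 powr (\<delta> / 12 * real n) \<le> 2 powr (\<gamma> * real n * real R)"
      using mult_right_mono[OF \<gamma>(3), of "real n"] by (simp add: mult_ac)
    then show "2 powr (\<delta> / 12 * real n) \<le> real (s ^ R)" using bounds(1)[of R] by linarith
    have exponent: "\<gamma> * real n * real L = \<delta> / 2 * real n" using \<gamma>(2) by (simp add: mult_ac)
    show "real (s ^ L) \<le> 2 ^ L * 2 powr (\<delta> / 2 * real n)" using bounds(2)[of L] unfolding exponent .
  qed
  then show ?thesis using \<gamma>(1) unfolding L_def by blast
qed

context chirotope
begin

lemma ramsey_homogeneous:
  fixes n :: nat
  shows "\<exists>R::nat. \<forall>f. inj_on f {..<R} \<longrightarrow> uniform_on (f ` {..<R}) \<longrightarrow>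
    (\<exists>e \<in> {..n} \<rightarrow>\<^sub>E {..<R}. strict_mono_on {..n} e \<and> (\<exists>\<epsilon>\<in>{1, -1}. homogeneous \<epsilon> (f \<circ> e) n))"
proof -
  obtain R :: nat where R: "\<And>P. \<exists>e \<in> {..n} \<rightarrow>\<^sub>E {..<R}. strict_mono_on {..n} e \<and>
      (\<exists>b. \<forall>i j k l. i < j \<longrightarrow> j < k \<longrightarrow> k < l \<longrightarrow> l \<le> n \<longrightarrow> (P (e i) (e j) (e k) (e l) \<longleftrightarrow> b))"
    using ramsey_increasing_quadruples[of n] by blast
  have "\<exists>e \<in> {..n} \<rightarrow>\<^sub>E {..<R}. strict_mono_on {..n} e \<and> (\<exists>\<epsilon>\<in>{1, -1}. homogeneous \<epsilon> (f \<circ> e) n)"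
    if f: "inj_on f {..<R}" "uniform_on (f ` {..<R})" for f
  proof -
    obtain e b where e: "e \<in> {..n} \<rightarrow>\<^sub>E {..<R}" "strict_mono_on {..n} e"
      and b: "\<forall>i j k l. i < j \<longrightarrow> j < k \<longrightarrow> k < l \<longrightarrow> l \<le> n \<longrightarrow>
        (0 < ori (f (e i)) (f (e j)) (f (e k)) (f (e l)) \<longleftrightarrow> b)"
      using R[of "\<lambda>i j k l. 0 < ori (f i) (f j) (f k) (f l)"] by blast
    have inj: "inj_on (f \<circ> e) {..n}"
    proof (rule comp_inj_on)
      show "inj_on e {..n}" using e(2) by (rule strict_mono_on_imp_inj_on)
      show "inj_on f (e ` {..n})" using f(1) by (rule inj_on_subset) (use e(1) in auto)
    qed
    have "homogeneous (if b then 1 else -1) (f \<circ> e) n"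
      unfolding homogeneous_def
    proof (intro allI impI)
      fix i j k l assume less: "i < j" "j < k" "k < l" "l \<le> n"
      let ?x = "f \<circ> e"
      have "?x u \<noteq> ?x v" if "u < v" "v \<le> n" for u v using inj_onD[OF inj, of u v] that by auto
      then have "distinct [?x i, ?x j, ?x k, ?x l]" using less by simp
      moreover have "{?x i, ?x j, ?x k, ?x l} \<subseteq> f ` {..<R}" using e(1) less by auto
      ultimately have "ori (?x i) (?x j) (?x k) (?x l) \<noteq> 0" by (intro uniform_onD[OF f(2)])
      moreover have "0 < ori (?x i) (?x j) (?x k) (?x l) \<longleftrightarrow> b" using b less by simp
      ultimately show "sgn (ori (?x i) (?x j) (?x k) (?x l)) = (if b then 1 else -1)"
        by (auto simp: sgn_if)
    qed
    then have "\<exists>\<epsilon>\<in>{1, -1}. homogeneous \<epsilon> (f \<circ> e) n" by (intro bexI[of _ "if b then 1 else -1"]) auto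
    then show ?thesis using e by blast
  qed
  then show ?thesis by blast
qed

lemma moment_clusters_of_slice:
  fixes A :: "nat \<Rightarrow> 'p set" and I :: "nat set" and g :: "nat \<Rightarrow> 'p" and e :: "nat \<Rightarrow> nat"
    and K :: nat and \<epsilon> :: real
  defines "V \<equiv> (\<lambda>j. e (4 * j + 2)) ` {..<K}"
  defines "C \<equiv> \<lambda>j. (\<lambda>f. f (e (4 * j + 2))) ` slice I A V g (\<lambda>f. homogeneous \<epsilon> (f \<circ> e) (4 * K))"
  assumes X: "finite X" "uniform_on X" "\<And>i. i \<in> I \<Longrightarrow> A i \<subseteq> X"
    and e: "inj_on e {..4 * K}" "e ` {..4 * K} \<subseteq> I" and g: "g \<in> PiE (I - V) A"
    and "0 < K" "\<epsilon> \<noteq> 0" "\<And>j. j < K \<Longrightarrow> C j \<noteq> {}"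
  shows "moment_clusters ori \<epsilon> X K (g \<circ> e) C"
proof -
  have single: "e t \<in> I - V" if "t \<le> 4 * K" "t mod 4 \<noteq> 2" for t
  proof -
    have "t \<noteq> 4 * j + 2" for j using that(2) by presburger
    then have "e t \<noteq> e (4 * j + 2)" if "j < K" for j
      using inj_onD[OF e(1), of t "4 * j + 2"] \<open>t \<le> 4 * K\<close> that by auto
    then show ?thesis using e(2) that(1) by (auto simp: V_def)
  qed
  show ?thesis
  proof (unfold_locales)
    show "(g \<circ> e) t \<in> X" if "t \<le> 4 * K" "t mod 4 \<noteq> 2" for t
      using PiE_mem[OF g single[OF that]] X(3) single[OF that] by auto
    show "C j \<subseteq> X" if "j < K" for j
    proof -
      have "V \<subseteq> I" "e (4 * j + 2) \<in> V" using e(2) that by (auto simp: V_def)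
      then have "C j \<subseteq> A (e (4 * j + 2))" "e (4 * j + 2) \<in> I"
        using coordinate_slice_subset unfolding C_def by (metis, blast)
      then show ?thesis using X(3) by blast
    qed
    fix j y assume "j < K" "y \<in> C j"
    then obtain f where f: "f \<in> slice I A V g (\<lambda>f. homogeneous \<epsilon> (f \<circ> e) (4 * K))" "y = f (e (4 * j + 2))"
      by (auto simp: C_def)
    then have "\<forall>t\<le>4 * K. t mod 4 \<noteq> 2 \<longrightarrow> (f \<circ> e) t = (g \<circ> e) t" using single by (auto simp: slice_def)
    then show "\<exists>x. homogeneous \<epsilon> x (4 * K) \<and> x (4 * j + 2) = y \<and> (\<forall>t\<le>4 * K. t mod 4 \<noteq> 2 \<longrightarrow> x t = (g \<circ> e) t)"
      using f by (intro exI[of _ "f \<circ> e"]) (auto simp: slice_def)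
  qed (use assms in blast)+
qed

lemma moment_clusters_in_parts:
  fixes T :: "((nat \<Rightarrow> nat) \<times> real) set"
  assumes X: "finite X" "uniform_on X" and pos: "0 < K" "0 < s"
    and A: "finite I" "\<And>i. i \<in> I \<Longrightarrow> A i \<subseteq> X \<and> card (A i) = Suc (card T) * s"
    and T: "finite T" "\<And>t. t \<in> T \<Longrightarrow> inj_on (fst t) {..4 * K} \<and> fst t ` {..4 * K} \<subseteq> I \<and> snd t \<noteq> 0"
    and cover: "\<And>f. f \<in> PiE I A \<Longrightarrow> \<exists>t\<in>T. homogeneous (snd t) (f \<circ> fst t) (4 * K)"
  shows "\<exists>\<epsilon> p C. moment_clusters ori \<epsilon> X K p C \<and> (\<forall>j<K. s \<le> card (C j))"
proof -
  define V where "V t = (\<lambda>j. fst t (4 * j + 2)) ` {..<K}" for t :: "(nat \<Rightarrow> nat) \<times> real"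
  define P where "P t f \<longleftrightarrow> homogeneous (snd t) (f \<circ> fst t) (4 * K)" for t :: "(nat \<Rightarrow> nat) \<times> real" and f
  have finA: "finite (A i) \<and> card (A i) = Suc (card T) * s" if "i \<in> I" for i
    using A(2)[OF that] X(1) finite_subset by blast
  have V: "V t \<subseteq> I" if "t \<in> T" for t
  proof -
    have "V t \<subseteq> fst t ` {..4 * K}" unfolding V_def by (auto intro!: imageI)
    then show ?thesis using T(2)[OF that] by blast
  qed
  obtain t g where t: "t \<in> T" "g \<in> PiE (I - V t) A"
    and large: "\<And>v. v \<in> V t \<Longrightarrow> s \<le> card ((\<lambda>f. f v) ` slice I A (V t) g (P t))"
    using product_pigeonhole_coordinates[of I A T s P V, OF A(1) finA pos(2) T(1) cover[folded P_def] V] by blast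
  define C where "C j = (\<lambda>f. f (fst t (4 * j + 2))) ` slice I A (V t) g (P t)" for j
  have size: "s \<le> card (C j)" if "j < K" for j
    unfolding C_def using that by (intro large) (simp add: V_def)
  then have nonempty: "C j \<noteq> {}" if "j < K" for j using that pos(2) by fastforce
  have "moment_clusters ori (snd t) X K (g \<circ> fst t) C"
    using moment_clusters_of_slice[OF X, of I A "fst t" K g "snd t"] A(2) T(2)[OF t(1)] t(2) pos(1) nonempty
    unfolding C_def P_def V_def by blast
  then show ?thesis using size by blast
qed

lemma moment_clusters_exist:
  assumes K: "0 < K"
  shows "\<exists>M. \<forall>X s. finite X \<longrightarrow> uniform_on X \<longrightarrow> 0 < s \<longrightarrow> M * s \<le> card X \<longrightarrow>
    (\<exists>\<epsilon> p C. moment_clusters ori \<epsilon> X K p C \<and> (\<forall>j<K. s \<le> card (C j)))"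
proof -
  define n where "n = 4 * K"
  obtain R :: nat where R: "\<And>f. \<lbrakk>inj_on f {..<R}; uniform_on (f ` {..<R})\<rbrakk> \<Longrightarrow>
      \<exists>e \<in> {..n} \<rightarrow>\<^sub>E {..<R}. strict_mono_on {..n} e \<and> (\<exists>\<epsilon>\<in>{1, -1}. homogeneous \<epsilon> (f \<circ> e) n)"
    using ramsey_homogeneous[of n] by blast
  define T where "T = {e \<in> {..n} \<rightarrow>\<^sub>E {..<R}. strict_mono_on {..n} e} \<times> {1, -1::real}"
  have finT: "finite T"
    unfolding T_def by (intro finite_cartesian_product finite_Collect_conjI disjI1) (simp_all add: finite_PiE)
  have T: "inj_on (fst t) {..4 * K} \<and> fst t ` {..4 * K} \<subseteq> {..<R} \<and> snd t \<noteq> 0" if "t \<in> T" for t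
    using that unfolding T_def n_def by (auto intro: strict_mono_on_imp_inj_on)
  have "\<exists>\<epsilon> p C. moment_clusters ori \<epsilon> X K p C \<and> (\<forall>j<K. s \<le> card (C j))"
    if X: "finite X" "uniform_on X" and s: "0 < s" "(R * Suc (card T)) * s \<le> card X" for X s
  proof -
    obtain A where A: "\<And>i. i < R \<Longrightarrow> A i \<subseteq> X \<and> card (A i) = Suc (card T) * s" "disjoint_family_on A {..<R}"
      using disjoint_parts_exist[OF X(1) s(2)[unfolded mult.assoc]] by blast
    show ?thesis
    proof (rule moment_clusters_in_parts[OF X K s(1) finite_lessThan _ finT T])
      fix f assume f: "f \<in> PiE {..<R} A"
      then have "f ` {..<R} \<subseteq> X" using PiE_mem[OF f] A(1) by fastforce
      then obtain e \<epsilon> where "e \<in> {..n} \<rightarrow>\<^sub>E {..<R}" "strict_mono_on {..n} e" "\<epsilon> \<in> {1, -1}"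
        "homogeneous \<epsilon> (f \<circ> e) n"
        using R[OF PiE_disjoint_inj_on[OF f A(2)]] uniform_on_subset[OF X(2)] by blast
      then show "\<exists>t\<in>T. homogeneous (snd t) (f \<circ> fst t) (4 * K)"
        by (intro bexI[of _ "(e, \<epsilon>)"]) (auto simp: T_def n_def)
    qed (use A(1) in auto)
  qed
  then show ?thesis by blast
qed

lemma cut_off_points_if_thresholds:
  assumes "0 < k" "0 < R"
  shows "\<exists>M. \<forall>X n s. finite X \<longrightarrow> uniform_on X \<longrightarrow> M * s ^ (4 * R + 2) \<le> card X \<longrightarrow>
    chain_threshold n (n div k + 1) < s \<longrightarrow> chain_threshold n (n div R + 1) < s ^ R \<longrightarrow> cut_off_points X n"
proof -
  define K where "K = k * stage_size k R"
  have "K > 0" using assms(1) stage_size_pos by (simp add: K_def)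
  then obtain M where M: "\<And>X s. \<lbrakk>finite X; uniform_on X; 0 < s; M * s \<le> card X\<rbrakk> \<Longrightarrow>
      \<exists>\<epsilon> p C. moment_clusters ori \<epsilon> X K p C \<and> (\<forall>j<K. s \<le> card (C j))"
    using moment_clusters_exist by blast
  have "cut_off_points X n"
    if X: "finite X" "uniform_on X" "M * s ^ (4 * R + 2) \<le> card X"
      and s: "chain_threshold n (n div k + 1) < s" "chain_threshold n (n div R + 1) < s ^ R" for X n s
  proof -
    have "0 < s ^ (4 * R + 2)" using s(1) by simp
    then obtain \<epsilon> p C where C: "moment_clusters ori \<epsilon> X K p C" "\<And>j. j < K \<Longrightarrow> s ^ (4 * R + 2) \<le> card (C j)"
      using M[OF X(1,2) _ X(3)] by blast
    interpret moment_clusters ori \<epsilon> X K p C by (rule C(1))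
    show ?thesis
    proof (rule cut_off_points_of_clusters[OF K_def _ s(1) _ s(2)])
      have "4 * R + 2 = 1 + 1 + (R + R + (R + R))" by simp
      then have pow: "s ^ (4 * R + 2) = (s * s) * ((s * s) ^ R * (s ^ R * s ^ R))"
        by (simp only: power_add power_one_right power_mult_distrib mult.assoc)
      show "(s * s) * ((s * s) ^ R * (s ^ R * s ^ R)) \<le> card (C j)" if "j < K" for j
        using C(2)[OF that] unfolding pow .
      show "n \<le> k * (n div k + 1)" "n \<le> R * (n div R + 1)"
        using assms dividend_less_times_div[of k n] dividend_less_times_div[of R n] by auto
    qed
  qed
  then show ?thesis by blast
qed

theorem cut_off_points_subexponential:
  fixes \<delta> :: real
  assumes "\<delta> > 0"
  shows "\<forall>\<^sub>F n in sequentially. \<forall>X. finite X \<longrightarrow> uniform_on X \<longrightarrow> 2 powr (\<delta> * real n) \<le> real (card X) \<longrightarrow>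
    cut_off_points X n"
proof -
  obtain R where R: "R > 0"
    "\<forall>\<^sub>F n in sequentially. real (chain_threshold n (n div R + 1)) < 2 powr (\<delta> / 12 * real n)"
    using chain_threshold_subexponential[of "\<delta> / 12"] assms by auto
  define L where "L = 4 * R + 2"
  obtain \<gamma> :: real where \<gamma>: "\<gamma> > 0" "\<And>n. \<exists>s::nat. 2 powr (\<gamma> * real n) \<le> real s \<and>
      2 powr (\<delta> / 12 * real n) \<le> real (s ^ R) \<and> real (s ^ L) \<le> 2 ^ L * 2 powr (\<delta> / 2 * real n)"
    using scale_with_power_bounds[OF assms R(1)] unfolding L_def by blast
  obtain k where k: "k > 0"
    "\<forall>\<^sub>F n in sequentially. real (chain_threshold n (n div k + 1)) < 2 powr (\<gamma> * real n)"
    using chain_threshold_subexponential[OF \<gamma>(1)] by blast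
  obtain M where M: "\<And>X n s. \<lbrakk>finite X; uniform_on X; M * s ^ L \<le> card X;
      chain_threshold n (n div k + 1) < s; chain_threshold n (n div R + 1) < s ^ R\<rbrakk> \<Longrightarrow> cut_off_points X n"
    using cut_off_points_if_thresholds[OF k(1) R(1)] unfolding L_def by blast
  have "\<forall>\<^sub>F n in sequentially. real (M * 2 ^ L) \<le> 2 powr (\<delta> / 2 * real n)"
    using assms by real_asymp
  with R(2) k(2) show ?thesis
  proof eventually_elim
    case (elim n)
    obtain s :: nat where s: "2 powr (\<gamma> * real n) \<le> real s" "2 powr (\<delta> / 12 * real n) \<le> real (s ^ R)"
      "real (s ^ L) \<le> 2 ^ L * 2 powr (\<delta> / 2 * real n)"
      using \<gamma>(2) by blast
    show ?case
    proof (intro allI impI)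
      fix X assume X: "finite X" "uniform_on X" "2 powr (\<delta> * real n) \<le> real (card X)"
      have "real (M * s ^ L) \<le> real (M * 2 ^ L) * 2 powr (\<delta> / 2 * real n)"
        using mult_left_mono[OF s(3), of "real M"] by simp
      also have "\<dots> \<le> 2 powr (\<delta> / 2 * real n) * 2 powr (\<delta> / 2 * real n)"
        using elim(3) by (intro mult_right_mono) auto
      also have "\<dots> = 2 powr (\<delta> * real n)" by (simp flip: powr_add)
      finally have "M * s ^ L \<le> card X" using X(3) by linarith
      moreover have "chain_threshold n (n div k + 1) < s" using elim(2) s(1) by linarith
      moreover have "chain_threshold n (n div R + 1) < s ^ R" using elim(1) s(2) by linarith
      ultimately show "cut_off_points X n" by (rule M[OF X(1,2)])
    qed
  qed
qed

end

section \<open>Positive fractions\<close>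

context chirotope
begin

definition cut_off_family :: "'i set \<Rightarrow> ('i \<Rightarrow> 'p set) \<Rightarrow> bool" where
  "cut_off_family J B \<longleftrightarrow> (\<forall>i\<in>J. \<exists>a b c. (\<forall>x\<in>B i. 0 < ori a b c x) \<and>
     (\<forall>j\<in>J - {i}. \<forall>x\<in>B j. ori a b c x < 0))"

definition cut_off_codes :: "'i set \<Rightarrow> nat \<Rightarrow> ('i set \<times> ('i \<Rightarrow> 'i \<times> 'i \<times> 'i)) set" where
  "cut_off_codes I m = (SIGMA J:{J. J \<subseteq> I \<and> card J = m}. J \<rightarrow>\<^sub>E (I - J) \<times> (I - J) \<times> (I - J))"

definition cut_off_by :: "'i set \<times> ('i \<Rightarrow> 'i \<times> 'i \<times> 'i) \<Rightarrow> ('i \<Rightarrow> 'p) \<Rightarrow> bool" where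
  "cut_off_by t f \<longleftrightarrow> (case t of (J, w) \<Rightarrow> \<forall>i\<in>J. case w i of (a, b, c) \<Rightarrow>
     0 < ori (f a) (f b) (f c) (f i) \<and> (\<forall>j\<in>J - {i}. ori (f a) (f b) (f c) (f j) < 0))"

lemma card_cut_off_codes_le:
  assumes "finite I"
  shows "finite (cut_off_codes I m)" "card (cut_off_codes I m) \<le> card I ^ (4 * m)"
proof -
  let ?subsets = "{J. J \<subseteq> I \<and> card J = m}" and ?witnesses = "\<lambda>J. J \<rightarrow>\<^sub>E (I - J) \<times> (I - J) \<times> (I - J)"
  have finJ: "finite J" if "J \<in> ?subsets" for J using that assms finite_subset by blast
  have witnesses: "finite (?witnesses J) \<and> card (?witnesses J) \<le> card I ^ (3 * m)" if "J \<in> ?subsets" for J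
  proof -
    have "card (I - J) \<le> card I" using assms by (intro card_mono) auto
    then have "card ((I - J) \<times> (I - J) \<times> (I - J)) \<le> card I ^ 3"
      by (simp add: card_cartesian_product power3_eq_cube mult.assoc mult_le_mono)
    then have "card (?witnesses J) \<le> (card I ^ 3) ^ m"
      using finJ[OF that] that by (simp add: card_funcsetE power_mono)
    then show ?thesis using finJ[OF that] assms by (simp add: finite_PiE power_mult)
  qed
  then show "finite (cut_off_codes I m)" unfolding cut_off_codes_def using assms by (intro finite_SigmaI) auto
  have "card (cut_off_codes I m) = (\<Sum>J\<in>?subsets. card (?witnesses J))"
    unfolding cut_off_codes_def using assms witnesses by (intro card_SigmaI) auto
  also have "\<dots> \<le> card ?subsets * card I ^ (3 * m)"
    using sum_bounded_above[of ?subsets "\<lambda>J. card (?witnesses J)" "card I ^ (3 * m)"] witnesses by simp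
  also have "card ?subsets \<le> card I ^ m"
    unfolding n_subsets[OF assms] by (cases "m \<le> card I") (simp_all add: binomial_le_pow binomial_eq_0)
  finally show "card (cut_off_codes I m) \<le> card I ^ (4 * m)" by (simp flip: power_add)
qed

lemma cut_off_code_exists:
  assumes f: "inj_on f I" and cut: "cut_off_points (f ` I) m"
  shows "\<exists>t\<in>cut_off_codes I m. cut_off_by t f"
proof -
  obtain V where V: "V \<subseteq> f ` I" "card V = m"
    "\<forall>v\<in>V. \<exists>a\<in>f ` I. \<exists>b\<in>f ` I. \<exists>c\<in>f ` I. 0 < ori a b c v \<and> (\<forall>w\<in>V - {v}. ori a b c w < 0)"
    using cut unfolding cut_off_points_def by blast
  obtain J where J: "J \<subseteq> I" "V = f ` J" using V(1) by (meson subset_imageE)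
  have "\<exists>a b c. a \<in> I - J \<and> b \<in> I - J \<and> c \<in> I - J \<and>
      0 < ori (f a) (f b) (f c) (f i) \<and> (\<forall>j\<in>J - {i}. ori (f a) (f b) (f c) (f j) < 0)" if i: "i \<in> J" for i
  proof -
    obtain a b c where abc: "{a, b, c} \<subseteq> I" "0 < ori (f a) (f b) (f c) (f i)"
      and neg: "\<forall>w\<in>V - {f i}. ori (f a) (f b) (f c) w < 0"
      using V(3) i J(2) by (auto simp: bex_simps)
    have neg': "ori (f a) (f b) (f c) (f j) < 0" if "j \<in> J - {i}" for j
      using neg that i J inj_onD[OF f] by blast
    then have "ori (f a) (f b) (f c) (f j) \<noteq> 0" if "j \<in> J" for j
      using abc(2) that by (cases "j = i") (auto simp: less_imp_neq)
    then have "a \<notin> J" "b \<notin> J" "c \<notin> J" by (metis ori_same)+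
    then show ?thesis using abc neg' by blast
  qed
  then obtain a b c where abc: "\<And>i. i \<in> J \<Longrightarrow> a i \<in> I - J \<and> b i \<in> I - J \<and> c i \<in> I - J \<and>
      0 < ori (f (a i)) (f (b i)) (f (c i)) (f i) \<and> (\<forall>j\<in>J - {i}. ori (f (a i)) (f (b i)) (f (c i)) (f j) < 0)"
    by metis
  define w where "w = restrict (\<lambda>i. (a i, b i, c i)) J"
  have "card J = m" using V(2) J card_image[OF inj_on_subset[OF f J(1)]] by simp
  then have "(J, w) \<in> cut_off_codes I m" using J(1) abc by (auto simp: cut_off_codes_def w_def)
  moreover have "cut_off_by (J, w) f" using abc by (auto simp: cut_off_by_def w_def)
  ultimately show ?thesis by blast
qed

lemma cut_off_family_of_slice:
  assumes "(J, w) \<in> cut_off_codes I m"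
  shows "cut_off_family J (\<lambda>i. (\<lambda>f. f i) ` slice I A J g (cut_off_by (J, w)))"
  unfolding cut_off_family_def
proof
  fix i assume i: "i \<in> J"
  obtain a b c where w: "w i = (a, b, c)" using prod_cases3 by blast
  have "w \<in> J \<rightarrow>\<^sub>E (I - J) \<times> (I - J) \<times> (I - J)" using assms by (simp add: cut_off_codes_def)
  from PiE_mem[OF this i] have abc: "a \<in> I - J" "b \<in> I - J" "c \<in> I - J" unfolding w by simp_all
  have side: "0 < ori (g a) (g b) (g c) (f i) \<and> (\<forall>j\<in>J - {i}. ori (g a) (g b) (g c) (f j) < 0)"
    if "f \<in> slice I A J g (cut_off_by (J, w))" for f
  proof -
    have "f a = g a" "f b = g b" "f c = g c" using that abc by (simp_all add: slice_def)
    moreover have "cut_off_by (J, w) f" using that by (simp add: slice_def)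
    ultimately show ?thesis using i w unfolding cut_off_by_def by fastforce
  qed
  show "\<exists>a b c. (\<forall>x\<in>(\<lambda>f. f i) ` slice I A J g (cut_off_by (J, w)). 0 < ori a b c x) \<and>
      (\<forall>j\<in>J - {i}. \<forall>x\<in>(\<lambda>f. f j) ` slice I A J g (cut_off_by (J, w)). ori a b c x < 0)"
    using side by (intro exI[of _ "g a"] exI[of _ "g b"] exI[of _ "g c"]) simp
qed

lemma cut_off_family_in_parts:
  assumes I: "finite I" and s: "0 < s" and A: "\<And>i. i \<in> I \<Longrightarrow> finite (A i) \<and> card (A i) = s"
    and disj: "disjoint_family_on A I" and cut: "\<And>f. f \<in> PiE I A \<Longrightarrow> cut_off_points (f ` I) m"
  shows "\<exists>J\<subseteq>I. \<exists>B. card J = m \<and> cut_off_family J B \<and> (\<forall>i\<in>J. B i \<subseteq> A i) \<and>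
    s ^ m \<le> (card I ^ 4) ^ m * (\<Prod>i\<in>J. card (B i))"
proof -
  let ?T = "cut_off_codes I m"
  have cover: "\<exists>t\<in>?T. cut_off_by t f" if f: "f \<in> PiE I A" for f
    by (rule cut_off_code_exists[OF PiE_disjoint_inj_on[OF f disj] cut[OF f]])
  have V: "fst t \<subseteq> I" if "t \<in> ?T" for t using that by (auto simp: cut_off_codes_def)
  obtain t g where t: "t \<in> ?T" and large: "s ^ card (fst t) \<le> card ?T *
      (\<Prod>i\<in>fst t. card ((\<lambda>f. f i) ` slice I A (fst t) g (cut_off_by t)))"
    using product_pigeonhole[of I A s ?T cut_off_by fst, OF I A s card_cut_off_codes_le(1)[OF I] cover V]
    by blast
  obtain J w where Jw: "t = (J, w)" by fastforce
  have J: "J \<subseteq> I" "card J = m" using t by (auto simp: Jw cut_off_codes_def)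
  define B where "B i = (\<lambda>f. f i) ` slice I A J g (cut_off_by (J, w))" for i
  have "cut_off_family J B" using cut_off_family_of_slice t unfolding B_def Jw by blast
  moreover have "B i \<subseteq> A i" if "i \<in> J" for i unfolding B_def by (rule coordinate_slice_subset[OF J(1) that])
  moreover have "s ^ m \<le> card ?T * (\<Prod>i\<in>J. card (B i))" using large J(2) by (simp add: Jw B_def)
  then have "s ^ m \<le> (card I ^ 4) ^ m * (\<Prod>i\<in>J. card (B i))"
    unfolding power_mult[symmetric] using mult_le_mono1[OF card_cut_off_codes_le(2)[OF I]] by (rule le_trans)
  ultimately show ?thesis using J by blast
qed

lemma cut_off_family_subset: "cut_off_family J B \<Longrightarrow> J' \<subseteq> J \<Longrightarrow> cut_off_family J' B"
  unfolding cut_off_family_def by (meson Diff_mono in_mono order_refl)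

theorem cut_off_family_exists:
  assumes X: "finite X" and S: "0 < S" "S \<le> card X"
    and cut: "\<And>Y. Y \<subseteq> X \<Longrightarrow> card Y = S \<Longrightarrow> cut_off_points Y (2 * n)"
  shows "\<exists>(J :: nat set) B. finite J \<and> card J = n \<and> cut_off_family J B \<and>
    (\<forall>i\<in>J. B i \<subseteq> X \<and> card X \<le> 2 * S ^ 9 * card (B i))"
proof -
  define s where "s = card X div S"
  have s: "0 < s" using S by (simp add: s_def div_greater_zero_iff)
  have "S * s \<le> card X" by (simp add: s_def)
  then obtain A where A: "\<And>i. i < S \<Longrightarrow> A i \<subseteq> X \<and> card (A i) = s" "disjoint_family_on A {..<S}"
    using disjoint_parts_exist[OF X] by blast
  have finA: "finite (A i) \<and> card (A i) = s" if "i \<in> {..<S}" for i using A(1) that X finite_subset by blast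
  have "cut_off_points (f ` {..<S}) (2 * n)" if f: "f \<in> PiE {..<S} A" for f
  proof (rule cut)
    show "f ` {..<S} \<subseteq> X" using PiE_mem[OF f] A(1) by fastforce
    show "card (f ` {..<S}) = S" using PiE_disjoint_inj_on[OF f A(2)] by (simp add: card_image)
  qed
  from cut_off_family_in_parts[OF finite_lessThan s finA A(2) this]
  obtain J B where J: "J \<subseteq> {..<S}" "card J = 2 * n" "cut_off_family J B" "\<forall>i\<in>J. B i \<subseteq> A i"
    and large: "s ^ (2 * n) \<le> (S ^ 4) ^ (2 * n) * (\<Prod>i\<in>J. card (B i))" by auto
  have finJ: "finite J" using J(1) finite_subset by blast
  define G where "G = {i \<in> J. s \<le> (S ^ 4) ^ 2 * card (B i)}"
  have "card (B i) \<le> s" if "i \<in> J" for i using J(1,4) finA[of i] that card_mono by (metis subsetD)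
  then have "2 * n \<le> 2 * card G"
    using half_of_factors_large[of J s "S ^ 4" "\<lambda>i. card (B i)"] finJ s S(1) J(2) large by (simp add: G_def)
  then obtain G' where G': "G' \<subseteq> G" "card G' = n"
    by (meson mult_le_cancel1 obtain_subset_with_card_n zero_less_numeral)
  then have "G' \<subseteq> J" by (auto simp: G_def)
  then have "finite G'" "cut_off_family G' B" using finJ finite_subset cut_off_family_subset[OF J(3)] by blast+
  moreover have "B i \<subseteq> X \<and> card X \<le> 2 * S ^ 9 * card (B i)" if "i \<in> G'" for i
  proof
    have i: "i \<in> J" "s \<le> S ^ 8 * card (B i)" using that G'(1) by (auto simp: G_def simp flip: power_mult)
    show "B i \<subseteq> X" using J(1,4) A(1)[of i] i(1) by auto
    have "card X < S * (s + 1)" using dividend_less_times_div[of S "card X"] S(1) by (simp add: s_def)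
    also have "\<dots> \<le> S * (2 * s)" using s by (intro mult_le_mono2) simp
    also have "\<dots> \<le> S * (2 * (S ^ 8 * card (B i)))" using i(2) by (intro mult_le_mono2)
    also have "\<dots> = 2 * S ^ 9 * card (B i)" using power_Suc[of S 8] by simp
    finally show "card X \<le> 2 * S ^ 9 * card (B i)" by simp
  qed
  ultimately show ?thesis using G'(2) by (intro exI[of _ G'] exI[of _ B]) simp
qed

end

section \<open>Generic projections\<close>

lemma general_position_subset:
  fixes X :: "'a::euclidean_space set"
  assumes "general_position X" "Y \<subseteq> X" "DIM('a) + 1 \<le> card Y"
  shows "general_position Y"
  using assms unfolding general_position_def by (meson order_trans)

lemma general_position_imp_affine_independent:
  fixes X :: "'a::euclidean_space set"
  assumes X: "finite X" "general_position X" and Q: "Q \<subseteq> X" "card Q \<le> DIM('a) + 1"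
  shows "\<not> affine_dependent Q"
proof -
  have "DIM('a) + 1 \<le> card X" using X unfolding general_position_def by blast
  then obtain S where S: "Q \<subseteq> S" "S \<subseteq> X" "card S = DIM('a) + 1"
    using exists_subset_between[OF Q(2) _ Q(1) X(1)] by blast
  have "\<not> aff_dim S < DIM('a)"
  proof
    assume "aff_dim S < DIM('a)"
    then obtain a b where "a \<noteq> 0" "S \<subseteq> {x. a \<bullet> x = b}" by (rule aff_lowdim_subset_hyperplane)
    then show False using X(2) S(2,3) unfolding general_position_def by blast
  qed
  moreover have "finite S" using S(2) X(1) finite_subset by blast
  ultimately have "\<not> affine_dependent S"
    using aff_dim_le_card[of S] S(3) by (simp add: affine_independent_iff_card)
  then show ?thesis using S(1) by (rule affine_independent_subset)
qed

definition constant_functionals :: "'a::euclidean_space set \<Rightarrow> 'a set" where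
  "constant_functionals Q = {z. \<forall>x\<in>Q. \<forall>y\<in>Q. z \<bullet> x = z \<bullet> y}"

lemma dim_constant_functionals:
  fixes Q :: "'a::euclidean_space set"
  assumes "\<not> affine_dependent Q" "Q \<noteq> {}"
  shows "dim (constant_functionals Q) + card Q = DIM('a) + 1"
proof -
  obtain q where q: "q \<in> Q" using assms(2) by blast
  let ?W = "span ((\<lambda>x. x - q) ` Q)"
  have mem: "z \<in> constant_functionals Q \<longleftrightarrow> (\<forall>x\<in>Q. orthogonal z (x - q))" for z
    unfolding constant_functionals_def orthogonal_def inner_diff_right mem_Collect_eq
    using q by (metis eq_iff_diff_eq_0)
  have "constant_functionals Q = {y \<in> UNIV. \<forall>x\<in>?W. orthogonal x y}"
  proof (intro set_eqI iffI)
    fix z assume "z \<in> constant_functionals Q"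
    then have "orthogonal z x" if "x \<in> ?W" for x
      using mem by (intro orthogonal_to_span[OF that]) auto
    then show "z \<in> {y \<in> UNIV. \<forall>x\<in>?W. orthogonal x y}" by (simp add: orthogonal_commute)
  next
    fix z assume "z \<in> {y \<in> UNIV. \<forall>x\<in>?W. orthogonal x y}"
    then have "orthogonal z (x - q)" if "x \<in> Q" for x
      using that span_base[of "x - q" "(\<lambda>x. x - q) ` Q"] by (simp add: orthogonal_commute[of z])
    then show "z \<in> constant_functionals Q" using mem by blast
  qed
  moreover have "dim {y \<in> UNIV. \<forall>x\<in>?W. orthogonal x y} + dim ?W = dim (UNIV :: 'a set)"
    by (rule dim_subspace_orthogonal_to_vectors) auto
  moreover have "int (dim ?W) = int (card Q) - 1"
    using aff_dim_eq_dim_subtract[OF hull_inc[OF q, of affine]] assms(1)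
    by (simp add: affine_independent_iff_card)
  ultimately show ?thesis by simp
qed

lemma avoid_lowdim_sets:
  fixes \<S> :: "'a::euclidean_space set set"
  assumes "finite \<S>" "\<And>S. S \<in> \<S> \<Longrightarrow> dim S < DIM('a)"
  shows "\<exists>r. \<forall>S\<in>\<S>. r \<notin> S"
proof -
  have "negligible (\<Union>\<S>)" using assms by (intro negligible_Union negligible_lowdim)
  then have "\<Union>\<S> \<noteq> UNIV" using non_negligible_UNIV by metis
  then show ?thesis by blast
qed

lemma dim_Un_le_card:
  fixes S T :: "'a::euclidean_space set"
  assumes "finite T"
  shows "dim (S \<union> T) \<le> dim S + card T"
  using assms
proof (induction T)
  case (insert t T)
  have "dim (S \<union> insert t T) \<le> dim (S \<union> T) + 1" by (simp add: dim_insert)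
  then show ?case using insert by simp
qed simp

lemma generic_vectors_exist:
  fixes \<U> :: "'a::euclidean_space set set"
  assumes "finite I" "finite \<U>" "\<And>U. U \<in> \<U> \<Longrightarrow> dim U + card I \<le> DIM('a)"
  shows "\<exists>r. \<forall>U\<in>\<U>. \<forall>a. (\<Sum>i\<in>I. a i *\<^sub>R r i) \<in> U \<longrightarrow> (\<forall>i\<in>I. a i = 0)"
  using assms(1,3)
proof (induction I)
  case (insert i I)
  obtain r where r: "\<And>U a. \<lbrakk>U \<in> \<U>; (\<Sum>j\<in>I. a j *\<^sub>R r j) \<in> U\<rbrakk> \<Longrightarrow> \<forall>j\<in>I. a j = 0"
    using insert.IH insert.prems insert.hyps by fastforce
  have "dim (U \<union> r ` I) < DIM('a)" if "U \<in> \<U>" for U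
  proof -
    have "dim (U \<union> r ` I) \<le> dim U + card (r ` I)" using insert.hyps(1) by (intro dim_Un_le_card) simp
    also have "card (r ` I) \<le> card I" using insert.hyps(1) by (rule card_image_le)
    finally show ?thesis using insert.prems[OF that] insert.hyps by simp
  qed
  then have "\<exists>v. \<forall>S\<in>(\<lambda>U. span (U \<union> r ` I)) ` \<U>. v \<notin> S"
    using assms(2) by (intro avoid_lowdim_sets) auto
  then obtain v where v: "\<And>U. U \<in> \<U> \<Longrightarrow> v \<notin> span (U \<union> r ` I)" by blast
  have "\<forall>j\<in>insert i I. a j = 0" if U: "U \<in> \<U>" "(\<Sum>j\<in>insert i I. a j *\<^sub>R (r(i := v)) j) \<in> U" for U a
  proof -
    let ?w = "\<Sum>j\<in>I. a j *\<^sub>R r j"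
    have "(\<Sum>j\<in>I. a j *\<^sub>R (r(i := v)) j) = ?w" using insert.hyps(2) by (intro sum.cong) auto
    then have sum: "a i *\<^sub>R v + ?w \<in> U" using U(2) insert.hyps by simp
    have "a i = 0"
    proof (rule ccontr)
      assume "a i \<noteq> 0"
      have "?w \<in> span (U \<union> r ` I)" by (intro span_sum span_scale span_base) auto
      moreover have "a i *\<^sub>R v + ?w \<in> span (U \<union> r ` I)" using sum by (intro span_base) simp
      ultimately have "a i *\<^sub>R v \<in> span (U \<union> r ` I)" using span_diff by fastforce
      then have "inverse (a i) *\<^sub>R a i *\<^sub>R v \<in> span (U \<union> r ` I)" by (rule span_scale)
      then show False using v[OF U(1)] \<open>a i \<noteq> 0\<close> by simp
    qed
    then show ?thesis using sum r[OF U(1), of a] by simp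
  qed
  then show ?case by blast
qed simp

lemma generic_linear_map_exists:
  fixes \<Q> :: "'a::euclidean_space set set"
  assumes "finite \<Q>" "\<And>Q. Q \<in> \<Q> \<Longrightarrow> \<not> affine_dependent Q \<and> card Q = DIM('b::euclidean_space) + 1"
  shows "\<exists>f :: 'a \<Rightarrow> 'b. linear f \<and> (\<forall>Q\<in>\<Q>. \<forall>a c. f ` Q \<subseteq> {y. a \<bullet> y = c} \<longrightarrow> a = 0)"
proof -
  have "dim (constant_functionals Q) + card (Basis :: 'b set) \<le> DIM('a)" if "Q \<in> \<Q>" for Q
    using dim_constant_functionals[of Q] assms(2)[OF that] by (cases "Q = {}") auto
  then have "\<exists>r. \<forall>U\<in>constant_functionals ` \<Q>. \<forall>a. (\<Sum>b\<in>Basis. a b *\<^sub>R r b) \<in> U \<longrightarrow>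
      (\<forall>b\<in>(Basis :: 'b set). a b = 0)"
    using assms(1) by (intro generic_vectors_exist) auto
  then obtain r :: "'b \<Rightarrow> 'a" where r: "\<And>Q a. \<lbrakk>Q \<in> \<Q>; (\<Sum>b\<in>Basis. a b *\<^sub>R r b) \<in> constant_functionals Q\<rbrakk> \<Longrightarrow>
      \<forall>b\<in>Basis. a b = 0"
    by blast
  define f where "f x = (\<Sum>b\<in>Basis. (r b \<bullet> x) *\<^sub>R b)" for x
  have "linear f"
    by (rule linearI) (simp_all add: f_def inner_add_right scaleR_add_left sum.distrib scaleR_sum_right)
  moreover have "a = 0" if Q: "Q \<in> \<Q>" "f ` Q \<subseteq> {y. a \<bullet> y = c}" for Q a c
  proof -
    have adjoint: "a \<bullet> f x = (\<Sum>b\<in>Basis. (a \<bullet> b) *\<^sub>R r b) \<bullet> x" for x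
      by (simp add: f_def inner_sum_right inner_sum_left mult.commute)
    have "a \<bullet> f x = c" if "x \<in> Q" for x using Q(2) that by auto
    then have "(\<Sum>b\<in>Basis. (a \<bullet> b) *\<^sub>R r b) \<in> constant_functionals Q"
      unfolding constant_functionals_def mem_Collect_eq adjoint[symmetric] by simp
    from r[OF Q(1) this] show ?thesis by (simp add: euclidean_all_zero_iff)
  qed
  ultimately show ?thesis by blast
qed

lemma inj_on_if_simplices_spread:
  fixes f :: "'a \<Rightarrow> 'b::euclidean_space"
  assumes X: "finite X" "DIM('b) + 1 \<le> card X"
    and spread: "\<And>Q a c. \<lbrakk>Q \<subseteq> X; card Q = DIM('b) + 1; f ` Q \<subseteq> {y. a \<bullet> y = c}\<rbrakk> \<Longrightarrow> a = 0"
  shows "inj_on f X"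
proof (rule inj_onI, rule ccontr)
  fix x y assume xy: "x \<in> X" "y \<in> X" "f x = f y" "x \<noteq> y"
  have "card {x, y} \<le> DIM('b) + 1" using xy(4) DIM_positive[where 'a = 'b] by (simp add: Suc_leI)
  then obtain Q where Q: "{x, y} \<subseteq> Q" "Q \<subseteq> X" "card Q = DIM('b) + 1"
    using exists_subset_between[of "{x, y}" "DIM('b) + 1" X] xy(1,2) X by blast
  have finQ: "finite Q" using Q(2) X(1) finite_subset by blast
  have "f y \<in> f ` (Q - {y})" using Q(1) xy(3,4) by (intro image_eqI[of _ _ x]) auto
  moreover have "Q = insert y (Q - {y})" using Q(1) by blast
  ultimately have "f ` Q = f ` (Q - {y})" by (metis image_insert insert_absorb)
  then have "card (f ` Q) \<le> DIM('b)" using card_image_le[of "Q - {y}" f] finQ Q by simp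
  then have "aff_dim (f ` Q) < DIM('b)" using aff_dim_le_card[of "f ` Q"] finQ by simp
  then obtain a c where "a \<noteq> 0" "f ` Q \<subseteq> {y. a \<bullet> y = c}" by (rule aff_lowdim_subset_hyperplane)
  then show False using spread Q(2,3) by blast
qed

theorem generic_projection_exists:
  fixes X :: "'a::euclidean_space set"
  assumes d: "DIM('b::euclidean_space) \<le> DIM('a)" and X: "finite X" "general_position X"
  shows "\<exists>f :: 'a \<Rightarrow> 'b. linear f \<and> inj_on f X \<and> general_position (f ` X)"
proof -
  let ?simplices = "{Q. Q \<subseteq> X \<and> card Q = DIM('b) + 1}"
  have "finite ?simplices" using X(1) by simp
  moreover have "\<not> affine_dependent Q \<and> card Q = DIM('b) + 1" if "Q \<in> ?simplices" for Q
    using general_position_imp_affine_independent[OF X] that d by simp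
  ultimately have "\<exists>f :: 'a \<Rightarrow> 'b. linear f \<and> (\<forall>Q\<in>?simplices. \<forall>a c. f ` Q \<subseteq> {y. a \<bullet> y = c} \<longrightarrow> a = 0)"
    by (rule generic_linear_map_exists)
  then obtain f :: "'a \<Rightarrow> 'b" where f: "linear f"
    and "\<forall>Q\<in>?simplices. \<forall>a c. f ` Q \<subseteq> {y. a \<bullet> y = c} \<longrightarrow> a = 0"
    by (elim exE conjE)
  then have spread: "a = 0" if "Q \<subseteq> X" "card Q = DIM('b) + 1" "f ` Q \<subseteq> {y. a \<bullet> y = c}" for Q a c
    using that by blast
  have size: "DIM('b) + 1 \<le> card X" using X d unfolding general_position_def by auto
  have inj: "inj_on f X" using X(1) size spread by (rule inj_on_if_simplices_spread)
  have "general_position (f ` X)"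
    unfolding general_position_def
  proof (intro conjI impI notI)
    show "DIM('b) + 1 \<le> card (f ` X)" using inj size by (simp add: card_image)
    assume "\<exists>S a c. S \<subseteq> f ` X \<and> card S = DIM('b) + 1 \<and> a \<noteq> 0 \<and> S \<subseteq> {x. a \<bullet> x = c}"
    then obtain S a c where S: "S \<subseteq> f ` X" "card S = DIM('b) + 1" "a \<noteq> 0" "S \<subseteq> {x. a \<bullet> x = c}" by blast
    then obtain Q where "Q \<subseteq> X" "inj_on f Q" "S = f ` Q" by (meson subset_image_inj)
    then show False using spread[of Q a c] S by (simp add: card_image)
  qed
  then show ?thesis using f inj by blast
qed

section \<open>Sets and families in convex position\<close>

lemma convex_positionI:
  assumes "finite P" "\<And>x. x \<in> P \<Longrightarrow> x \<notin> convex hull (P - {x})"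
  shows "convex_position P"
  unfolding convex_position_def
proof (intro exI conjI)
  show "polytope (convex hull P)" using assms(1) unfolding polytope_def by blast
  show "P = {x. x extreme_point_of (convex hull P)}"
    using extreme_point_of_convex_hull_convex_independent[OF finite_imp_compact[OF assms(1)] assms(2)] by blast
qed

lemma convex_positionD:
  assumes "convex_position P" "x \<in> P"
  shows "x \<notin> convex hull (P - {x})"
proof -
  obtain K where K: "polytope K" "P = {v. v extreme_point_of K}"
    using assms(1) unfolding convex_position_def by blast
  have "convex (K - {x})"
    using extreme_point_of_stillconvex[OF polytope_imp_convex[OF K(1)]] assms(2) K(2) by blast
  moreover have "P - {x} \<subseteq> K - {x}" using K(2) by (auto simp: extreme_point_of_def)
  ultimately have "convex hull (P - {x}) \<subseteq> K - {x}" by (intro hull_minimal)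
  then show ?thesis by blast
qed

lemma family_convex_position_mono:
  assumes X: "family_convex_position I X" and sub: "J \<subseteq> I" "\<And>j. j \<in> J \<Longrightarrow> Y j \<subseteq> X j"
  shows "family_convex_position J Y"
  unfolding family_convex_position_def
proof
  fix i assume i: "i \<in> J"
  have "convex hull (Y i) \<subseteq> convex hull (X i)" using sub(2)[OF i] by (rule hull_mono)
  moreover have "(\<Union>j\<in>J - {i}. Y j) \<subseteq> (\<Union>j\<in>I - {i}. X j)" using sub by blast
  then have "convex hull (\<Union>j\<in>J - {i}. Y j) \<subseteq> convex hull (\<Union>j\<in>I - {i}. X j)" by (rule hull_mono)
  moreover have "convex hull (X i) \<inter> convex hull (\<Union>j\<in>I - {i}. X j) = {}"
    using X i sub(1) unfolding family_convex_position_def by blast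
  ultimately show "convex hull (Y i) \<inter> convex hull (\<Union>j\<in>J - {i}. Y j) = {}" by blast
qed

lemma family_convex_position_reindex:
  assumes "inj_on h I" "family_convex_position (h ` I) X"
  shows "family_convex_position I (X \<circ> h)"
  unfolding family_convex_position_def
proof
  fix i assume i: "i \<in> I"
  have "h ` (I - {i}) = h ` I - {h i}" using assms(1) i by (auto simp: inj_on_def)
  then have "(\<Union>j\<in>I - {i}. (X \<circ> h) j) = (\<Union>j\<in>h ` I - {h i}. X j)" by (metis image_comp)
  then show "convex hull ((X \<circ> h) i) \<inter> convex hull (\<Union>j\<in>I - {i}. (X \<circ> h) j) = {}"
    using assms(2) i unfolding family_convex_position_def by simp
qed

lemma family_convex_position_linear_image:
  assumes "linear f" "family_convex_position I (\<lambda>i. f ` X i)"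
  shows "family_convex_position I X"
  unfolding family_convex_position_def
proof (intro ballI equals0I)
  fix i z assume i: "i \<in> I" and z: "z \<in> convex hull X i \<inter> convex hull (\<Union>j\<in>I - {i}. X j)"
  have "f z \<in> f ` (convex hull X i)" "f z \<in> f ` (convex hull (\<Union>j\<in>I - {i}. X j))" using z by auto
  then have "f z \<in> convex hull (f ` X i)" "f z \<in> convex hull (\<Union>j\<in>I - {i}. f ` X j)"
    using assms(1) by (simp_all add: convex_hull_linear_image image_UN)
  then show False using assms(2) i unfolding family_convex_position_def by blast
qed

lemma family_convex_position_singletons:
  "convex_position P \<Longrightarrow> family_convex_position P (\<lambda>x. {x})"
  using convex_positionD unfolding family_convex_position_def by fastforce

lemma convex_position_of_representatives:
  assumes "finite I" "family_convex_position I X" "\<And>i. i \<in> I \<Longrightarrow> x i \<in> X i"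
  shows "inj_on x I" "convex_position (x ` I)"
proof -
  have "family_convex_position I (\<lambda>i. {x i})"
    by (rule family_convex_position_mono[OF assms(2) order_refl]) (use assms(3) in simp)
  then have sep: "x i \<notin> convex hull (x ` (I - {i}))" if "i \<in> I" for i
    using that by (simp add: family_convex_position_def UNION_singleton_eq_range)
  show inj: "inj_on x I"
  proof (rule inj_onI, rule ccontr)
    fix i j assume ij: "i \<in> I" "j \<in> I" "x i = x j" "i \<noteq> j"
    then have "x i \<in> x ` (I - {i})" by auto
    then show False using sep[OF ij(1)] hull_inc by metis
  qed
  show "convex_position (x ` I)"
  proof (rule convex_positionI)
    fix y assume "y \<in> x ` I"
    then obtain i where i: "i \<in> I" "y = x i" by blast
    have "x ` I - {y} = x ` (I - {i})" using inj i by (auto simp: inj_on_def)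
    then show "y \<notin> convex hull (x ` I - {y})" using sep i by simp
  qed (use assms(1) in simp)
qed

definition convex_fraction_family :: "nat \<Rightarrow> real \<Rightarrow> 'a::euclidean_space set \<Rightarrow> bool" where
  "convex_fraction_family n \<epsilon> \<X> \<longleftrightarrow> (\<exists>X :: nat \<Rightarrow> 'a set. (\<forall>i\<in>{1..n}. X i \<subseteq> \<X>) \<and>
     family_convex_position {1..n} X \<and> (\<forall>i\<in>{1..n}. real (card (X i)) \<ge> \<epsilon> * real (card \<X>)))"

lemma convex_fraction_familyI:
  assumes "finite J" "card J = n" "family_convex_position J B"
    and "\<And>j. j \<in> J \<Longrightarrow> B j \<subseteq> X" "\<And>j. j \<in> J \<Longrightarrow> \<epsilon> * real (card X) \<le> real (card (B j))"
  shows "convex_fraction_family n \<epsilon> X"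
proof -
  obtain h where h: "bij_betw h {1..n} J"
    using finite_same_card_bij[of "{1..n}" J] assms(1,2) by auto
  then have "family_convex_position {1..n} (B \<circ> h)"
    using family_convex_position_reindex[of h "{1..n}" B] assms(3) by (simp add: bij_betw_def)
  moreover have "h i \<in> J" if "i \<in> {1..n}" for i using h that by (rule bij_betwE[THEN bspec])
  ultimately show ?thesis
    unfolding convex_fraction_family_def using assms(4,5) by (intro exI[of _ "B \<circ> h"]) auto
qed

lemma convex_fraction_family_mono:
  assumes "convex_fraction_family n' \<epsilon> X" "n \<le> n'"
  shows "convex_fraction_family n \<epsilon> X"
proof -
  have sub: "{1..n} \<subseteq> {1..n'}" using assms(2) by simp
  obtain Y where Y: "\<forall>i\<in>{1..n'}. Y i \<subseteq> X" "family_convex_position {1..n'} Y"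
    "\<forall>i\<in>{1..n'}. \<epsilon> * real (card X) \<le> real (card (Y i))"
    using assms(1) unfolding convex_fraction_family_def by blast
  then show ?thesis
    unfolding convex_fraction_family_def
    using family_convex_position_mono[OF Y(2) sub] sub by (intro exI[of _ Y]) auto
qed

lemma convex_fraction_family_linear_preimage:
  assumes f: "linear f" "inj_on f X" and "convex_fraction_family n \<epsilon> (f ` X)"
  shows "convex_fraction_family n \<epsilon> X"
proof -
  obtain B where B: "\<forall>i\<in>{1..n}. B i \<subseteq> f ` X" "family_convex_position {1..n} B"
    "\<forall>i\<in>{1..n}. \<epsilon> * real (card X) \<le> real (card (B i))"
    using assms(3) f(2) unfolding convex_fraction_family_def by (auto simp: card_image)
  define Y where "Y i = {x \<in> X. f x \<in> B i}" for i
  have image: "f ` Y i = B i" if "i \<in> {1..n}" for i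
  proof -
    have "B i \<subseteq> f ` X" using B(1) that by blast
    then show ?thesis by (auto simp: Y_def)
  qed
  then have "family_convex_position {1..n} (\<lambda>i. f ` Y i)"
    using family_convex_position_mono[OF B(2) order_refl] by simp
  then have "family_convex_position {1..n} Y" by (rule family_convex_position_linear_image[OF f(1)])
  moreover have "card (Y i) = card (B i)" if "i \<in> {1..n}" for i
    using card_image[OF inj_on_subset[OF f(2), of "Y i"]] image[OF that] by (auto simp: Y_def)
  ultimately show ?thesis
    unfolding convex_fraction_family_def using B(3) by (intro exI[of _ Y]) (auto simp: Y_def)
qed

lemma convex_fraction_family_of_convex_position:
  assumes "finite P" "convex_position P" "P \<subseteq> X" "n \<le> card P" "\<epsilon> * real (card X) \<le> 1"
  shows "convex_fraction_family n \<epsilon> X"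
proof -
  obtain J where J: "J \<subseteq> P" "card J = n" using assms(4) by (meson obtain_subset_with_card_n)
  have "family_convex_position J (\<lambda>x. {x})"
    by (rule family_convex_position_mono[OF family_convex_position_singletons[OF assms(2)] J(1)]) simp
  then show ?thesis
    using J finite_subset[OF J(1) assms(1)] assms(3,5) by (intro convex_fraction_familyI[of J _ "\<lambda>x. {x}"]) auto
qed

lemma convex_position_of_convex_fraction_family:
  assumes "convex_fraction_family n \<epsilon> X" "\<epsilon> > 0" "finite X" "X \<noteq> {}"
  shows "\<exists>P\<subseteq>X. card P = n \<and> convex_position P"
proof -
  obtain Y where Y: "\<forall>i\<in>{1..n}. Y i \<subseteq> X" "family_convex_position {1..n} Y"
    "\<forall>i\<in>{1..n}. \<epsilon> * real (card X) \<le> real (card (Y i))"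
    using assms(1) unfolding convex_fraction_family_def by blast
  have "0 < \<epsilon> * real (card X)" using assms(2-4) by (simp add: card_gt_0_iff)
  then have "Y i \<noteq> {}" if "i \<in> {1..n}" for i using Y(3) that by fastforce
  then have "\<forall>i\<in>{1..n}. \<exists>x. x \<in> Y i" by blast
  then obtain x where "\<forall>i\<in>{1..n}. x i \<in> Y i" by (rule bchoice[THEN exE])
  then have x: "\<And>i. i \<in> {1..n} \<Longrightarrow> x i \<in> Y i" by blast
  note reps = convex_position_of_representatives[OF _ Y(2) x]
  have "x ` {1..n} \<subseteq> X" using x Y(1) by blast
  moreover have "card (x ` {1..n}) = n" using reps(1) by (simp add: card_image)
  ultimately show ?thesis using reps(2) by blast
qed

lemma convex_position_if_card_ge_ES:
  fixes X :: "'a::euclidean_space set"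
  assumes ex: "\<exists>N \<ge> DIM('a) + 1. \<forall>X :: 'a set. finite X \<and> card X = N \<and> general_position X \<longrightarrow>
      (\<exists>P\<subseteq>X. card P = n \<and> convex_position P)"
    and X: "finite X" "general_position X" "ES TYPE('a) n \<le> card X"
  shows "\<exists>P\<subseteq>X. card P = n \<and> convex_position P"
proof -
  let ?N = "ES TYPE('a) n"
  have N: "?N \<ge> DIM('a) + 1 \<and> (\<forall>X :: 'a set. finite X \<and> card X = ?N \<and> general_position X \<longrightarrow>
      (\<exists>P\<subseteq>X. card P = n \<and> convex_position P))"
    unfolding ES_def using ex by (rule LeastI_ex)
  obtain Y where Y: "Y \<subseteq> X" "card Y = ?N" using X(3) by (meson obtain_subset_with_card_n)
  have "general_position Y" using general_position_subset[OF X(2) Y(1)] N Y(2) by simp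
  moreover have "finite Y" using Y(1) X(1) finite_subset by blast
  ultimately obtain P where "P \<subseteq> Y" "card P = n" "convex_position P" using N Y(2) by blast
  then show ?thesis using Y(1) by blast
qed

section \<open>Positive fractions in three dimensions\<close>

definition orient3 :: "real ^ 3 \<Rightarrow> real ^ 3 \<Rightarrow> real ^ 3 \<Rightarrow> real ^ 3 \<Rightarrow> real" where
  "orient3 a b c d = cross3 (b - a) (c - a) \<bullet> (d - a)"

interpretation orient3: chirotope orient3
proof
  show "orient3 b a c d = - orient3 a b c d" "orient3 a c b d = - orient3 a b c d"
    "orient3 a b d c = - orient3 a b c d" for a b c d
    unfolding orient3_def inner_vec_def sum_3 cross_components vector_minus_component inner_real_def
    by algebra+
  have "cross3 u c \<bullet> d * (cross3 u e \<bullet> f) - cross3 u c \<bullet> e * (cross3 u d \<bullet> f) +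
    cross3 u c \<bullet> f * (cross3 u d \<bullet> e) = 0"
    for u c d e f
    unfolding inner_vec_def sum_3 cross_components inner_real_def by algebra
  then show "orient3 a b c d * orient3 a b e f - orient3 a b c e * orient3 a b d f +
    orient3 a b c f * orient3 a b d e = 0"
    for a b c d e f unfolding orient3_def .
qed

lemma orient3_less_0_iff: "orient3 a b c x < 0 \<longleftrightarrow> cross3 (b - a) (c - a) \<bullet> x < cross3 (b - a) (c - a) \<bullet> a"
  and orient3_greater_0_iff: "0 < orient3 a b c x \<longleftrightarrow> cross3 (b - a) (c - a) \<bullet> a < cross3 (b - a) (c - a) \<bullet> x"
  by (simp_all add: orient3_def inner_diff_right)

lemma family_convex_position_if_cut_off_family:
  assumes "orient3.cut_off_family J B"
  shows "family_convex_position J B"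
  unfolding family_convex_position_def
proof
  fix i assume "i \<in> J"
  then obtain a b c where pos: "\<forall>x\<in>B i. 0 < orient3 a b c x"
    and neg: "\<forall>j\<in>J - {i}. \<forall>x\<in>B j. orient3 a b c x < 0"
    using assms unfolding orient3.cut_off_family_def by blast
  have "convex hull B i \<subseteq> {x. 0 < orient3 a b c x}"
    using pos unfolding orient3_greater_0_iff by (intro hull_minimal convex_halfspace_gt) auto
  moreover have "convex hull (\<Union>j\<in>J - {i}. B j) \<subseteq> {x. orient3 a b c x < 0}"
    using neg unfolding orient3_less_0_iff by (intro hull_minimal convex_halfspace_lt) auto
  ultimately show "convex hull B i \<inter> convex hull (\<Union>j\<in>J - {i}. B j) = {}" by force
qed

lemma uniform_on_if_general_position:
  assumes X: "finite X" "general_position X"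
  shows "orient3.uniform_on X"
  unfolding orient3.uniform_on_def
proof (intro allI impI)
  fix a b c d assume abcd: "{a, b, c, d} \<subseteq> X" "distinct [a, b, c, d]"
  define n where "n = cross3 (b - a) (c - a)"
  have "card {a, b, c} \<le> DIM(real ^ 3) + 1" using abcd(2) by simp
  then have "\<not> affine_dependent {a, b, c}"
    using general_position_imp_affine_independent[OF X, of "{a, b, c}"] abcd(1) by simp
  then have "\<not> collinear {b, a, c}" using abcd(2) by (auto simp: collinear_3_eq_affine_dependent insert_commute)
  then have "n \<noteq> 0" unfolding n_def cross_eq_0 by (auto simp: collinear_def)
  show "orient3 a b c d \<noteq> 0"
  proof
    assume "orient3 a b c d = 0"
    moreover have "n \<bullet> (b - a) = 0" "n \<bullet> (c - a) = 0" by (simp_all add: n_def dot_cross_self)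
    ultimately have "{a, b, c, d} \<subseteq> {x. n \<bullet> x = n \<bullet> a}"
      by (simp add: orient3_def inner_diff_right flip: n_def)
    moreover have "card {a, b, c, d} = DIM(real ^ 3) + 1" using abcd(2) by simp
    ultimately show False using X(2) abcd(1) \<open>n \<noteq> 0\<close> unfolding general_position_def by blast
  qed
qed

definition positive_fraction3 :: "nat \<Rightarrow> nat \<Rightarrow> bool" where
  "positive_fraction3 n t \<longleftrightarrow> (\<forall>X :: (real ^ 3) set. finite X \<longrightarrow> general_position X \<longrightarrow> 2 ^ t \<le> card X \<longrightarrow>
     convex_fraction_family n (1 / 2 ^ t) X)"

lemma positive_fraction3_mono: "positive_fraction3 n' t \<Longrightarrow> n \<le> n' \<Longrightarrow> positive_fraction3 n t"
  unfolding positive_fraction3_def using convex_fraction_family_mono by blast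

lemma positive_fraction3_if_cut_off_points:
  assumes cut: "\<And>Y. finite Y \<Longrightarrow> orient3.uniform_on Y \<Longrightarrow> card Y = 2 ^ s \<Longrightarrow> orient3.cut_off_points Y (2 * n)"
  shows "positive_fraction3 n (9 * s + 1)"
  unfolding positive_fraction3_def
proof (intro allI impI)
  fix X :: "(real ^ 3) set"
  assume X: "finite X" "general_position X" "2 ^ (9 * s + 1) \<le> card X"
  have "(2::nat) ^ s \<le> 2 ^ (9 * s + 1)" by (intro power_increasing) auto
  then have "2 ^ s \<le> card X" using X(3) by linarith
  moreover have "orient3.cut_off_points Y (2 * n)" if "Y \<subseteq> X" "card Y = 2 ^ s" for Y
    using cut that finite_subset[OF _ X(1)]
      orient3.uniform_on_subset[OF uniform_on_if_general_position[OF X(1,2)]]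
    by blast
  ultimately obtain J :: "nat set" and B where J: "finite J" "card J = n" "orient3.cut_off_family J B"
    and B: "\<forall>i\<in>J. B i \<subseteq> X \<and> card X \<le> 2 * (2 ^ s) ^ 9 * card (B i)"
    using orient3.cut_off_family_exists[OF X(1), of "2 ^ s" n] by auto
  show "convex_fraction_family n (1 / 2 ^ (9 * s + 1)) X"
  proof (rule convex_fraction_familyI[OF J(1,2) family_convex_position_if_cut_off_family[OF J(3)]])
    fix i assume i: "i \<in> J"
    show "B i \<subseteq> X" using B i by blast
    have "card X \<le> 2 ^ (9 * s + 1) * card (B i)" using B i by (simp add: power_mult mult.commute[of 9])
    then have "real (card X) \<le> real (2 ^ (9 * s + 1) * card (B i))" by (rule of_nat_mono)
    then show "1 / 2 ^ (9 * s + 1) * real (card X) \<le> real (card (B i))" by (simp add: field_simps)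
  qed
qed

lemma eventually_positive_fraction3:
  fixes \<delta> :: real
  assumes "\<delta> > 0"
  shows "\<forall>\<^sub>F n in sequentially. \<exists>t. real t \<le> \<delta> * real n \<and> positive_fraction3 n t"
proof -
  define \<eta> where "\<eta> = \<delta> / 36"
  have \<eta>: "\<eta> > 0" using assms by (simp add: \<eta>_def)
  have "filterlim (\<lambda>n::nat. 2 * n) at_top sequentially"
    by (rule filterlim_subseq) (simp add: strict_mono_def)
  from eventually_compose_filterlim[OF orient3.cut_off_points_subexponential[OF \<eta>] this]
  have "\<forall>\<^sub>F n in sequentially. \<forall>Y. finite Y \<longrightarrow> orient3.uniform_on Y \<longrightarrow>
    2 powr (\<eta> * real (2 * n)) \<le> real (card Y) \<longrightarrow> orient3.cut_off_points Y (2 * n)" .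
  moreover have "\<forall>\<^sub>F n in sequentially. 20 / \<delta> \<le> real n"
    by (rule eventually_compose_filterlim[OF eventually_ge_at_top filterlim_real_sequentially])
  ultimately show ?thesis
  proof eventually_elim
    case (elim n)
    define s where "s = nat \<lceil>\<eta> * real (2 * n)\<rceil>"
    have s: "\<eta> * real (2 * n) \<le> real s" "real s < \<eta> * real (2 * n) + 1"
      using \<eta> unfolding s_def by (auto simp: of_nat_nat ceiling_less_iff) linarith
    have "20 \<le> \<delta> * real n" using elim(2) assms by (simp add: field_simps)
    then have "real (9 * s + 1) \<le> \<delta> * real n" using s(2) by (simp add: \<eta>_def)
    moreover have "2 powr (\<eta> * real (2 * n)) \<le> 2 powr real s" using s(1) by (intro powr_mono) auto
    then have "positive_fraction3 n (9 * s + 1)"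
      using elim(1) by (intro positive_fraction3_if_cut_off_points) (simp add: powr_realpow)
    ultimately show ?case by blast
  qed
qed

lemma positive_fraction3_exists: "\<exists>t. positive_fraction3 n t"
proof -
  have "\<forall>\<^sub>F m in sequentially. n \<le> m \<and> (\<exists>t. real t \<le> 1 * real m \<and> positive_fraction3 m t)"
    using eventually_ge_at_top eventually_positive_fraction3[of 1] by (simp add: eventually_conj)
  then obtain m where "n \<le> m" "\<exists>t. positive_fraction3 m t" using eventually_happens by fastforce
  then show ?thesis using positive_fraction3_mono by blast
qed

definition fraction_exponent :: "nat \<Rightarrow> nat" where
  "fraction_exponent n = (LEAST t. positive_fraction3 n t)"

lemma positive_fraction3_exponent: "positive_fraction3 n (fraction_exponent n)"
  unfolding fraction_exponent_def using positive_fraction3_exists by (rule LeastI_ex)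

lemma fraction_exponent_sublinear: "(\<lambda>n. real (fraction_exponent n)) \<in> o(\<lambda>n. real n)"
proof (rule landau_o.smallI)
  fix c :: real assume "c > 0"
  from eventually_positive_fraction3[OF this]
  show "\<forall>\<^sub>F n in sequentially. norm (real (fraction_exponent n)) \<le> c * norm (real n)"
  proof eventually_elim
    case (elim n)
    then obtain t where t: "real t \<le> c * real n" "positive_fraction3 n t" by blast
    have "fraction_exponent n \<le> t" unfolding fraction_exponent_def using t(2) by (rule Least_le)
    then show ?case using t(1) by simp
  qed
qed

lemma convex_position_if_card_ge_ES3:
  fixes X :: "(real ^ 3) set"
  assumes X: "finite X" "general_position X" "ES TYPE(real ^ 3) m \<le> card X"
  shows "\<exists>P\<subseteq>X. card P = m \<and> convex_position P"
proof (rule convex_position_if_card_ge_ES[OF _ X])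
  obtain t where t: "positive_fraction3 m t" using positive_fraction3_exists by blast
  have "\<exists>P\<subseteq>Y. card P = m \<and> convex_position P"
    if "finite Y" "card Y = 4 + 2 ^ t" "general_position Y" for Y :: "(real ^ 3) set"
  proof (rule convex_position_of_convex_fraction_family)
    show "convex_fraction_family m (1 / 2 ^ t) Y" using t that unfolding positive_fraction3_def by simp
    show "Y \<noteq> {}" using that(2) by auto
  qed (use that(1) in simp_all)
  then show "\<exists>N \<ge> DIM(real ^ 3) + 1. \<forall>Y :: (real ^ 3) set. finite Y \<and> card Y = N \<and> general_position Y \<longrightarrow>
      (\<exists>P\<subseteq>Y. card P = m \<and> convex_position P)"
    by (intro exI[of _ "4 + 2 ^ t"]) simp
qed

lemma convex_fraction_family_if_card_ge_ES3:
  fixes X :: "(real ^ 3) set"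
  assumes t: "positive_fraction3 n t" and X: "finite X" "general_position X"
    and card: "ES TYPE(real ^ 3) m \<le> card X" "n \<le> m"
  shows "convex_fraction_family n (1 / 2 ^ t) X"
proof (cases "2 ^ t \<le> card X")
  case True
  then show ?thesis using t X unfolding positive_fraction3_def by blast
next
  case False
  obtain P where P: "P \<subseteq> X" "card P = m" "convex_position P"
    using convex_position_if_card_ge_ES3[OF X card(1)] by blast
  have "real (card X) < 2 ^ t" using False by (metis not_le of_nat_less_numeral_power_cancel_iff)
  then show ?thesis
    using P X(1) finite_subset card(2) by (intro convex_fraction_family_of_convex_position[of P]) auto
qed

theorem theorem1p3:
  assumes "CARD('d::finite) \<ge> 3"
  shows "\<exists>\<epsilon>::nat \<Rightarrow> real.
    (\<forall>n\<ge>3. \<epsilon> n > 0) \<and>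
    (\<lambda>n. log 2 (1 / \<epsilon> n)) \<in> o(\<lambda>n. real n) \<and>
    (\<forall>n\<ge>3. \<forall>\<X>::(real ^ 'd) set.
       finite \<X> \<and> general_position \<X> \<and> card \<X> \<ge> ES TYPE(real ^ 3) (8 * n) \<longrightarrow>
       (\<exists>X::nat \<Rightarrow> (real ^ 'd) set.
          (\<forall>i\<in>{1..n}. X i \<subseteq> \<X>) \<and>
          family_convex_position {1..n} X \<and>
          (\<forall>i\<in>{1..n}. real (card (X i)) \<ge> \<epsilon> n * real (card \<X>))))"
proof (intro exI[of _ "\<lambda>n. 1 / 2 ^ fraction_exponent n"] conjI allI impI)
  show "(\<lambda>n. log 2 (1 / (1 / 2 ^ fraction_exponent n))) \<in> o(\<lambda>n. real n)"
    using fraction_exponent_sublinear by (simp add: log_nat_power)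
  fix n and \<X> :: "(real ^ 'd) set"
  assume "finite \<X> \<and> general_position \<X> \<and> card \<X> \<ge> ES TYPE(real ^ 3) (8 * n)"
  then have X: "finite \<X>" "general_position \<X>" "card \<X> \<ge> ES TYPE(real ^ 3) (8 * n)" by blast+
  obtain f :: "real ^ 'd \<Rightarrow> real ^ 3" where f: "linear f" "inj_on f \<X>" "general_position (f ` \<X>)"
    using generic_projection_exists[where 'b = "real ^ 3", OF _ X(1,2)] assms by auto
  have "convex_fraction_family n (1 / 2 ^ fraction_exponent n) (f ` \<X>)"
    using X f by (intro convex_fraction_family_if_card_ge_ES3[OF positive_fraction3_exponent, of _ "8 * n"])
      (simp_all add: card_image)
  then have "convex_fraction_family n (1 / 2 ^ fraction_exponent n) \<X>"
    by (rule convex_fraction_family_linear_preimage[OF f(1,2)])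
  then show "\<exists>X::nat \<Rightarrow> (real ^ 'd) set. (\<forall>i\<in>{1..n}. X i \<subseteq> \<X>) \<and> family_convex_position {1..n} X \<and>
      (\<forall>i\<in>{1..n}. real (card (X i)) \<ge> 1 / 2 ^ fraction_exponent n * real (card \<X>))"
    unfolding convex_fraction_family_def .
qed simp

end
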